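(* Let $\mathcal V=\mathrm{Alt}^{(2)}$ be the variety of alternative metabelian algebras over a field $F$ of characteristic $0$, i.e. the variety defined by $(x,x,y)=0$, $(x,y,y)=0$, $(xy)(zt)=0$. Then the supervarieties $\mathcal V_{r,s}$ satisfy the following relations, where $\subset$ denotes strict inclusion: (1) $\mathcal V_{r,0}\subset\mathcal V_{r+1,0}$ and $\mathcal V_{r,0}\subset\mathcal V_{r,1}$ for all $r\geqslant1$; (2) $\mathcal V_{0,1}\subset\mathcal V_{1,1}$, $\mathcal V_{0,2}\subset\mathcal V_{1,2}$, $\mathcal V_{0,1}=\mathcal V_{0,2}$, and $\mathcal V_{0,2}\subset\mathcal V_{0,3}$; (3) $\mathcal V_{r,s}=\mathcal V_{r+1,s}$ and $\mathcal V_{r,s}=\mathcal V_{r,s+1}$ for all $r\geqslant1$, $s\geqslant1$; (4) $\mathcal V_{0,s}=\mathcal V_{1,s}$ and $\mathcal V_{0,s}=\mathcal V_{0,s+1}$ for all $s\geqslant3$.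
   Context: All algebras are over a field $F$ of characteristic $0$ and are not assumed associative or unital. $(x,y,z)=(xy)z-x(yz)$ is the associator. A superalgebra is a $\mathbb Z_2$-graded algebra $\mathcal A=\mathcal A_0+\mathcal A_1$, $\mathcal A_i\mathcal A_j\subseteq\mathcal A_{i+j \bmod 2}$. $\mathrm G=\mathrm G_0+\mathrm G_1$ is the Grassmann algebra on countably many anticommuting generators $e_1,e_2,\dots$ ($\mathrm G_0$, $\mathrm G_1$ spanned by words of even, resp. odd, length). The Grassmann envelope of $\mathcal A$ is $\mathrm G(\mathcal A)=\mathrm G_0\otimes\mathcal A_0+\mathrm G_1\otimes\mathcal A_1\subseteq \mathrm G\otimes\mathcal A$. For a multilinear polynomial $f$, its superization $\tilde f$ is obtained by the Koszul sign rule (a sign $(-1)^{ij}$ whenever a variable of parity $i$ passes through one of parity $j$); $\mathcal A$ satisfies the superidentity $\tilde f=0$ if and only if $\mathrm G(\mathcal A)$ satisfies $f=0$. For a variety $\mathcal V$, a $\mathcal V$-superalgebra is a superalgebra $\mathcal A$ with $\mathrm G(\mathcal A)\in\mathcal V$. The supervariety generated by a superalgebra $\mathcal B$ is the class of all superalgebras satisfying every superidentity $\tilde f=0$ ($f$ multilinear) satisfied by $\mathcal B$. For nonnegative integers $(r,s)\ne(0,0)$, $\mathcal V_{r,s}$ is the supervariety generated by the free $\mathcal V$-superalgebra on $r$ even and $s$ odd generators. *)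

theory Defs
  imports
    "HOL-Algebra.QuotRing"
    "HOL-Algebra.Module"
    "HOL-Algebra.Algebraic_Closure_Type"
    "HOL-Library.Z2"
begin

section \<open>Nonassociative algebras and superalgebras\<close>

text \<open>
  Algebras live on the carrier of a \<open>module\<close> record over the ground field
  \<^term>\<open>ring_of_type_algebra :: 'f::field ring\<close>, i.e. over the type \<open>'f\<close> itself.
  The locale \<^locale>\<open>module\<close> puts no condition on the multiplication or on the
  component \<open>one\<close>; the latter plays no role, as algebras need not be unital.
\<close>

locale nonassoc_algebra =
  module "ring_of_type_algebra :: 'f ring" A
  for A :: "('f::field, 'a, 'm) module_scheme" (structure) +
  assumes mult_closed: "\<lbrakk>x \<in> carrier A; y \<in> carrier A\<rbrakk> \<Longrightarrow> x \<otimes> y \<in> carrier A"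
    and mult_add_left: "\<lbrakk>x \<in> carrier A; y \<in> carrier A; z \<in> carrier A\<rbrakk> \<Longrightarrow>
      (x \<oplus> y) \<otimes> z = x \<otimes> z \<oplus> y \<otimes> z"
    and mult_add_right: "\<lbrakk>x \<in> carrier A; y \<in> carrier A; z \<in> carrier A\<rbrakk> \<Longrightarrow>
      z \<otimes> (x \<oplus> y) = z \<otimes> x \<oplus> z \<otimes> y"
    and smult_mult_left: "\<lbrakk>x \<in> carrier A; y \<in> carrier A\<rbrakk> \<Longrightarrow>
      (c \<odot>\<^bsub>A\<^esub> x) \<otimes> y = c \<odot>\<^bsub>A\<^esub> (x \<otimes> y)"
    and smult_mult_right: "\<lbrakk>x \<in> carrier A; y \<in> carrier A\<rbrakk> \<Longrightarrow>
      x \<otimes> (c \<odot>\<^bsub>A\<^esub> y) = c \<odot>\<^bsub>A\<^esub> (x \<otimes> y)"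

definition associator :: "('f, 'a, 'm) module_scheme \<Rightarrow> 'a \<Rightarrow> 'a \<Rightarrow> 'a \<Rightarrow> 'a" where
  "associator A x y z = ((x \<otimes>\<^bsub>A\<^esub> y) \<otimes>\<^bsub>A\<^esub> z) \<ominus>\<^bsub>A\<^esub> (x \<otimes>\<^bsub>A\<^esub> (y \<otimes>\<^bsub>A\<^esub> z))"

text \<open>The variety of alternative metabelian algebras.\<close>

locale alt_metabelian_algebra = nonassoc_algebra +
  assumes left_alternative: "\<lbrakk>x \<in> carrier A; y \<in> carrier A\<rbrakk> \<Longrightarrow> associator A x x y = \<zero>"
    and right_alternative: "\<lbrakk>x \<in> carrier A; y \<in> carrier A\<rbrakk> \<Longrightarrow> associator A x y y = \<zero>"
    and metabelian: "\<lbrakk>x \<in> carrier A; y \<in> carrier A; z \<in> carrier A; t \<in> carrier A\<rbrakk> \<Longrightarrow>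
      (x \<otimes> y) \<otimes> (z \<otimes> t) = \<zero>"

text \<open>Parities are elements of the two-element field \<^typ>\<open>bit\<close>.\<close>

record ('f, 'a) superalgebra = "('f, 'a) module" +
  homog :: "bit \<Rightarrow> 'a set"

locale superalgebra = nonassoc_algebra A
  for A :: "('f::field, 'a, 'm) superalgebra_scheme" (structure) +
  assumes homog_submodule:
      "submodule (homog A i) (ring_of_type_algebra :: 'f ring) A"
    and homog_sum: "homog A 0 <+> homog A 1 = carrier A"
    and homog_disjoint: "homog A 0 \<inter> homog A 1 = {\<zero>}"
    and homog_mult: "\<lbrakk>x \<in> homog A i; y \<in> homog A j\<rbrakk> \<Longrightarrow> x \<otimes> y \<in> homog A (i + j)"


section \<open>The Grassmann envelope\<close>

text \<open>
  The Grassmann algebra has the basis \<open>e\<^sub>S = e\<^bsub>i\<^sub>1\<^esub> \<dots> e\<^bsub>i\<^sub>k\<^esub>\<close>, indexed by the finite sets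
  \<open>S = {i\<^sub>1 < \<dots> < i\<^sub>k}\<close> of naturals, with \<open>e\<^sub>T e\<^sub>U = grassmann_sign T U \<cdot> e\<^bsub>T \<union> U\<^esub>\<close> if \<open>T\<close>, \<open>U\<close>
  are disjoint and \<open>e\<^sub>T e\<^sub>U = 0\<close> otherwise. An element \<open>\<Sum>\<^sub>S e\<^sub>S \<otimes> a\<^sub>S\<close> of its tensor product
  with \<open>A\<close> is represented by the finitely supported family of coefficients \<open>a\<^sub>S\<close>; it lies
  in the Grassmann envelope iff every \<open>a\<^sub>S\<close> has the parity of the cardinality of \<open>S\<close>.
\<close>

definition grassmann_sign :: "nat set \<Rightarrow> nat set \<Rightarrow> 'f::field" where
  "grassmann_sign T U = (- 1) ^ card {(t, u). t \<in> T \<and> u \<in> U \<and> u < t}"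

definition grassmann_envelope ::
    "('f::field, 'a, 'm) superalgebra_scheme \<Rightarrow> ('f, nat set \<Rightarrow> 'a) module" where
  "grassmann_envelope A =
    \<lparr>carrier = {\<phi>. finite {S. \<phi> S \<noteq> \<zero>\<^bsub>A\<^esub>} \<and> (\<forall>S. infinite S \<longrightarrow> \<phi> S = \<zero>\<^bsub>A\<^esub>) \<and>
        (\<forall>S. \<phi> S \<in> homog A (of_nat (card S)))},
     monoid.mult = (\<lambda>\<phi> \<psi> S. if finite S
        then \<Oplus>\<^bsub>A\<^esub>T\<in>Pow S. grassmann_sign T (S - T) \<odot>\<^bsub>A\<^esub> (\<phi> T \<otimes>\<^bsub>A\<^esub> \<psi> (S - T))
        else \<zero>\<^bsub>A\<^esub>),
     one = undefined,
     ring.zero = (\<lambda>S. \<zero>\<^bsub>A\<^esub>),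
     add = (\<lambda>\<phi> \<psi> S. \<phi> S \<oplus>\<^bsub>A\<^esub> \<psi> S),
     module.smult = (\<lambda>c \<phi> S. c \<odot>\<^bsub>A\<^esub> \<phi> S)\<rparr>"

definition alt_metabelian_superalgebra ::
    "('f::field, 'a, 'm) superalgebra_scheme \<Rightarrow> bool" where
  "alt_metabelian_superalgebra A \<longleftrightarrow>
    superalgebra A \<and> alt_metabelian_algebra (grassmann_envelope A)"


section \<open>Multilinear polynomials and superidentities\<close>

datatype 'x monomial = Gen 'x | Prod "'x monomial" "'x monomial"

primrec letters :: "'x monomial \<Rightarrow> 'x list" where
  "letters (Gen x) = [x]"
| "letters (Prod u v) = letters u @ letters v"

primrec eval_monomial ::
    "('f, 'a, 'm) module_scheme \<Rightarrow> ('x \<Rightarrow> 'a) \<Rightarrow> 'x monomial \<Rightarrow> 'a" where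
  "eval_monomial A a (Gen x) = a x"
| "eval_monomial A a (Prod u v) = eval_monomial A a u \<otimes>\<^bsub>A\<^esub> eval_monomial A a v"

text \<open>
  A nonassociative polynomial is given by its coefficient function. It is multilinear in
  the variables \<open>0, \<dots>, n - 1\<close> if each of its monomials contains each of them exactly once.
\<close>

definition multilinear_polynomial :: "nat \<Rightarrow> (nat monomial \<Rightarrow> 'f::field) \<Rightarrow> bool" where
  "multilinear_polynomial n f \<longleftrightarrow> finite {w. f w \<noteq> 0} \<and>
    (\<forall>w. f w \<noteq> 0 \<longrightarrow> distinct (letters w) \<and> set (letters w) = {..<n})"

text \<open>
  The Koszul sign of a monomial, for variables of parities \<open>p\<close>: one factor \<open>- 1\<close> for every
  pair of odd variables that occurs in the monomial in reversed order.
\<close>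

definition koszul_sign :: "(nat \<Rightarrow> bit) \<Rightarrow> nat monomial \<Rightarrow> 'f::field" where
  "koszul_sign p w = (- 1) ^ card {(i, j). i < j \<and> j < length (letters w) \<and>
    letters w ! j < letters w ! i \<and> p (letters w ! i) = 1 \<and> p (letters w ! j) = 1}"

definition superization_value ::
    "('f::field, 'a, 'm) module_scheme \<Rightarrow> (nat monomial \<Rightarrow> 'f) \<Rightarrow> (nat \<Rightarrow> bit) \<Rightarrow> (nat \<Rightarrow> 'a) \<Rightarrow> 'a"
  where
  "superization_value A f p a =
    (\<Oplus>\<^bsub>A\<^esub>w\<in>{w. f w \<noteq> 0}. (koszul_sign p w * f w) \<odot>\<^bsub>A\<^esub> eval_monomial A a w)"

definition satisfies_superidentity ::
    "('f::field, 'a, 'm) superalgebra_scheme \<Rightarrow> nat \<Rightarrow> (nat monomial \<Rightarrow> 'f) \<Rightarrow> bool" where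
  "satisfies_superidentity A n f \<longleftrightarrow>
    (\<forall>p a. (\<forall>i<n. a i \<in> homog A (p i)) \<longrightarrow> superization_value A f p a = \<zero>\<^bsub>A\<^esub>)"

text \<open>
  The members of the generated supervariety are the superalgebras whose carrier is a set of
  elements of the type \<open>'u\<close>, which is independent of the type \<open>'b\<close> of the generating algebra.
  If \<open>'f\<close> embeds into \<open>'u\<close>, every superalgebra over \<open>'f\<close> of at most countable dimension is
  isomorphic to one with carrier in \<open>'u\<close>; otherwise there are only zero algebras on \<open>'u\<close>.
\<close>

definition generated_supervariety ::
    "('f::field, 'b) superalgebra \<Rightarrow> ('f, 'u) superalgebra set" where
  "generated_supervariety B = {A. superalgebra A \<and>
    (\<forall>n f. multilinear_polynomial n f \<and> satisfies_superidentity B n f \<longrightarrow>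
      satisfies_superidentity A n f)}"


section \<open>Free alternative metabelian superalgebras\<close>

definition generators :: "nat \<Rightarrow> nat \<Rightarrow> (nat + nat) set" where
  "generators r s = Inl ` {..<r} \<union> Inr ` {..<s}"

definition monomial_parity :: "(nat + nat) monomial \<Rightarrow> bit" where
  "monomial_parity w = (\<Sum>x\<leftarrow>letters w. case x of Inl _ \<Rightarrow> 0 | Inr _ \<Rightarrow> 1)"

text \<open>
  The free nonassociative superalgebra on \<open>r\<close> even generators \<open>Inl i\<close> and \<open>s\<close> odd generators
  \<open>Inr j\<close>. Every monomial of degree at least two factors uniquely, so that products have
  no convolution sums.
\<close>

definition free_superalgebra ::
    "nat \<Rightarrow> nat \<Rightarrow> ('f::field, (nat + nat) monomial \<Rightarrow> 'f) superalgebra" where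
  "free_superalgebra r s =
    (let C = {f. finite {w. f w \<noteq> 0} \<and> (\<forall>w. f w \<noteq> 0 \<longrightarrow> set (letters w) \<subseteq> generators r s)}
     in \<lparr>carrier = C,
         monoid.mult = (\<lambda>f g w. case w of Gen x \<Rightarrow> 0 | Prod u v \<Rightarrow> f u * g v),
         one = undefined,
         ring.zero = (\<lambda>w. 0),
         add = (\<lambda>f g w. f w + g w),
         module.smult = (\<lambda>c f w. c * f w),
         homog = (\<lambda>p. {f \<in> C. \<forall>w. f w \<noteq> 0 \<longrightarrow> monomial_parity w = p})\<rparr>)"

definition graded_ideal :: "'a set \<Rightarrow> ('f::field, 'a, 'm) superalgebra_scheme \<Rightarrow> bool" where
  "graded_ideal J A \<longleftrightarrow>
    submodule J (ring_of_type_algebra :: 'f ring) A \<and>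
    (\<forall>a\<in>carrier A. \<forall>x\<in>J. a \<otimes>\<^bsub>A\<^esub> x \<in> J \<and> x \<otimes>\<^bsub>A\<^esub> a \<in> J) \<and>
    J = (J \<inter> homog A 0) <+>\<^bsub>A\<^esub> (J \<inter> homog A 1)"

definition quotient_superalgebra ::
    "('f::field, 'a) superalgebra \<Rightarrow> 'a set \<Rightarrow> ('f, 'a set) superalgebra" where
  "quotient_superalgebra A J =
    \<lparr>carrier = a_rcosets\<^bsub>A\<^esub> J,
     monoid.mult = rcoset_mult A J,
     one = undefined,
     ring.zero = J,
     add = set_add A,
     module.smult = (\<lambda>c B. \<Union>x\<in>B. J +>\<^bsub>A\<^esub> (c \<odot>\<^bsub>A\<^esub> x)),
     homog = (\<lambda>p. (\<lambda>a. J +>\<^bsub>A\<^esub> a) ` homog A p)\<rparr>"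

text \<open>
  The relatively free superalgebra: the quotient of the free nonassociative superalgebra by
  its least graded ideal whose quotient is alternative metabelian.
\<close>

definition alt_metabelian_ideal ::
    "nat \<Rightarrow> nat \<Rightarrow> ((nat + nat) monomial \<Rightarrow> 'f::field) set" where
  "alt_metabelian_ideal r s = \<Inter> {J. graded_ideal J (free_superalgebra r s) \<and>
    alt_metabelian_superalgebra (quotient_superalgebra (free_superalgebra r s) J)}"

definition free_alt_metabelian_superalgebra ::
    "nat \<Rightarrow> nat \<Rightarrow> ('f::field, ((nat + nat) monomial \<Rightarrow> 'f) set) superalgebra" where
  "free_alt_metabelian_superalgebra r s =
    quotient_superalgebra (free_superalgebra r s) (alt_metabelian_ideal r s)"

definition alt_metabelian_supervariety ::
    "nat \<Rightarrow> nat \<Rightarrow> ('f::field, 'u) superalgebra set" where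
  "alt_metabelian_supervariety r s =
    generated_supervariety (free_alt_metabelian_superalgebra r s)"

end

theory Submission
  imports Defs
begin

text \<open>A supervariety is determined by the superidentities of its generator, so the inclusions
  amount to comparing the identities of the free superalgebras. In an alternative metabelian algebra
  \<open>A\<close> the multiplications by elements of \<open>A\<close> act on \<open>A\<^sup>2\<close> almost in a skew-symmetric way:
  there are elements (\<open>chain\<close> below) \<open>D(x; y\<^sub>1, \<dots>, y\<^sub>m) k\<close> with \<open>k \<in> F[\<tau>]\<close>, \<open>\<tau>\<^sup>2 + \<tau> + 1 = 0\<close>, which
  are alternating in \<open>y\<^sub>1, \<dots>, y\<^sub>m\<close>, satisfy \<open>D(x; y\<^sub>1, \<dots>, y\<^sub>m) k \<cdot> t = D(x; y\<^sub>1, \<dots>, y\<^sub>m, t) k\<close>,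
  and for which \<open>t \<cdot> D(x; y\<^sub>1, \<dots>, y\<^sub>m) k = D(x; t, y\<^sub>1, \<dots>, y\<^sub>m) (\<lambda>\<^sub>m k)\<close> with \<open>\<lambda>\<^sub>m = \<tau>\<close>
  for even \<open>m\<close> and \<open>\<lambda>\<^sub>m = 1 + \<tau>\<close> for odd \<open>m\<close>. Every monomial of degree \<open>n \<ge> 4\<close> is the sum
  over its letters \<open>x\<close> of such elements, with coefficients that are seen in the superalgebra
  generated by one odd element. Hence a multilinear identity of one odd generator of degree
  \<open>n \<noteq> 3\<close> holds everywhere, and in degree \<open>3\<close> it holds up to a multiple of the
  linearisation of \<open>x\<^sup>3\<close>. The latter vanishes for two odd generators, since of three
  arguments of degree \<open>1\<close> two are proportional, but it does not vanish for three odd generators or for one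
  generator of each parity. Finally, skew-symmetry kills the left-normed monomial of degree
  \<open>r + 2\<close> for \<open>r \<ge> 2\<close> even generators, but not for \<open>r + 1\<close> of them nor in
  the presence of an odd one; for \<open>r = 1\<close> the polynomial \<open>x(yz) - x(zy)\<close> plays this role.\<close>

section \<open>Linear functionals\<close>

text \<open>Equations between elements are tested by all linear functionals. These separate points,
  and they turn consequences of alternativity into polynomial relations between scalars, which
  \<open>Groebner_Basis.algebra\<close> decides. The ring \<open>F[\<tau>]\<close> is forced. For
  \<open>v\<close> in the square of \<open>A\<close>, alternativity gives
  \<open>t(vy) = (tv)y + (vt)y\<close> and \<open>s(tv) = (vt)s\<close>. On elements that alternate
  in their letters this reads \<open>\<lambda>_(m+1) = \<lambda>_m + (- 1)^m\<close> and
  \<open>\<lambda>_(m+1) \<lambda>_m = - 1\<close>, so \<open>\<tau> (1 + \<tau>) = - 1\<close>. The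
  free superalgebra is given by an intersection of ideals. A superidentity holds in it iff it holds
  in the quotient by every ideal \<open>J\<close> of the family, and kernels of evaluations in
  superalgebras with the laws belong to the family. Hence identities are proved in the Grassmann
  envelope of an arbitrary such quotient, an ordinary algebra, and refuted in explicit models. A
  strict inclusion needs a witness on the type \<open>'u\<close>. The free superalgebra provides it,
  because finitely supported functions on monomials can be coded by single scalars.\<close>

definition linear_functional ::
    "('f::field, 'a, 'm) module_scheme \<Rightarrow> ('a \<Rightarrow> 'f) \<Rightarrow> bool" where
  "linear_functional A \<phi> \<longleftrightarrow>
    (\<forall>x\<in>carrier A. \<forall>y\<in>carrier A. \<phi> (x \<oplus>\<^bsub>A\<^esub> y) = \<phi> x + \<phi> y) \<and>
    (\<forall>c. \<forall>x\<in>carrier A. \<phi> (c \<odot>\<^bsub>A\<^esub> x) = c * \<phi> x)"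

lemma carrier_field [simp]: "carrier (ring_of_type_algebra :: 'f::field ring) = UNIV"
  and mult_field [simp]: "monoid.mult (ring_of_type_algebra :: 'f::field ring) = (*)"
  and add_field [simp]: "ring.add (ring_of_type_algebra :: 'f::field ring) = (+)"
  and zero_field [simp]: "ring.zero (ring_of_type_algebra :: 'f::field ring) = 0"
  and one_field [simp]: "monoid.one (ring_of_type_algebra :: 'f::field ring) = 1"
  by (simp_all add: ring_of_type_algebra_def)

context nonassoc_algebra
begin

lemma smult_in [simp, intro]: "x \<in> carrier A \<Longrightarrow> c \<odot>\<^bsub>A\<^esub> x \<in> carrier A"
  using smult_closed[of c x] by simp

lemma smult_add_scalar: "x \<in> carrier A \<Longrightarrow> (a + b) \<odot>\<^bsub>A\<^esub> x = a \<odot>\<^bsub>A\<^esub> x \<oplus> b \<odot>\<^bsub>A\<^esub> x"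
  using smult_l_distr[of a b x] by simp

lemma smult_add:
  "x \<in> carrier A \<Longrightarrow> y \<in> carrier A \<Longrightarrow> a \<odot>\<^bsub>A\<^esub> (x \<oplus> y) = a \<odot>\<^bsub>A\<^esub> x \<oplus> a \<odot>\<^bsub>A\<^esub> y"
  using smult_r_distr[of a x y] by simp

lemma smult_mult: "x \<in> carrier A \<Longrightarrow> (a * b) \<odot>\<^bsub>A\<^esub> x = a \<odot>\<^bsub>A\<^esub> (b \<odot>\<^bsub>A\<^esub> x)"
  using smult_assoc1[of a b x] by simp

lemma smult_1 [simp]: "x \<in> carrier A \<Longrightarrow> 1 \<odot>\<^bsub>A\<^esub> x = x"
  using smult_one[of x] by simp

lemma smult_0 [simp]: "x \<in> carrier A \<Longrightarrow> 0 \<odot>\<^bsub>A\<^esub> x = \<zero>"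
  using smult_l_null[of x] by simp

lemma smult_zero [simp]: "c \<odot>\<^bsub>A\<^esub> \<zero> = \<zero>"
  using smult_r_null[of c] by simp

lemma smult_uminus_1: "x \<in> carrier A \<Longrightarrow> (- 1) \<odot>\<^bsub>A\<^esub> x = \<ominus> x"
  using smult_add_scalar[of x "- 1" 1] M.minus_equality[of "(- 1) \<odot>\<^bsub>A\<^esub> x" x] by simp

lemmas mult_in [simp, intro] = mult_closed

lemma mult_zero_left [simp]: "x \<in> carrier A \<Longrightarrow> \<zero> \<otimes> x = \<zero>"
  using smult_mult_left[of \<zero> x 0] by simp

lemma mult_zero_right [simp]: "x \<in> carrier A \<Longrightarrow> x \<otimes> \<zero> = \<zero>"
  using smult_mult_right[of x \<zero> 0] by simp

lemma associator_closed [simp, intro]: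
  "\<lbrakk>x \<in> carrier A; y \<in> carrier A; z \<in> carrier A\<rbrakk> \<Longrightarrow> associator A x y z \<in> carrier A"
  by (simp add: associator_def)

lemma functional_add:
  "\<lbrakk>linear_functional A \<phi>; x \<in> carrier A; y \<in> carrier A\<rbrakk> \<Longrightarrow> \<phi> (x \<oplus> y) = \<phi> x + \<phi> y"
  by (simp add: linear_functional_def)

lemma functional_smult:
  "\<lbrakk>linear_functional A \<phi>; x \<in> carrier A\<rbrakk> \<Longrightarrow> \<phi> (c \<odot>\<^bsub>A\<^esub> x) = c * \<phi> x"
  by (simp add: linear_functional_def)

lemma functional_zero: "linear_functional A \<phi> \<Longrightarrow> \<phi> \<zero> = 0"
  using functional_smult[of \<phi> \<zero> 0] by simp

lemma functional_uminus: "linear_functional A \<phi> \<Longrightarrow> x \<in> carrier A \<Longrightarrow> \<phi> (\<ominus> x) = - \<phi> x"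
  using functional_smult[of \<phi> x "- 1"] by (simp add: smult_uminus_1)

lemma functional_minus:
  "\<lbrakk>linear_functional A \<phi>; x \<in> carrier A; y \<in> carrier A\<rbrakk> \<Longrightarrow> \<phi> (x \<ominus> y) = \<phi> x - \<phi> y"
  by (simp add: a_minus_def functional_add functional_uminus)

lemmas functional_simps =
  functional_add functional_smult functional_zero functional_uminus functional_minus

lemma functional_finsum:
  assumes "linear_functional A \<phi>" "g \<in> I \<rightarrow> carrier A"
  shows "\<phi> (finsum A g I) = (\<Sum>i\<in>I. \<phi> (g i))"
  using assms(2)
proof (induction I rule: infinite_finite_induct)
  case (infinite I)
  then show ?case
    using functional_zero[OF assms(1)] by (simp add: M.finsum_infinite)
next
  case empty
  then show ?case
    using functional_zero[OF assms(1)] by simp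
next
  case (insert i I)
  then have "g i \<in> carrier A" "g \<in> I \<rightarrow> carrier A"
    by auto
  with insert show ?case
    by (simp add: functional_add[OF assms(1)] finsum_insert)
qed

lemma linear_functional_mult_right:
  "\<lbrakk>linear_functional A \<phi>; y \<in> carrier A\<rbrakk> \<Longrightarrow> linear_functional A (\<lambda>x. \<phi> (x \<otimes> y))"
  unfolding linear_functional_def by (auto simp: mult_add_left smult_mult_left)

lemma linear_functional_mult_left:
  "\<lbrakk>linear_functional A \<phi>; y \<in> carrier A\<rbrakk> \<Longrightarrow> linear_functional A (\<lambda>x. \<phi> (y \<otimes> x))"
  unfolding linear_functional_def by (auto simp: mult_add_right smult_mult_right)

text \<open>A subspace maximal among those avoiding \<open>v\<close> is the kernel of a functional with value
  \<open>1\<close> at \<open>v\<close>.\<close>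

lemma separating_functional:
  assumes v: "v \<in> carrier A" "v \<noteq> \<zero>"
  obtains \<phi> where "linear_functional A \<phi>" "\<phi> v = 1"
proof -
  define P where "P J \<longleftrightarrow> J \<subseteq> carrier A \<and> \<zero> \<in> J \<and> (\<forall>x\<in>J. \<forall>y\<in>J. x \<oplus> y \<in> J) \<and>
    (\<forall>c. \<forall>x\<in>J. c \<odot>\<^bsub>A\<^esub> x \<in> J) \<and> v \<notin> J" for J
  have "\<exists>J\<in>Collect P. \<forall>Y\<in>Collect P. J \<subseteq> Y \<longrightarrow> Y = J"
  proof (rule subset_Zorn_nonempty)
    have "P {\<zero>}"
      using v by (auto simp: P_def)
    then show "Collect P \<noteq> {}"
      by blast
  next
    fix C assume C: "C \<noteq> {}" "subset.chain (Collect P) C"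
    have chain: "U \<subseteq> Y \<or> Y \<subseteq> U" if "U \<in> C" "Y \<in> C" for U Y
      using C that by (auto simp: subset_chain_def)
    have CP: "P U" if "U \<in> C" for U
      using C that by (auto simp: subset_chain_def)
    have "x \<oplus> y \<in> \<Union>C" if xy: "x \<in> \<Union>C" "y \<in> \<Union>C" for x y
    proof -
      from xy obtain U Y where "U \<in> C" "Y \<in> C" "x \<in> U" "y \<in> Y"
        by auto
      then obtain Z where "Z \<in> C" "x \<in> Z" "y \<in> Z"
        using chain[of U Y] by blast
      with CP[of Z] show ?thesis
        by (auto simp: P_def)
    qed
    moreover have "\<zero> \<in> \<Union>C"
      using C(1) CP by (auto simp: P_def)
    moreover have "\<Union>C \<subseteq> carrier A" "v \<notin> \<Union>C"
      using CP unfolding P_def by blast+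
    moreover have "c \<odot>\<^bsub>A\<^esub> x \<in> \<Union>C" if "x \<in> \<Union>C" for c x
      using that CP unfolding P_def by blast
    ultimately show "\<Union>C \<in> Collect P"
      unfolding P_def by simp
  qed
  then obtain J where J: "P J" and max: "\<And>U. P U \<Longrightarrow> J \<subseteq> U \<Longrightarrow> U = J"
    by auto
  have Jc: "J \<subseteq> carrier A" and J0: "\<zero> \<in> J" and Ja: "\<And>x y. x \<in> J \<Longrightarrow> y \<in> J \<Longrightarrow> x \<oplus> y \<in> J"
    and Jm: "\<And>c x. x \<in> J \<Longrightarrow> c \<odot>\<^bsub>A\<^esub> x \<in> J" and Jv: "v \<notin> J"
    using J by (auto simp: P_def)
  have Jneg: "\<ominus> x \<in> J" if "x \<in> J" for x
    using Jm[OF that, of "- 1"] that Jc by (auto simp: smult_uminus_1)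
  have Jc': "x \<in> carrier A" if "x \<in> J" for x
    using that Jc by auto
  have unique: "c = d" if x: "x \<in> carrier A" "x \<oplus> c \<odot>\<^bsub>A\<^esub> v \<in> J" "x \<oplus> d \<odot>\<^bsub>A\<^esub> v \<in> J" for x c d
  proof (rule ccontr)
    assume "c \<noteq> d"
    have "(x \<oplus> c \<odot>\<^bsub>A\<^esub> v) \<oplus> (- 1) \<odot>\<^bsub>A\<^esub> (x \<oplus> d \<odot>\<^bsub>A\<^esub> v) \<in> J"
      using x Ja Jm by blast
    moreover have "(x \<oplus> c \<odot>\<^bsub>A\<^esub> v) \<oplus> (- 1) \<odot>\<^bsub>A\<^esub> (x \<oplus> d \<odot>\<^bsub>A\<^esub> v) =
        (x \<oplus> (- 1) \<odot>\<^bsub>A\<^esub> x) \<oplus> (c \<odot>\<^bsub>A\<^esub> v \<oplus> ((- 1) * d) \<odot>\<^bsub>A\<^esub> v)"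
      using v x by (simp only: smult_add smult_mult smult_in M.a_closed M.a_ac)
    moreover have "\<dots> = (c - d) \<odot>\<^bsub>A\<^esub> v"
      using v x by (simp add: smult_add_scalar[symmetric] smult_uminus_1 M.r_neg)
    ultimately have "inverse (c - d) \<odot>\<^bsub>A\<^esub> ((c - d) \<odot>\<^bsub>A\<^esub> v) \<in> J"
      using Jm by metis
    with \<open>c \<noteq> d\<close> v Jv show False
      by (simp add: smult_mult[symmetric])
  qed
  have exists: "\<exists>c. x \<oplus> c \<odot>\<^bsub>A\<^esub> v \<in> J" if x: "x \<in> carrier A" for x
  proof (cases "x \<in> J")
    case True
    then show ?thesis
      using v x by (intro exI[of _ 0]) simp
  next
    case False
    \<comment> \<open>By maximality of \<open>J\<close> the larger subspace \<open>J + Fx\<close>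
      must contain \<open>v\<close>; solving for \<open>x\<close> puts \<open>x\<close> into
      \<open>J + Fv\<close>.\<close>
    let ?U = "{j \<oplus> c \<odot>\<^bsub>A\<^esub> x | j c. j \<in> J}"
    have "j \<oplus> c \<odot>\<^bsub>A\<^esub> x \<oplus> (j' \<oplus> c' \<odot>\<^bsub>A\<^esub> x) = (j \<oplus> j') \<oplus> (c + c') \<odot>\<^bsub>A\<^esub> x" if "j \<in> J" "j' \<in> J" for j j' c c'
      using Jc'[OF that(1)] Jc'[OF that(2)] x by (simp add: smult_add_scalar M.a_ac)
    then have "y \<oplus> z \<in> ?U" if "y \<in> ?U" "z \<in> ?U" for y z
      using that Ja by (smt (verit) mem_Collect_eq)
    moreover have "d \<odot>\<^bsub>A\<^esub> (j \<oplus> c \<odot>\<^bsub>A\<^esub> x) = d \<odot>\<^bsub>A\<^esub> j \<oplus> (d * c) \<odot>\<^bsub>A\<^esub> x" if "j \<in> J" for j c d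
      using Jc'[OF that] x by (simp add: smult_add smult_mult)
    then have "d \<odot>\<^bsub>A\<^esub> y \<in> ?U" if "y \<in> ?U" for d y
      using that Jm by (smt (verit) mem_Collect_eq)
    moreover have "j = j \<oplus> 0 \<odot>\<^bsub>A\<^esub> x" if "j \<in> J" for j
      using Jc'[OF that] x by simp
    then have sub: "J \<subseteq> ?U"
      by blast
    moreover have "?U \<subseteq> carrier A"
      using x Jc' by auto
    ultimately have "v \<notin> ?U \<Longrightarrow> P ?U"
      unfolding P_def using J0 by blast
    moreover have "x \<in> ?U"
      using J0 x by (intro CollectI exI[of _ \<zero>] exI[of _ 1]) simp
    ultimately have "v \<in> ?U"
      using max[of ?U] sub False by blast
    then obtain j c where jc: "j \<in> J" "v = j \<oplus> c \<odot>\<^bsub>A\<^esub> x"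
      by auto
    then have "c \<noteq> 0"
      using Jv x Jc' by auto
    have "x \<oplus> (- inverse c) \<odot>\<^bsub>A\<^esub> v = (- inverse c) \<odot>\<^bsub>A\<^esub> j \<oplus> (x \<oplus> (- inverse c * c) \<odot>\<^bsub>A\<^esub> x)"
      using jc Jc'[of j] x by (simp only: smult_add smult_mult smult_in M.a_ac M.a_closed)
    also have "\<dots> = (- inverse c) \<odot>\<^bsub>A\<^esub> j"
      using \<open>c \<noteq> 0\<close> x Jc'[OF jc(1)] by (simp add: smult_uminus_1 M.r_neg)
    finally show ?thesis
      using Jm[OF jc(1)] by metis
  qed
  \<comment> \<open>Every \<open>x\<close> is congruent to \<open>- c v\<close> modulo
    \<open>J\<close> for exactly one \<open>c\<close>, hence the sign.\<close>
  define \<phi> where "\<phi> x = - (THE c. x \<oplus> c \<odot>\<^bsub>A\<^esub> v \<in> J)" for x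
  have \<phi>: "\<phi> x = - c" if "x \<in> carrier A" "x \<oplus> c \<odot>\<^bsub>A\<^esub> v \<in> J" for x c
    unfolding \<phi>_def using unique that by (metis (mono_tags, lifting) theI)
  have "linear_functional A \<phi>"
    unfolding linear_functional_def
  proof (intro conjI ballI allI)
    fix x y assume xy: "x \<in> carrier A" "y \<in> carrier A"
    obtain c d where cd: "x \<oplus> c \<odot>\<^bsub>A\<^esub> v \<in> J" "y \<oplus> d \<odot>\<^bsub>A\<^esub> v \<in> J"
      using exists xy by blast
    have "(x \<oplus> c \<odot>\<^bsub>A\<^esub> v) \<oplus> (y \<oplus> d \<odot>\<^bsub>A\<^esub> v) = (x \<oplus> y) \<oplus> (c + d) \<odot>\<^bsub>A\<^esub> v"
      using xy v by (simp add: smult_add_scalar M.a_ac)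
    then have "(x \<oplus> y) \<oplus> (c + d) \<odot>\<^bsub>A\<^esub> v \<in> J"
      using Ja[OF cd] by simp
    then show "\<phi> (x \<oplus> y) = \<phi> x + \<phi> y"
      using \<phi>[OF _ cd(1)] \<phi>[OF _ cd(2)] \<phi>[of "x \<oplus> y"] xy by simp
  next
    fix x a assume x: "x \<in> carrier A"
    obtain c where c: "x \<oplus> c \<odot>\<^bsub>A\<^esub> v \<in> J"
      using exists x by blast
    have "a \<odot>\<^bsub>A\<^esub> (x \<oplus> c \<odot>\<^bsub>A\<^esub> v) = a \<odot>\<^bsub>A\<^esub> x \<oplus> (a * c) \<odot>\<^bsub>A\<^esub> v"
      using x v by (simp add: smult_add smult_mult)
    then have "a \<odot>\<^bsub>A\<^esub> x \<oplus> (a * c) \<odot>\<^bsub>A\<^esub> v \<in> J"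
      using Jm[OF c, of a] by simp
    then show "\<phi> (a \<odot>\<^bsub>A\<^esub> x) = a * \<phi> x"
      using \<phi>[OF x c] \<phi>[of "a \<odot>\<^bsub>A\<^esub> x"] x by simp
  qed
  moreover have "\<phi> v = 1"
    using \<phi>[of v "- 1"] v J0 by (simp add: smult_uminus_1 M.r_neg)
  ultimately show ?thesis
    using that by blast
qed

text \<open>This is how relations in an algebra become relations in the field: a difference
  \<open>x - y\<close> that is not zero is detected by some functional.\<close>

lemma eq_by_functionals:
  assumes "x \<in> carrier A" "y \<in> carrier A" "\<And>\<phi>. linear_functional A \<phi> \<Longrightarrow> \<phi> x = \<phi> y"
  shows "x = y"
proof (rule ccontr)
  assume "x \<noteq> y"
  then have "x \<ominus> y \<noteq> \<zero>"
    using assms(1,2) M.minus_minus[of y] M.minus_equality[of x "\<ominus> y"] by (auto simp: a_minus_def)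
  then obtain \<phi> where "linear_functional A \<phi>" "\<phi> (x \<ominus> y) = 1"
    using separating_functional[of "x \<ominus> y"] assms by auto
  moreover have "\<phi> (x \<ominus> y) = 0" if "linear_functional A \<phi>" for \<phi>
    using assms that by (simp add: functional_minus)
  ultimately show False
    by fastforce
qed

end

section \<open>Alternative metabelian algebras\<close>

locale alt_metabelian_algebra_char_0 = alt_metabelian_algebra A
  for A :: "('f::field_char_0, 'a, 'm) module_scheme" (structure)
begin

text \<open>Polarisation: expand \<open>(x + y, x + y, z) = 0\<close> and subtract the two diagonal
  terms.\<close>

lemma linearised_left_alternative:
  assumes "linear_functional A \<phi>" "x \<in> carrier A" "y \<in> carrier A" "z \<in> carrier A"
  shows "\<phi> ((x \<otimes> y) \<otimes> z) - \<phi> (x \<otimes> (y \<otimes> z)) + \<phi> ((y \<otimes> x) \<otimes> z) - \<phi> (y \<otimes> (x \<otimes> z)) = 0"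
proof -
  have "\<phi> (associator A (x \<oplus> y) (x \<oplus> y) z) - \<phi> (associator A x x z) - \<phi> (associator A y y z) = 0"
    using assms by (simp add: left_alternative functional_zero)
  then show ?thesis
    using assms
    by (simp add: associator_def functional_simps mult_add_left mult_add_right algebra_simps)
qed

lemma linearised_right_alternative:
  assumes "linear_functional A \<phi>" "x \<in> carrier A" "y \<in> carrier A" "z \<in> carrier A"
  shows "\<phi> ((x \<otimes> y) \<otimes> z) - \<phi> (x \<otimes> (y \<otimes> z)) + \<phi> ((x \<otimes> z) \<otimes> y) - \<phi> (x \<otimes> (z \<otimes> y)) = 0"
proof -
  have "\<phi> (associator A x (y \<oplus> z) (y \<oplus> z)) - \<phi> (associator A x y y) - \<phi> (associator A x z z) = 0"
    using assms by (simp add: right_alternative functional_zero)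
  then show ?thesis
    using assms
    by (simp add: associator_def functional_simps mult_add_left mult_add_right algebra_simps)
qed

text \<open>The two-sided annihilator of all products stands in for the square of \<open>A\<close>.
  It contains every product by the metabelian law and is a subspace by bilinearity, so that linear
  combinations of products, such as \<open>cubic\<close>, lie in it without a span being
  formed.\<close>

definition square_annihilator :: "'a set" where
  "square_annihilator = {v \<in> carrier A.
    \<forall>x\<in>carrier A. \<forall>y\<in>carrier A. v \<otimes> (x \<otimes> y) = \<zero> \<and> (x \<otimes> y) \<otimes> v = \<zero>}"

lemma square_annihilator_carrier: "v \<in> square_annihilator \<Longrightarrow> v \<in> carrier A"
  by (simp add: square_annihilator_def)

lemma square_annihilator_mult:
  "x \<in> carrier A \<Longrightarrow> y \<in> carrier A \<Longrightarrow> x \<otimes> y \<in> square_annihilator"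
  by (simp add: square_annihilator_def metabelian)

lemma square_annihilator_add:
  "u \<in> square_annihilator \<Longrightarrow> v \<in> square_annihilator \<Longrightarrow> u \<oplus> v \<in> square_annihilator"
  by (simp add: square_annihilator_def mult_add_left mult_add_right)

lemma square_annihilator_smult:
  "u \<in> square_annihilator \<Longrightarrow> c \<odot>\<^bsub>A\<^esub> u \<in> square_annihilator"
  by (simp add: square_annihilator_def smult_mult_left smult_mult_right)

lemma square_annihilator_minus:
  "u \<in> square_annihilator \<Longrightarrow> v \<in> square_annihilator \<Longrightarrow> u \<ominus> v \<in> square_annihilator"
  using square_annihilator_add[of u "\<ominus> v"] square_annihilator_smult[of v "- 1"]
  by (simp add: a_minus_def smult_uminus_1 square_annihilator_carrier)

lemma annihilated_products:
  assumes "linear_functional A \<phi>" "v \<in> square_annihilator" "x \<in> carrier A" "y \<in> carrier A"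
  shows "\<phi> (v \<otimes> (x \<otimes> y)) = 0" "\<phi> ((x \<otimes> y) \<otimes> v) = 0"
  using assms by (simp_all add: square_annihilator_def functional_zero)

text \<open>In \<open>(v, x, y) + (v, y, x) = 0\<close> the terms \<open>v(xy)\<close> and
  \<open>v(yx)\<close> vanish.\<close>

lemma right_right_skew:
  assumes "linear_functional A \<phi>" "v \<in> square_annihilator" "x \<in> carrier A" "y \<in> carrier A"
  shows "\<phi> ((v \<otimes> x) \<otimes> y) = - \<phi> ((v \<otimes> y) \<otimes> x)"
  using linearised_right_alternative[OF assms(1) square_annihilator_carrier[OF assms(2)] assms(3,4)]
    annihilated_products[OF assms] annihilated_products[OF assms(1,2,4,3)]
  by (simp add: add_eq_0_iff)

text \<open>As \<open>(xy)v\<close> and \<open>v(xy)\<close> vanish, right and left alternativity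
  give \<open>x(yv) = (xv)y - x(vy) = - (vx)y\<close>, which is \<open>(vy)x\<close> by skew
  symmetry.\<close>

lemma left_left:
  assumes "linear_functional A \<phi>" "v \<in> square_annihilator" "x \<in> carrier A" "y \<in> carrier A"
  shows "\<phi> (x \<otimes> (y \<otimes> v)) = \<phi> ((v \<otimes> y) \<otimes> x)"
  using linearised_right_alternative[OF assms(1) assms(3,4) square_annihilator_carrier[OF assms(2)]]
    linearised_left_alternative[OF assms(1) assms(3) square_annihilator_carrier[OF assms(2)] assms(4)]
    annihilated_products[OF assms] annihilated_products[OF assms(1,2,4,3)] right_right_skew[OF assms]
  by Groebner_Basis.algebra

text \<open>This is \<open>(x, v, y) + (v, x, y) = 0\<close> with \<open>v(xy) = 0\<close>. The
  second summand is responsible for the change of the left coefficient of a \<open>chain\<close>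
  with its length.\<close>

lemma left_right:
  assumes "linear_functional A \<phi>" "v \<in> square_annihilator" "x \<in> carrier A" "y \<in> carrier A"
  shows "\<phi> (x \<otimes> (v \<otimes> y)) = \<phi> ((x \<otimes> v) \<otimes> y) + \<phi> ((v \<otimes> x) \<otimes> y)"
  using
    linearised_left_alternative[OF assms(1) assms(3) square_annihilator_carrier[OF assms(2)] assms(4)]
    annihilated_products[OF assms]
  by Groebner_Basis.algebra

end

text \<open>Products of degree 4 with a fixed functional applied: \<open>a p q z t\<close> stands for
  \<open>((p q) z) t\<close> and \<open>b p q z t\<close> for \<open>(z (p q)) t\<close>; all other products reduce to these.\<close>

locale degree_four = alt_metabelian_algebra_char_0 +
  fixes \<phi>
  assumes \<phi>: "linear_functional A \<phi>"
begin

definition "a p q z t = \<phi> (((p \<otimes> q) \<otimes> z) \<otimes> t)"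
definition "b p q z t = \<phi> ((z \<otimes> (p \<otimes> q)) \<otimes> t)"

lemma a_eq: "\<phi> (((p \<otimes> q) \<otimes> z) \<otimes> t) = a p q z t"
  and b_eq: "\<phi> ((z \<otimes> (p \<otimes> q)) \<otimes> t) = b p q z t"
  by (simp_all add: a_def b_def)

context
  fixes p q z t
  assumes pqzt: "p \<in> carrier A" "q \<in> carrier A" "z \<in> carrier A" "t \<in> carrier A"
begin

lemma left_eqs:
  "\<phi> (t \<otimes> ((p \<otimes> q) \<otimes> z)) = b p q t z + a p q t z"
  "\<phi> (t \<otimes> (z \<otimes> (p \<otimes> q))) = a p q z t"
  unfolding a_def b_def
  using left_right[OF \<phi> square_annihilator_mult[OF pqzt(1,2)] pqzt(4,3)]
    left_left[OF \<phi> square_annihilator_mult[OF pqzt(1,2)] pqzt(4,3)]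
  by simp_all

lemma a_skew: "a p q z t = - a p q t z"
  unfolding a_def by (rule right_right_skew[OF \<phi> square_annihilator_mult[OF pqzt(1,2)] pqzt(3,4)])

end

context
  fixes x y z w
  assumes xyzw: "x \<in> carrier A" "y \<in> carrier A" "z \<in> carrier A" "w \<in> carrier A"
begin

text \<open>This lemma and the next three multiply an alternative law in \<open>x\<close>,
  \<open>y\<close>, \<open>z\<close> by a fourth element: the first letter of the name stands for
  left or right alternativity, the last one for the side on which \<open>w\<close> is
  multiplied.\<close>

lemma L1R: "a x y z w - b y z x w + a y x z w - b x z y w = 0"
  using linearised_left_alternative[OF linear_functional_mult_right[OF \<phi> xyzw(4)] xyzw(1-3)]
  by (simp add: a_eq b_eq)

lemma R1R: "a x y z w - b y z x w + a x z y w - b z y x w = 0"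
  using linearised_right_alternative[OF linear_functional_mult_right[OF \<phi> xyzw(4)] xyzw(1-3)]
  by (simp add: a_eq b_eq)

lemma L1L: "a x y w z + b x y w z - a y z x w + a y x w z + b y x w z - a x z y w = 0"
  using linearised_left_alternative[OF linear_functional_mult_left[OF \<phi> xyzw(4)] xyzw(1-3)] xyzw
  by (simp add: left_eqs algebra_simps)

lemma R1L: "a x y w z + b x y w z - a y z x w + a x z w y + b x z w y - a z y x w = 0"
  using linearised_right_alternative[OF linear_functional_mult_left[OF \<phi> xyzw(4)] xyzw(1-3)] xyzw
  by (simp add: left_eqs algebra_simps)

end

text \<open>The middle element is itself the product \<open>xy\<close> here. The relation is a
  linear combination of degree four consequences of alternativity in which all four letters change
  their places.\<close>

lemma b_skew:
  assumes [simp]: "x \<in> carrier A" "y \<in> carrier A" "z \<in> carrier A" "t \<in> carrier A"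
  shows "b x y z t = - b x y t z"
proof -
  note facts = R1L[of x t y z] R1R[of x t y z] R1R[of z t x y] L1L[of t y z x] R1L[of x y z t]
    L1R[of t z x y] L1L[of x z y t]
  note a_skew[of x y z t] a_skew[of x z y t] a_skew[of x t y z] a_skew[of y x z t] a_skew[of y z x t]
    a_skew[of y t x z] a_skew[of z x y t] a_skew[of z y x t] a_skew[of z t x y] a_skew[of t x y z]
    a_skew[of t y x z] a_skew[of t z x y]
  with facts show ?thesis
    by simp Groebner_Basis.algebra
qed

end

text \<open>Pairs \<open>(c, d)\<close> stand for the elements \<open>c + d \<tau>\<close> of \<open>F[\<tau>]\<close>, where \<open>\<tau>\<^sup>2 + \<tau> + 1 = 0\<close>;
  \<open>twist m\<close> is the multiplication by \<open>\<tau>\<close> for even \<open>m\<close> and by \<open>1 + \<tau>\<close> for odd \<open>m\<close>.\<close>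

definition twist :: "nat \<Rightarrow> 'f::field \<times> 'f \<Rightarrow> 'f \<times> 'f" where
  "twist m k = (if even m then (- snd k, fst k - snd k) else (fst k - snd k, fst k))"

lemma adjacent_swaps_move:
  fixes H :: "'b list \<Rightarrow> 'f::comm_ring_1"
  assumes "\<And>l1 y z l2. H (l1 @ y # z # l2) = - H (l1 @ z # y # l2)"
  shows "H (l1 @ l2 @ t # l3) = (- 1) ^ length l2 * H (l1 @ t # l2 @ l3)"
proof (induction l2 arbitrary: l1)
  case (Cons y l2)
  have "H (l1 @ (y # l2) @ t # l3) = (- 1) ^ length l2 * H (l1 @ y # t # l2 @ l3)"
    using Cons[of "l1 @ [y]"] by simp
  then show ?case
    by (simp add: assms[of l1 y t])
qed simp

section \<open>Elements of degree three and their products with a fourth factor\<close>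

context alt_metabelian_algebra_char_0
begin

text \<open>The linearisation of \<open>x^3\<close>. Since the associator is alternating,
  right-normed products would give the same sum.\<close>

definition symmetric_cube :: "'a \<Rightarrow> 'a \<Rightarrow> 'a \<Rightarrow> 'a" where
  "symmetric_cube x y z = (x \<otimes> y) \<otimes> z \<oplus> (x \<otimes> z) \<otimes> y \<oplus> (y \<otimes> x) \<otimes> z \<oplus> (y \<otimes> z) \<otimes> x \<oplus>
    (z \<otimes> x) \<otimes> y \<oplus> (z \<otimes> y) \<otimes> x"

text \<open>The multilinear part of degree three of the free alternative algebra has dimension 7:
  twelve monomials modulo the five relations that make the associator alternating. It splits into
  the line of \<open>symmetric_cube\<close> and, for each of the three choices of a distinguished
  letter, two elements that are skew in the other letters. \<open>cubic_1\<close> and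
  \<open>cubic_tau\<close> are such a pair, with coefficients that make
  \<open>left_normed_product\<close> and \<open>left_mult_cubic\<close> hold.\<close>

definition cubic_1 :: "'a \<Rightarrow> 'a \<Rightarrow> 'a \<Rightarrow> 'a" where
  "cubic_1 x y z = (1 / 3) \<odot>\<^bsub>A\<^esub> (associator A x y z \<oplus> (x \<otimes> y) \<otimes> z \<oplus> (z \<otimes> y) \<otimes> x \<ominus> (y \<otimes> z) \<otimes> x
    \<ominus> (x \<otimes> z) \<otimes> y)"

definition cubic_tau :: "'a \<Rightarrow> 'a \<Rightarrow> 'a \<Rightarrow> 'a" where
  "cubic_tau x y z = cubic_1 x y z \<ominus> (x \<otimes> y) \<otimes> z \<ominus> (z \<otimes> y) \<otimes> x \<ominus> (z \<otimes> x) \<otimes> y \<oplus>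
    (1 / 2) \<odot>\<^bsub>A\<^esub> symmetric_cube x y z"

definition cubic :: "'a \<Rightarrow> 'a \<Rightarrow> 'a \<Rightarrow> 'f \<times> 'f \<Rightarrow> 'a" where
  "cubic x y z k = fst k \<odot>\<^bsub>A\<^esub> cubic_1 x y z \<oplus> snd k \<odot>\<^bsub>A\<^esub> cubic_tau x y z"

context
  fixes x y z
  assumes [simp]: "x \<in> carrier A" "y \<in> carrier A" "z \<in> carrier A"
begin

lemma cubic_annihilates:
  "symmetric_cube x y z \<in> square_annihilator" "cubic x y z k \<in> square_annihilator"
  unfolding symmetric_cube_def cubic_def cubic_1_def cubic_tau_def associator_def
  by (intro square_annihilator_add square_annihilator_smult square_annihilator_minus
      square_annihilator_mult mult_in; simp)+

lemma cubic_closed [simp]: "cubic_1 x y z \<in> carrier A" "cubic_tau x y z \<in> carrier A"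
  "symmetric_cube x y z \<in> carrier A" "cubic x y z k \<in> carrier A"
  by (simp_all add: cubic_def cubic_1_def cubic_tau_def symmetric_cube_def)

context
  fixes \<phi>
  assumes \<phi>: "linear_functional A \<phi>"
begin

lemma functional_symmetric_cube:
  "\<phi> (symmetric_cube x y z) = \<phi> ((x \<otimes> y) \<otimes> z) + \<phi> ((x \<otimes> z) \<otimes> y) + \<phi> ((y \<otimes> x) \<otimes> z)
    + \<phi> ((y \<otimes> z) \<otimes> x) + \<phi> ((z \<otimes> x) \<otimes> y) + \<phi> ((z \<otimes> y) \<otimes> x)"
  by (simp add: symmetric_cube_def functional_simps[OF \<phi>])

lemma functional_cubic_1:
  "3 * \<phi> (cubic_1 x y z) = 2 * \<phi> ((x \<otimes> y) \<otimes> z) - \<phi> (x \<otimes> (y \<otimes> z)) + \<phi> ((z \<otimes> y) \<otimes> x)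
    - \<phi> ((y \<otimes> z) \<otimes> x) - \<phi> ((x \<otimes> z) \<otimes> y)"
  by (simp add: cubic_1_def associator_def functional_simps[OF \<phi>])

lemma functional_cubic_tau:
  "2 * \<phi> (cubic_tau x y z) = 2 * \<phi> (cubic_1 x y z) - 2 * \<phi> ((x \<otimes> y) \<otimes> z) - 2 * \<phi> ((z \<otimes> y) \<otimes> x)
    - 2 * \<phi> ((z \<otimes> x) \<otimes> y) + \<phi> (symmetric_cube x y z)"
  by (simp add: cubic_tau_def functional_simps[OF \<phi>] algebra_simps)

lemma functional_cubic:
  "\<phi> (cubic x y z k) = fst k * \<phi> (cubic_1 x y z) + snd k * \<phi> (cubic_tau x y z)"
  by (simp add: cubic_def functional_simps[OF \<phi>])

end

end

context
  fixes x y z \<phi>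
  assumes xyz: "x \<in> carrier A" "y \<in> carrier A" "z \<in> carrier A"
    and \<phi>: "linear_functional A \<phi>"
begin

lemmas alternative_instances =
  linearised_left_alternative[OF \<phi> xyz] linearised_left_alternative[OF \<phi> xyz(1,3,2)]
  linearised_left_alternative[OF \<phi> xyz(2,3,1)]
  linearised_right_alternative[OF \<phi> xyz] linearised_right_alternative[OF \<phi> xyz(2,1,3)]
  linearised_right_alternative[OF \<phi> xyz(3,1,2)]

text \<open>The factor 6 clears the denominators of \<open>cubic_1\<close> and
  \<open>cubic_tau\<close>. The coefficients 1 for \<open>x\<close>, \<tau> for \<open>y\<close> and
  0 for \<open>z\<close> are those that \<open>mark_coeff\<close> will assign to the three
  letters.\<close>

lemma left_normed_product:
  "6 * \<phi> ((x \<otimes> y) \<otimes> z) =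
    6 * \<phi> (cubic_1 x y z) + 6 * \<phi> (cubic_tau y x z) + \<phi> (symmetric_cube x y z)"
  using functional_cubic_1[OF xyz \<phi>] functional_cubic_1[OF xyz(2,1,3) \<phi>]
    functional_cubic_tau[OF xyz(2,1,3) \<phi>] functional_symmetric_cube[OF xyz \<phi>]
    functional_symmetric_cube[OF xyz(2,1,3) \<phi>] alternative_instances
  by Groebner_Basis.algebra

lemma right_normed_product:
  "6 * \<phi> (x \<otimes> (y \<otimes> z)) = 6 * \<phi> (cubic_1 y x z) + 6 * \<phi> (cubic_tau y x z)
    - 6 * \<phi> (cubic_1 z x y) + \<phi> (symmetric_cube x y z)"
  using functional_cubic_1[OF xyz(2,1,3) \<phi>] functional_cubic_1[OF xyz(3,1,2) \<phi>]
    functional_cubic_tau[OF xyz(2,1,3) \<phi>] functional_symmetric_cube[OF xyz \<phi>]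
    functional_symmetric_cube[OF xyz(2,1,3) \<phi>] alternative_instances
  by Groebner_Basis.algebra

lemma cubic_skew: "\<phi> (cubic x y z k) = - \<phi> (cubic x z y k)"
proof -
  note facts = functional_cubic_1[OF xyz \<phi>] functional_cubic_1[OF xyz(1,3,2) \<phi>]
    functional_cubic_tau[OF xyz \<phi>] functional_cubic_tau[OF xyz(1,3,2) \<phi>]
    functional_symmetric_cube[OF xyz \<phi>] functional_symmetric_cube[OF xyz(1,3,2) \<phi>]
    alternative_instances
  have "\<phi> (cubic_1 x y z) = - \<phi> (cubic_1 x z y)"
    using facts by Groebner_Basis.algebra
  moreover have "\<phi> (cubic_tau x y z) = - \<phi> (cubic_tau x z y)"
    using facts by Groebner_Basis.algebra
  ultimately show ?thesis
    by (simp add: functional_cubic[OF xyz \<phi>] functional_cubic[OF xyz(1,3,2) \<phi>])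
qed

context
  fixes t
  assumes t: "t \<in> carrier A"
begin

interpretation degree_four A \<phi>
  by unfold_locales (rule \<phi>)

lemmas \<phi>R = linear_functional_mult_right[OF \<phi> t]
lemmas \<phi>L = linear_functional_mult_left[OF \<phi> t]

text \<open>Linear algebra in degree four. Its effect is that the linearised cube is an obstruction
  in degree three only: it does not survive a further multiplication.\<close>

lemma symmetric_cube_mult:
  "\<phi> (symmetric_cube x y z \<otimes> t) = 0" "\<phi> (t \<otimes> symmetric_cube x y z) = 0"
proof -
  note [simp] = xyz t
  note rels = R1R[of y x z t] L1L[of x z y t] R1L[of y x z t] L1R[of x z y t]
    a_skew[of x y z t] a_skew[of x z y t] a_skew[of y x z t] a_skew[of y z x t]
    a_skew[of z x y t] a_skew[of z y x t] b_skew[of x y z t] b_skew[of x z y t] b_skew[of y x z t]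
    b_skew[of y z x t] b_skew[of z x y t] b_skew[of z y x t]
  show "\<phi> (symmetric_cube x y z \<otimes> t) = 0"
    using functional_symmetric_cube[OF xyz \<phi>R] rels
    by (simp add: a_eq b_eq) Groebner_Basis.algebra
  show "\<phi> (t \<otimes> symmetric_cube x y z) = 0"
    using functional_symmetric_cube[OF xyz \<phi>L] rels
    by (simp add: left_eqs) Groebner_Basis.algebra
qed

text \<open>Here \<tau> enters: moving a left factor to the right sends \<open>cubic_1\<close> to
  \<open>cubic_tau\<close> and \<open>cubic_tau\<close> to \<open>- cubic_1 - cubic_tau\<close>, the
  companion matrix of \<open>\<tau>^2 + \<tau> + 1\<close>.\<close>

lemma left_mult_cubic: "\<phi> (t \<otimes> cubic x y z k) = \<phi> (cubic x y z (twist 0 k) \<otimes> t)"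
proof -
  note [simp] = xyz t
  note rels = R1R[of x y z t] L1L[of y z x t] L1R[of x y z t] L1R[of x z y t] R1L[of z x y t]
    R1L[of x y z t] R1L[of y x z t]
    a_skew[of x y z t] a_skew[of x z y t] a_skew[of y x z t] a_skew[of y z x t]
    a_skew[of z x y t] a_skew[of z y x t] b_skew[of x y z t] b_skew[of x z y t] b_skew[of y x z t]
    b_skew[of y z x t] b_skew[of z x y t] b_skew[of z y x t]
  note defs = functional_cubic_1[OF xyz \<phi>R, unfolded a_eq b_eq]
    functional_cubic_tau[OF xyz \<phi>R, unfolded a_eq b_eq]
    functional_cubic_1[OF xyz \<phi>L] functional_cubic_tau[OF xyz \<phi>L]
    symmetric_cube_mult rels
  have "\<phi> (t \<otimes> cubic_1 x y z) = \<phi> (cubic_tau x y z \<otimes> t)"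
    using defs by (simp add: left_eqs) Groebner_Basis.algebra
  moreover have "\<phi> (t \<otimes> cubic_tau x y z) = - \<phi> (cubic_1 x y z \<otimes> t) - \<phi> (cubic_tau x y z \<otimes> t)"
    using defs by (simp add: left_eqs) Groebner_Basis.algebra
  ultimately show ?thesis
    by (simp add: functional_cubic[OF xyz \<phi>R] functional_cubic[OF xyz \<phi>L] twist_def ring_distribs)
qed

end

end

text \<open>Skew symmetry across the seam between a cubic element and the factor multiplied to it.
  Together with \<open>cubic_skew\<close> and \<open>right_right_skew\<close> it makes chains
  alternating in all unmarked letters.\<close>

lemma cubic_mult_skew:
  assumes xyz: "x \<in> carrier A" "y \<in> carrier A" "z \<in> carrier A" and t: "t \<in> carrier A"
    and \<phi>: "linear_functional A \<phi>"
  shows "\<phi> (cubic x y z k \<otimes> t) = - \<phi> (cubic x y t k \<otimes> z)"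
proof -
  interpret degree_four A \<phi>
    by unfold_locales (rule \<phi>)
  note [simp] = xyz t
  note \<phi>t = linear_functional_mult_right[OF \<phi> t] and \<phi>z = linear_functional_mult_right[OF \<phi> xyz(3)]
  note xyt = xyz(1,2) t
  note rels = L1L[of t z y x] R1R[of x t z y] R1L[of y t z x] R1R[of y t z x] L1L[of t z x y]
    R1L[of y x z t] R1L[of y t x z]
    a_skew[of x y z t] a_skew[of x z y t] a_skew[of x t y z] a_skew[of y x z t] a_skew[of y z x t]
    a_skew[of y t x z] a_skew[of z x y t] a_skew[of z y x t] a_skew[of z t x y] a_skew[of t x y z]
    a_skew[of t y x z] a_skew[of t z x y]
    b_skew[of x y z t] b_skew[of x z y t] b_skew[of x t y z] b_skew[of y x z t] b_skew[of y z x t]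
    b_skew[of y t x z] b_skew[of z x y t] b_skew[of z y x t] b_skew[of z t x y] b_skew[of t x y z]
    b_skew[of t y x z] b_skew[of t z x y]
  note defs = functional_cubic_1[OF xyz \<phi>t, unfolded a_eq b_eq]
    functional_cubic_tau[OF xyz \<phi>t, unfolded a_eq b_eq]
    functional_cubic_1[OF xyt \<phi>z, unfolded a_eq b_eq]
    functional_cubic_tau[OF xyt \<phi>z, unfolded a_eq b_eq]
    symmetric_cube_mult[OF xyz \<phi> t] symmetric_cube_mult[OF xyt \<phi> xyz(3)] rels
  have "\<phi> (cubic_1 x y z \<otimes> t) = - \<phi> (cubic_1 x y t \<otimes> z)"
    using defs by simp Groebner_Basis.algebra
  moreover have "\<phi> (cubic_tau x y z \<otimes> t) = - \<phi> (cubic_tau x y t \<otimes> z)"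
    using defs by simp Groebner_Basis.algebra
  ultimately show ?thesis
    by (simp add: functional_cubic[OF xyz \<phi>t] functional_cubic[OF xyt \<phi>z])
qed

end

section \<open>Signs of words and functions alternating in their letters\<close>

definition permutation_sign :: "nat list \<Rightarrow> 'f::comm_ring_1" where
  "permutation_sign l = (- 1) ^ card {(i, j). i < j \<and> j < length l \<and> l ! j < l ! i}"

text \<open>Inversions that involve the head are counted apart from those of the tail. The relation
  \<open>R\<close> is arbitrary, so that the count serves both \<open>permutation_sign\<close> and
  \<open>koszul_list\<close>.\<close>

lemma card_inversions_Cons:
  fixes R :: "'a \<Rightarrow> 'a \<Rightarrow> bool"
  shows "card {(i, j). i < j \<and> j < length (t # l) \<and> R ((t # l) ! i) ((t # l) ! j)} =
    length (filter (R t) l) + card {(i, j). i < j \<and> j < length l \<and> R (l ! i) (l ! j)}"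
proof -
  let ?I = "{(i, j). i < j \<and> j < length l \<and> R (l ! i) (l ! j)}"
  let ?J = "{j. j < length l \<and> R t (l ! j)}"
  have "{(i, j). i < j \<and> j < length (t # l) \<and> R ((t # l) ! i) ((t # l) ! j)} =
      Pair 0 ` Suc ` ?J \<union> map_prod Suc Suc ` ?I"
  proof (intro subset_antisym subsetI)
    fix p assume "p \<in> {(i, j). i < j \<and> j < length (t # l) \<and> R ((t # l) ! i) ((t # l) ! j)}"
    then obtain i j where p: "p = (i, j)" "i < j" "j < length (t # l)" "R ((t # l) ! i) ((t # l) ! j)"
      by auto
    then obtain j' where j': "j = Suc j'"
      by (cases j) auto
    show "p \<in> Pair 0 ` Suc ` ?J \<union> map_prod Suc Suc ` ?I"
    proof (cases i)
      case 0
      with p j' show ?thesis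
        by auto
    next
      case (Suc i')
      with p j' have "(i', j') \<in> ?I"
        by auto
      with p j' Suc show ?thesis
        by force
    qed
  qed auto
  moreover have "finite ?I"
    by (rule finite_subset[of _ "{..<length l} \<times> {..<length l}"]) auto
  moreover have "Pair 0 ` Suc ` ?J \<inter> map_prod Suc Suc ` ?I = {}"
    by auto
  ultimately show ?thesis
    by (simp add: card_Un_disjoint card_image inj_on_def prod.inj_map length_filter_conv_card)
qed

lemma permutation_sign_Nil [simp]: "permutation_sign [] = 1"
  by (simp add: permutation_sign_def)

lemma permutation_sign_Cons:
  "permutation_sign (t # l) = (- 1) ^ length (filter (\<lambda>y. y < t) l) * permutation_sign l"
  using card_inversions_Cons[where R = "\<lambda>x y. y < x" and t = t and l = l]
  by (simp add: permutation_sign_def power_add)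

lemma adjacent_swaps_insort:
  fixes H :: "nat list \<Rightarrow> 'f::comm_ring_1"
  assumes "\<And>l1 y z l2. H (l1 @ y # z # l2) = - H (l1 @ z # y # l2)" "sorted l"
  shows "H (l1 @ t # l) = (- 1) ^ length (filter (\<lambda>y. y < t) l) * H (l1 @ insort t l)"
  using assms(2)
proof (induction l arbitrary: l1)
  case (Cons y l)
  show ?case
  proof (cases "t \<le> y")
    case True
    with Cons.prems have "filter (\<lambda>z. z < t) (y # l) = []"
      by (auto simp: filter_empty_conv)
    with True show ?thesis
      by simp
  next
    case False
    then show ?thesis
      using Cons.IH[of "l1 @ [y]"] Cons.prems assms(1)[of l1 t y l] by simp
  qed
qed simp

lemma length_filter_sort: "length (filter P (sort l)) = length (filter P l)"
  by (metis mset_filter mset_sort size_mset)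

text \<open>Insertion sort: each smaller letter that is passed by the head accounts for one
  inversion and one change of sign. The prefix \<open>l1\<close> is carried along because the swaps
  take place in the middle of a word.\<close>

lemma adjacent_swaps_sort:
  fixes H :: "nat list \<Rightarrow> 'f::comm_ring_1"
  assumes "\<And>l1 y z l2. H (l1 @ y # z # l2) = - H (l1 @ z # y # l2)"
  shows "H (l1 @ l) = permutation_sign l * H (l1 @ sort l)"
proof (induction l arbitrary: l1)
  case (Cons t l)
  show ?case
    using Cons[of "l1 @ [t]"] adjacent_swaps_insort[of H, OF assms sorted_sort, of l1 t l]
    by (simp add: permutation_sign_Cons length_filter_sort)
qed simp

text \<open>Two equal letters can be made adjacent; swapping them gives \<open>H = - H\<close>,
  hence zero in characteristic 0.\<close>

lemma adjacent_swaps_not_distinct: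
  fixes H :: "nat list \<Rightarrow> 'f::field_char_0"
  assumes "\<And>l1 y z l2. H (l1 @ y # z # l2) = - H (l1 @ z # y # l2)" "\<not> distinct l"
  shows "H l = 0"
proof -
  obtain l1 l2 l3 y where l: "l = l1 @ [y] @ l2 @ [y] @ l3"
    using assms(2) not_distinct_decomp by blast
  have "H (l1 @ y # y # l2 @ l3) = 0"
    using assms(1)[of l1 y y "l2 @ l3"] by (simp add: eq_neg_iff_add_eq_0 flip: mult_2)
  then show ?thesis
    using adjacent_swaps_move[of H, OF assms(1), of "l1 @ [y]" l2 y l3] l by simp
qed

section \<open>Monomials as sums of chains over a marked letter\<close>

abbreviation mdegree :: "'x monomial \<Rightarrow> nat" where
  "mdegree w \<equiv> length (letters w)"

lemma letters_nonempty [simp]: "letters w \<noteq> []"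
  by (induction w) auto

lemma mdegree_ge_1: "1 \<le> mdegree w"
  by (simp add: Suc_le_eq)

definition delete_nth :: "nat \<Rightarrow> 'x list \<Rightarrow> 'x list" where
  "delete_nth j l = take j l @ drop (Suc j) l"

lemma length_delete_nth [simp]: "j < length l \<Longrightarrow> length (delete_nth j l) = length l - 1"
  by (simp add: delete_nth_def)

lemma delete_nth_snoc: "j < length l \<Longrightarrow> delete_nth j (l @ [x]) = delete_nth j l @ [x]"
  by (simp add: delete_nth_def)

lemma delete_nth_Cons: "delete_nth (Suc j) (x # l) = x # delete_nth j l"
  by (simp add: delete_nth_def)

lemma set_delete_nth: "set (delete_nth j l) \<subseteq> set l"
  by (auto simp: delete_nth_def dest: in_set_takeD in_set_dropD)

text \<open>The coefficient in the monomial \<open>w\<close>, evaluated with its \<open>j\<close>-th letter marked. It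
  vanishes unless \<open>w\<close> arises from this letter by successive multiplications with single letters.\<close>

fun mark_coeff :: "'x monomial \<Rightarrow> nat \<Rightarrow> 'f::field \<times> 'f" where
  "mark_coeff (Gen x) j = (1, 0)"
| "mark_coeff (Prod u v) j =
    (if j < mdegree u then if mdegree v = 1 then mark_coeff u j else (0, 0)
     else if mdegree u = 1 then twist (mdegree v - 1) (mark_coeff v (j - 1)) else (0, 0))"

context alt_metabelian_algebra_char_0
begin

text \<open>A cubic element in \<open>x\<close> and the first two letters of \<open>l\<close>,
  multiplied on the right by the other letters. Only lists of length at least 2 are
  meaningful.\<close>

definition chain :: "'a \<Rightarrow> 'a list \<Rightarrow> 'f \<times> 'f \<Rightarrow> 'a" where
  "chain x l k = foldl (\<otimes>) (cubic x (l ! 0) (l ! 1) k) (drop 2 l)"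

lemma chain_snoc: "2 \<le> length l \<Longrightarrow> chain x (l @ [t]) k = chain x l k \<otimes> t"
  by (auto simp: chain_def nth_append)

lemma chain_annihilates:
  assumes "x \<in> carrier A" "set l \<subseteq> carrier A" "2 \<le> length l"
  shows "chain x l k \<in> square_annihilator"
  using assms(2,3)
proof (induction l rule: rev_induct)
  case (snoc t l)
  show ?case
  proof (cases "length l = 1")
    case True
    then obtain y where "l = [y]"
      by (auto simp: length_Suc_conv)
    with snoc assms show ?thesis
      by (simp add: chain_def cubic_annihilates)
  next
    case False
    with snoc have "2 \<le> length l"
      by simp
    with snoc show ?thesis
      by (auto simp: chain_snoc intro!: square_annihilator_mult square_annihilator_carrier)
  qed
qed simp

lemma functional_chain:
  assumes "x \<in> carrier A" "set l \<subseteq> carrier A" "2 \<le> length l" "linear_functional A \<phi>"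
  shows "\<phi> (chain x l k) = fst k * \<phi> (chain x l (1, 0)) + snd k * \<phi> (chain x l (0, 1))"
  using assms(2-)
proof (induction l arbitrary: \<phi> rule: rev_induct)
  case (snoc t l)
  show ?case
  proof (cases "length l = 1")
    case True
    then obtain y where "l = [y]"
      by (auto simp: length_Suc_conv)
    with snoc assms show ?thesis
      by (simp add: chain_def functional_cubic)
  next
    case False
    with snoc.prems have "2 \<le> length l"
      by simp
    with snoc.prems snoc.IH[of "\<lambda>v. \<phi> (v \<otimes> t)"] show ?thesis
      by (simp add: chain_snoc linear_functional_mult_right)
  qed
qed simp

text \<open>The swapped pair lies inside the cubic start (\<open>cubic_skew\<close>), across its end
  (\<open>cubic_mult_skew\<close>) or among the later factors (\<open>right_right_skew\<close>).
  What follows the pair is absorbed into the functional.\<close>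

lemma chain_skew:
  assumes "x \<in> carrier A" "set (l1 @ y # z # l2) \<subseteq> carrier A" "linear_functional A \<phi>"
  shows "\<phi> (chain x (l1 @ y # z # l2) k) = - \<phi> (chain x (l1 @ z # y # l2) k)"
  using assms(2,3)
proof (induction l2 arbitrary: \<phi> rule: rev_induct)
  case Nil
  consider "l1 = []" | t where "l1 = [t]" | "2 \<le> length l1"
    by (cases l1; cases "tl l1") auto
  then show ?case
  proof cases
    case 1
    with Nil assms(1) show ?thesis
      by (auto simp: chain_def intro: cubic_skew)
  next
    case (2 t)
    with Nil assms(1) show ?thesis
      by (auto simp: chain_def intro: cubic_mult_skew)
  next
    case 3
    have "chain x (l1 @ [y, z]) k = (chain x l1 k \<otimes> y) \<otimes> z"
      "chain x (l1 @ [z, y]) k = (chain x l1 k \<otimes> z) \<otimes> y"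
      using 3 chain_snoc[of "l1 @ [_]" x _ k] by (simp_all add: chain_snoc)
    moreover have "\<phi> ((chain x l1 k \<otimes> y) \<otimes> z) = - \<phi> ((chain x l1 k \<otimes> z) \<otimes> y)"
      using Nil 3 by (intro right_right_skew chain_annihilates assms(1)) auto
    ultimately show ?thesis
      by simp
  qed
next
  case (snoc t l2)
  have "chain x (l1 @ y # z # l2 @ [t]) k = chain x (l1 @ y # z # l2) k \<otimes> t"
    "chain x (l1 @ z # y # l2 @ [t]) k = chain x (l1 @ z # y # l2) k \<otimes> t"
    using chain_snoc[of "l1 @ y # z # l2"] chain_snoc[of "l1 @ z # y # l2"] by simp_all
  then show ?case
    using snoc.IH[of "\<lambda>v. \<phi> (v \<otimes> t)"] snoc.prems by (simp add: linear_functional_mult_right)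
qed

lemma chain_move:
  assumes "x \<in> carrier A" "set (l @ t # l') \<subseteq> carrier A" "linear_functional A \<phi>"
  shows "\<phi> (chain x (l @ t # l') k) = (- 1) ^ length l * \<phi> (chain x (t # l @ l') k)"
  using assms(2)
proof (induction l arbitrary: l' rule: rev_induct)
  case (snoc y l)
  have "\<phi> (chain x (l @ y # t # l') k) = - \<phi> (chain x (l @ t # y # l') k)"
    by (rule chain_skew) (use snoc.prems assms in auto)
  also have "\<phi> (chain x (l @ t # y # l') k) = (- 1) ^ length l * \<phi> (chain x (t # l @ y # l') k)"
    by (rule snoc.IH) (use snoc.prems in auto)
  finally show ?case
    by simp
qed simp

text \<open>Induction along the chain: \<open>t(vz) = (tv)z + (vt)z\<close> pulls \<open>t\<close>
  past the last factor. In the second summand \<open>t\<close> stands near the end; carrying it to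
  the front costs \<open>(- 1)^length l\<close>, which is the difference of the coefficients for
  consecutive lengths.\<close>

lemma left_mult_chain:
  assumes "x \<in> carrier A" "set l \<subseteq> carrier A" "2 \<le> length l" "t \<in> carrier A"
    "linear_functional A \<phi>"
  shows "\<phi> (t \<otimes> chain x l k) = \<phi> (chain x (t # l) (twist (length l) k))"
  using assms(2,3,5)
proof (induction l arbitrary: \<phi> rule: rev_induct)
  case (snoc z l)
  have tz: "t \<in> carrier A" "z \<in> carrier A" "set l \<subseteq> carrier A"
    using snoc assms by auto
  show ?case
  proof (cases "length l = 1")
    case True
    then obtain y where l: "l = [y]"
      by (auto simp: length_Suc_conv)
    with snoc have y: "y \<in> carrier A"
      by simp
    have "\<phi> (t \<otimes> chain x [y, z] k) = \<phi> (cubic x y z (twist 0 k) \<otimes> t)"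
      using left_mult_cubic[OF assms(1) y tz(2) snoc.prems(3) tz(1)] by (simp add: chain_def)
    \<comment> \<open>Only the parity of the length matters to \<open>twist\<close>, so the index 0
      of the cubic case may be replaced by the length 2.\<close>
    also have "\<dots> = \<phi> (chain x [y, z, t] (twist 2 k))"
      by (simp add: chain_def twist_def)
    also have "\<dots> = \<phi> (chain x [t, y, z] (twist 2 k))"
      using chain_skew[of x "[y]" z t "[]" \<phi>] chain_skew[of x "[]" y t "[z]" \<phi>]
        y tz assms(1) snoc.prems(3) by simp
    finally show ?thesis
      by (simp add: l numeral_2_eq_2)
  next
    case False
    then have l2: "2 \<le> length l"
      using snoc by simp
    let ?c = "\<lambda>k. \<phi> (chain x (t # l @ [z]) k)"
    have "\<phi> (t \<otimes> chain x (l @ [z]) k) = \<phi> (t \<otimes> (chain x l k \<otimes> z))"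
      using l2 by (simp add: chain_snoc)
    also have "\<dots> = \<phi> ((t \<otimes> chain x l k) \<otimes> z) + \<phi> ((chain x l k \<otimes> t) \<otimes> z)"
      by (intro left_right chain_annihilates snoc.prems assms(1) tz l2)
    also have "\<phi> ((t \<otimes> chain x l k) \<otimes> z) = \<phi> (chain x (t # l) (twist (length l) k) \<otimes> z)"
      by (intro snoc.IH tz l2 linear_functional_mult_right snoc.prems)
    also have "chain x (t # l) (twist (length l) k) \<otimes> z = chain x (t # l @ [z]) (twist (length l) k)"
      using l2 chain_snoc[of "t # l"] by simp
    also have "(chain x l k \<otimes> t) \<otimes> z = chain x (l @ t # [z]) k"
      using l2 chain_snoc[of "l @ [t]"] by (simp add: chain_snoc)
    also have "\<phi> (chain x (l @ t # [z]) k) = (- 1) ^ length l * ?c k"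
      by (rule chain_move) (use assms(1) tz snoc.prems in auto)
    \<comment> \<open>The recursion \<open>\<lambda>_(m+1) = \<lambda>_m + (- 1)^m\<close> with
      \<open>m = length l\<close>: it gives \<open>\<tau> + 1\<close> for even \<open>m\<close> and
      \<open>(1 + \<tau>) - 1\<close> for odd \<open>m\<close>.\<close>
    also have "?c (twist (length l) k) + (- 1) ^ length l * ?c k = ?c (twist (length (l @ [z])) k)"
    proof -
      have "?c k = fst k * ?c (1, 0) + snd k * ?c (0, 1)" for k
        by (intro functional_chain) (use assms(1) tz snoc.prems in auto)
      from this[of k] this[of "twist (length l) k"] this[of "twist (length (l @ [z])) k"]
      show ?thesis
        by (simp add: twist_def algebra_simps)
    qed
    finally show ?thesis
      by simp
  qed
qed simp

end

lemma mdegree_eq_1: "mdegree w = 1 \<longleftrightarrow> (\<exists>x. w = Gen x)"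
proof (cases w)
  case (Prod u v)
  then have "mdegree w \<noteq> 1"
    using mdegree_ge_1[of u] mdegree_ge_1[of v] by (simp only: letters.simps length_append)
  with Prod show ?thesis
    by simp
qed simp

lemma mdegree_eq_2: "mdegree w = 2 \<longleftrightarrow> (\<exists>x y. w = Prod (Gen x) (Gen y))"
proof (cases w)
  case (Prod u v)
  then have "mdegree w = 2 \<longleftrightarrow> mdegree u = 1 \<and> mdegree v = 1"
    using mdegree_ge_1[of u] mdegree_ge_1[of v] by (simp only: letters.simps length_append) linarith
  with Prod show ?thesis
    unfolding mdegree_eq_1 by auto
qed simp

lemma (in nonassoc_algebra) eval_monomial_closed:
  "(\<And>x. x \<in> set (letters w) \<Longrightarrow> b x \<in> carrier A) \<Longrightarrow> eval_monomial A b w \<in> carrier A"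
  by (induction w) auto

context alt_metabelian_algebra_char_0
begin

lemma eval_monomial_annihilates:
  assumes "\<And>x. x \<in> set (letters w) \<Longrightarrow> b x \<in> carrier A" "2 \<le> mdegree w"
  shows "eval_monomial A b w \<in> square_annihilator"
  using assms by (cases w) (auto intro!: square_annihilator_mult eval_monomial_closed)

lemma functional_chain_0:
  assumes "x \<in> carrier A" "set l \<subseteq> carrier A" "2 \<le> length l" "linear_functional A \<phi>"
  shows "\<phi> (chain x l (0, 0)) = 0"
  using functional_chain[OF assms, of "(0, 0)"] by simp

text \<open>Induction on the monomial. A product of two factors of degree at least 2 is zero.
  Otherwise one factor is a single letter: on the right it is appended to every chain, on the left
  it is prepended with a twist, and its own mark has coefficient zero. The base case is degree 3,
  whose symmetric part is lost with the next multiplication.\<close>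

theorem monomial_reduction:
  assumes "\<And>x. x \<in> set (letters w) \<Longrightarrow> b x \<in> carrier A" "3 \<le> mdegree w" "linear_functional A \<phi>"
  shows "\<phi> (eval_monomial A b w) =
    (\<Sum>j<mdegree w. \<phi> (chain (b (letters w ! j)) (map b (delete_nth j (letters w))) (mark_coeff w j))) +
    (if mdegree w = 3
     then \<phi> (symmetric_cube (b (letters w ! 0)) (b (letters w ! 1)) (b (letters w ! 2))) / 6 else 0)"
  using assms
proof (induction w arbitrary: \<phi>)
  case (Prod u v)
  have bu: "b x \<in> carrier A" if "x \<in> set (letters u)" for x
    using Prod.prems that by simp
  have bv: "b x \<in> carrier A" if "x \<in> set (letters v)" for x
    using Prod.prems that by simp
  have bj: "b ((letters u @ letters v) ! j) \<in> carrier A" if "j < mdegree (Prod u v)" for j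
    using Prod.prems(1) that by (metis letters.simps(2) nth_mem)
  have bd: "set (map b (delete_nth j (letters u @ letters v))) \<subseteq> carrier A" for j
    using Prod.prems(1) set_delete_nth[of j "letters u @ letters v"] by auto
  have bdu: "set (map b (delete_nth j (letters u))) \<subseteq> carrier A" for j
    using bu set_delete_nth[of j "letters u"] by auto
  have bdv: "set (map b (delete_nth j (letters v))) \<subseteq> carrier A" for j
    using bv set_delete_nth[of j "letters v"] by auto
  note \<phi> = Prod.prems(3)
  \<comment> \<open>Marks with coefficient zero contribute nothing, so that sums over the letters of
    one factor extend to all letters.\<close>
  have zero: "\<phi> (chain (b ((letters u @ letters v) ! j)) (map b (delete_nth j (letters u @ letters v))) (0, 0)) = 0"
    if "j < mdegree (Prod u v)" for j
    by (rule functional_chain_0[OF bj[OF that] bd _ \<phi>]) (use Prod.prems that in simp)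
  consider "2 \<le> mdegree u" "2 \<le> mdegree v"
    | x y z where "u = Prod (Gen x) (Gen y)" "v = Gen z"
    | x y z where "v = Prod (Gen y) (Gen z)" "u = Gen x"
    | z where "3 \<le> mdegree u" "v = Gen z" | x where "3 \<le> mdegree v" "u = Gen x"
  proof -
    have "2 \<le> mdegree u \<and> 2 \<le> mdegree v \<or> mdegree u = 2 \<and> mdegree v = 1 \<or> mdegree u = 1 \<and> mdegree v = 2 \<or>
        3 \<le> mdegree u \<and> mdegree v = 1 \<or> mdegree u = 1 \<and> 3 \<le> mdegree v"
      using Prod.prems(2) mdegree_ge_1[of u] mdegree_ge_1[of v]
      by (simp only: letters.simps length_append) linarith
    then show ?thesis
      using that unfolding mdegree_eq_1 mdegree_eq_2 by blast
  qed
  then show ?case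
  proof cases
    case 1
    have "\<phi> (eval_monomial A b (Prod u v)) = 0"
    proof -
      obtain v1 v2 where "v = Prod v1 v2"
        using 1 by (cases v) auto
      then show ?thesis
        using annihilated_products(1)[OF \<phi> eval_monomial_annihilates[OF bu 1(1)]] bv
        by (simp add: eval_monomial_closed)
    qed
    moreover have "\<phi> (chain (b (letters (Prod u v) ! j)) (map b (delete_nth j (letters (Prod u v))))
        (mark_coeff (Prod u v) j)) = 0" if "j < mdegree (Prod u v)" for j
      using zero[OF that] 1 by auto
    ultimately show ?thesis
      using 1 by simp
  next
    case (2 x y z)
    then have xyz: "b x \<in> carrier A" "b y \<in> carrier A" "b z \<in> carrier A"
      using Prod.prems by auto
    show ?thesis
      using left_normed_product[OF xyz \<phi>] zero[of 2] 2 xyz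
      by (simp add: numeral_3_eq_3 delete_nth_def chain_def functional_cubic[OF _ _ _ \<phi>] twist_def
          field_simps)
  next
    case (3 x y z)
    then have xyz: "b x \<in> carrier A" "b y \<in> carrier A" "b z \<in> carrier A"
      using Prod.prems by auto
    show ?thesis
      using right_normed_product[OF xyz \<phi>] zero[of 0] 3 xyz
      by (simp add: numeral_3_eq_3 delete_nth_def chain_def functional_cubic[OF _ _ _ \<phi>] twist_def
          field_simps)
  next
    case (4 z)
    have z: "b z \<in> carrier A"
      using Prod.prems 4 by simp
    let ?\<phi> = "\<lambda>v. \<phi> (v \<otimes> b z)"
    have \<phi>': "linear_functional A ?\<phi>"
      by (rule linear_functional_mult_right[OF \<phi> z])
    have "\<phi> (eval_monomial A b (Prod u v)) = (\<Sum>j<mdegree u.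
        ?\<phi> (chain (b (letters u ! j)) (map b (delete_nth j (letters u))) (mark_coeff u j)))"
    proof -
      have "?\<phi> (symmetric_cube (b (letters u ! 0)) (b (letters u ! 1)) (b (letters u ! 2))) = 0"
        by (rule symmetric_cube_mult(1)[OF _ _ _ \<phi> z]) (use bu 4 in auto)
      then show ?thesis
        using Prod.IH(1)[of ?\<phi>] bu 4 \<phi>' by simp
    qed
    also have "\<dots> = (\<Sum>j<mdegree u. \<phi> (chain (b (letters (Prod u v) ! j))
        (map b (delete_nth j (letters (Prod u v)))) (mark_coeff (Prod u v) j)))"
      by (rule sum.cong) (use 4 in \<open>simp_all add: nth_append delete_nth_snoc chain_snoc\<close>)
    also have "\<dots> = (\<Sum>j<mdegree (Prod u v). \<phi> (chain (b (letters (Prod u v) ! j))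
        (map b (delete_nth j (letters (Prod u v)))) (mark_coeff (Prod u v) j)))"
      using 4 zero[of "mdegree u"] by simp
    finally show ?thesis
      using 4 by simp
  next
    case (5 x)
    have x: "b x \<in> carrier A"
      using Prod.prems 5 by simp
    let ?\<phi> = "\<lambda>v. \<phi> (b x \<otimes> v)"
    have \<phi>': "linear_functional A ?\<phi>"
      by (rule linear_functional_mult_left[OF \<phi> x])
    have "\<phi> (eval_monomial A b (Prod u v)) = (\<Sum>j<mdegree v.
        ?\<phi> (chain (b (letters v ! j)) (map b (delete_nth j (letters v))) (mark_coeff v j)))"
    proof -
      have "?\<phi> (symmetric_cube (b (letters v ! 0)) (b (letters v ! 1)) (b (letters v ! 2))) = 0"
        by (rule symmetric_cube_mult(2)[OF _ _ _ \<phi> x]) (use bv 5 in auto)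
      then show ?thesis
        using Prod.IH(2)[of ?\<phi>] bv 5 \<phi>' by simp
    qed
    \<comment> \<open>The new letter takes position 0, hence the shift of the marks of
      \<open>v\<close>. The list without the marked letter has length \<open>mdegree v - 1\<close>,
      the index of \<open>twist\<close> in \<open>mark_coeff\<close>.\<close>
    also have "\<dots> = (\<Sum>j<mdegree v. \<phi> (chain (b (letters (Prod u v) ! Suc j))
        (map b (delete_nth (Suc j) (letters (Prod u v)))) (mark_coeff (Prod u v) (Suc j))))"
    proof (rule sum.cong)
      fix j assume j: "j \<in> {..<mdegree v}"
      have "?\<phi> (chain (b (letters v ! j)) (map b (delete_nth j (letters v))) (mark_coeff v j)) =
        \<phi> (chain (b (letters v ! j)) (b x # map b (delete_nth j (letters v)))
          (twist (length (map b (delete_nth j (letters v)))) (mark_coeff v j)))"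
        by (rule left_mult_chain) (use bv bdv 5 x \<phi> j in auto)
      with j 5 show "?\<phi> (chain (b (letters v ! j)) (map b (delete_nth j (letters v))) (mark_coeff v j)) =
          \<phi> (chain (b (letters (Prod u v) ! Suc j))
        (map b (delete_nth (Suc j) (letters (Prod u v)))) (mark_coeff (Prod u v) (Suc j)))"
        by (simp add: delete_nth_Cons)
    qed simp
    also have "\<dots> = (\<Sum>j<mdegree (Prod u v). \<phi> (chain (b (letters (Prod u v) ! j))
        (map b (delete_nth j (letters (Prod u v)))) (mark_coeff (Prod u v) j)))"
      using 5 zero[of 0] by (simp add: sum.lessThan_Suc_shift del: sum.lessThan_Suc)
    finally show ?thesis
      using 5 by simp
  qed
qed simp

text \<open>If the degree exceeds the number of distinct letters by 2, a repetition remains after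
  the removal of the marked letter, and a chain with a repeated letter is zero. From degree 4 on
  there is no symmetric part.\<close>

lemma monomial_vanishes:
  fixes b :: "nat \<Rightarrow> 'a"
  assumes b: "\<And>i. b i \<in> carrier A" and w: "4 \<le> mdegree w" "card (set (letters w)) + 2 \<le> mdegree w"
  shows "eval_monomial A b w = \<zero>"
proof (rule eq_by_functionals)
  fix \<phi> assume \<phi>: "linear_functional A \<phi>"
  have "\<phi> (chain (b (letters w ! j)) (map b (delete_nth j (letters w))) (mark_coeff w j)) = 0"
    if "j < mdegree w" for j
  proof -
    let ?H = "\<lambda>l. \<phi> (chain (b (letters w ! j)) (map b l) (mark_coeff w j))"
    have "?H (l1 @ y # z # l2) = - ?H (l1 @ z # y # l2)" for l1 y z l2
      using chain_skew[of "b (letters w ! j)" "map b l1" "b y" "b z" "map b l2" \<phi> "mark_coeff w j"]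
        b \<phi> by auto
    moreover have "card (set (delete_nth j (letters w))) < length (delete_nth j (letters w))"
      using w that card_mono[OF _ set_delete_nth[of j "letters w"]] by simp
    then have "\<not> distinct (delete_nth j (letters w))"
      using distinct_card by fastforce
    ultimately show ?thesis
      by (rule adjacent_swaps_not_distinct)
  qed
  then show "\<phi> (eval_monomial A b w) = \<phi> \<zero>"
    using monomial_reduction[of w b \<phi>] b \<phi> w by (simp add: functional_zero)
qed (simp_all add: eval_monomial_closed b)

end

section \<open>Multilinear polynomials through their marks\<close>

definition letter_index :: "'x \<Rightarrow> 'x list \<Rightarrow> nat" where
  "letter_index x l = length (takeWhile (\<lambda>y. y \<noteq> x) l)"

lemma letter_index_nth: "distinct l \<Longrightarrow> j < length l \<Longrightarrow> letter_index (l ! j) l = j"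
  by (induction l arbitrary: j) (auto simp: letter_index_def nth_Cons split: nat.split)

lemma delete_nth_distinct:
  "distinct l \<Longrightarrow> j < length l \<Longrightarrow> delete_nth j l = filter (\<lambda>y. y \<noteq> l ! j) l"
proof (induction l arbitrary: j)
  case (Cons x l)
  then show ?case
    by (cases j) (auto simp: delete_nth_def intro!: filter_True[symmetric])
qed simp

text \<open>Positions depend on the monomial, letters do not: after this reindexing the
  contributions of the monomials of a polynomial can be added letter by letter.\<close>

lemma sum_positions_letters:
  assumes "distinct l"
  shows "(\<Sum>j<length l. g (l ! j) (delete_nth j l) j) =
    (\<Sum>x\<in>set l. g x (filter (\<lambda>y. y \<noteq> x) l) (letter_index x l))"
proof -
  have "(\<Sum>j<length l. g (l ! j) (delete_nth j l) j) =
      (\<Sum>j<length l. g (l ! j) (filter (\<lambda>y. y \<noteq> l ! j) l) (letter_index (l ! j) l))"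
    using assms by (intro sum.cong) (simp_all add: delete_nth_distinct letter_index_nth)
  also have "\<dots> = (\<Sum>x\<in>set l. g x (filter (\<lambda>y. y \<noteq> x) l) (letter_index x l))"
    using assms by (intro sum.reindex_bij_betw bij_betw_nth) auto
  finally show ?thesis .
qed

text \<open>The value of the monomial \<open>w\<close> with an even mark in place of \<open>i\<close> and one and the same
  odd element in place of the other letters.\<close>

definition marked_value :: "nat \<Rightarrow> nat monomial \<Rightarrow> 'f::field \<times> 'f" where
  "marked_value i w = mark_coeff w (letter_index i (letters w))"

text \<open>The sign of sorting the unmarked letters, in which chains alternate. By
  \<open>marked_sign_koszul\<close> it is also the Koszul sign for even \<open>i\<close> and odd
  remaining letters.\<close>

definition marked_sign :: "nat \<Rightarrow> nat monomial \<Rightarrow> 'f::field" where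
  "marked_sign i w = permutation_sign (filter (\<lambda>y. y \<noteq> i) (letters w))"

text \<open>What the superalgebra generated by one odd element sees of \<open>f\<close>, by
  \<open>identities_marks_vanish\<close>: for every marked letter one linear condition per component
  in \<open>F[\<tau>]\<close>.\<close>

definition marks_vanish :: "nat \<Rightarrow> (nat monomial \<Rightarrow> 'f::field) \<Rightarrow> bool" where
  "marks_vanish n f \<longleftrightarrow> (\<forall>i<n.
    (\<Sum>w\<in>{w. f w \<noteq> 0}. marked_sign i w * f w * fst (marked_value i w)) = 0 \<and>
    (\<Sum>w\<in>{w. f w \<noteq> 0}. marked_sign i w * f w * snd (marked_value i w)) = 0)"

definition polynomial_value ::
    "('f::field, 'a, 'm) module_scheme \<Rightarrow> (nat monomial \<Rightarrow> 'f) \<Rightarrow> (nat \<Rightarrow> 'a) \<Rightarrow> 'a" where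
  "polynomial_value A f b = (\<Oplus>\<^bsub>A\<^esub>w\<in>{w. f w \<noteq> 0}. f w \<odot>\<^bsub>A\<^esub> eval_monomial A b w)"

context alt_metabelian_algebra_char_0
begin

lemma symmetric_cube_commute:
  assumes "x \<in> carrier A" "y \<in> carrier A" "z \<in> carrier A"
  shows "symmetric_cube x z y = symmetric_cube x y z" "symmetric_cube y x z = symmetric_cube x y z"
  using assms by (simp_all add: symmetric_cube_def M.a_ac)

lemma symmetric_cube_permutation:
  assumes "\<And>i. b i \<in> carrier A" "distinct l" "set l = {..<3}"
  shows "symmetric_cube (b (l ! 0)) (b (l ! 1)) (b (l ! 2)) =
    symmetric_cube (b 0) (b 1) (b (2 :: nat))"
proof -
  have "length l = 3"
    using distinct_card[OF assms(2)] assms(3) by simp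
  then obtain i j k where l: "l = [i, j, k]"
    by (auto simp: numeral_3_eq_3 length_Suc_conv)
  have "i < 3" "j < 3" "k < 3"
    using assms(3) l by auto
  then have "i \<in> {0, 1, 2}" "j \<in> {0, 1, 2}" "k \<in> {0, 1, 2}"
    by auto
  then show ?thesis
    using assms(1,2) l symmetric_cube_commute[of "b 0" "b 1" "b 2"]
      symmetric_cube_commute[of "b 1" "b 0" "b 2"] symmetric_cube_commute[of "b 0" "b 2" "b 1"]
      symmetric_cube_commute[of "b 1" "b 2" "b 0"] symmetric_cube_commute[of "b 2" "b 1" "b 0"]
    by auto
qed

text \<open>Once the unmarked letters are sorted, all monomials involve the same elements
  \<open>c i (1, 0)\<close> and \<open>c i (0, 1)\<close>, and their coefficients are the sums in
  \<open>marks_vanish\<close>. Only the symmetric part is left; being invariant under permutations,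
  it is multiplied by the sum of all coefficients.\<close>

theorem polynomial_value_by_marks:
  assumes f: "multilinear_polynomial n f" and n: "3 \<le> n" and marks: "marks_vanish n f"
    and b: "\<And>i. b i \<in> carrier A"
  shows "polynomial_value A f b = (if n = 3
    then ((\<Sum>w\<in>{w. f w \<noteq> 0}. f w) / 6) \<odot>\<^bsub>A\<^esub> symmetric_cube (b 0) (b 1) (b 2) else \<zero>)"
proof (rule eq_by_functionals)
  fix \<phi> assume \<phi>: "linear_functional A \<phi>"
  let ?W = "{w. f w \<noteq> 0}"
  let ?S = "if n = 3 then \<phi> (symmetric_cube (b 0) (b 1) (b 2)) / 6 else 0"
  define c where "c i k = \<phi> (chain (b i) (map b (filter (\<lambda>y. y \<noteq> i) [0..<n])) k)" for i k
  have c: "c i k = fst k * c i (1, 0) + snd k * c i (0, 1)" if "i < n" for i k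
  proof -
    have "length (filter (\<lambda>y. y \<noteq> i) [0..<n]) = card ({..<n} - {i})"
      using distinct_card[of "filter (\<lambda>y. y \<noteq> i) [0..<n]"]
      by (simp add: set_eq_iff set_diff_eq lessThan_def)
    also have "\<dots> \<ge> 2"
      using n that by simp
    finally show ?thesis
      unfolding c_def by (intro functional_chain \<phi>) (use b in auto)
  qed
  have reduce: "\<phi> (eval_monomial A b w) = (\<Sum>i<n. marked_sign i w * c i (marked_value i w)) + ?S"
    if w: "w \<in> ?W" for w
  proof -
    have d: "distinct (letters w)" "set (letters w) = {..<n}"
      using f w by (auto simp: multilinear_polynomial_def)
    then have deg: "mdegree w = n"
      using distinct_card by fastforce
    have chain: "\<phi> (chain (b i) (map b (filter (\<lambda>y. y \<noteq> i) (letters w))) k) = marked_sign i w * c i k"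
      for i k
    proof -
      let ?H = "\<lambda>l. \<phi> (chain (b i) (map b l) k)"
      have H: "?H (l1 @ y # z # l2) = - ?H (l1 @ z # y # l2)" for l1 y z l2
        using chain_skew[of "b i" "map b l1" "b y" "b z" "map b l2" \<phi> k] b \<phi> by auto
      have "sort (filter (\<lambda>y. y \<noteq> i) (letters w)) = filter (\<lambda>y. y \<noteq> i) [0..<n]"
        using d by (intro sorted_distinct_set_unique sorted_wrt_filter sorted_sort) auto
      then show ?thesis
        using adjacent_swaps_sort[of ?H, OF H, of "[]" "filter (\<lambda>y. y \<noteq> i) (letters w)"]
        by (simp add: marked_sign_def c_def)
    qed
    have cube: "symmetric_cube (b (letters w ! 0)) (b (letters w ! 1)) (b (letters w ! 2)) =
        symmetric_cube (b 0) (b 1) (b 2)" if "n = 3"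
      by (rule symmetric_cube_permutation) (use b d that in auto)
    have "\<phi> (eval_monomial A b w) = (\<Sum>i<n.
        \<phi> (chain (b i) (map b (filter (\<lambda>y. y \<noteq> i) (letters w))) (marked_value i w))) + ?S"
      using monomial_reduction[of w b \<phi>] n b \<phi> cube
        sum_positions_letters[OF d(1), of "\<lambda>x l j. \<phi> (chain (b x) (map b l) (mark_coeff w j))"]
      by (simp add: marked_value_def deg d(2))
    then show ?thesis
      by (simp add: chain)
  qed
  have fin: "finite ?W"
    using f by (simp add: multilinear_polynomial_def)
  have "\<phi> (polynomial_value A f b) = (\<Sum>w\<in>?W. f w * \<phi> (eval_monomial A b w))"
    unfolding polynomial_value_def using b
    by (subst functional_finsum[OF \<phi>]) (auto simp: eval_monomial_closed functional_smult[OF \<phi>])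
  also have "\<dots> = (\<Sum>w\<in>?W. f w * (\<Sum>i<n. marked_sign i w * c i (marked_value i w))) +
      (\<Sum>w\<in>?W. f w) * ?S"
    by (simp only: reduce cong: sum.cong) (simp add: sum.distrib sum_distrib_right algebra_simps)
  also have "(\<Sum>w\<in>?W. f w * (\<Sum>i<n. marked_sign i w * c i (marked_value i w))) =
      (\<Sum>i<n. \<Sum>w\<in>?W. f w * (marked_sign i w * c i (marked_value i w)))"
    by (simp add: sum_distrib_left) (rule sum.swap)
  also have "\<dots> = (\<Sum>i<n. (\<Sum>w\<in>?W. marked_sign i w * f w * fst (marked_value i w)) * c i (1, 0) +
      (\<Sum>w\<in>?W. marked_sign i w * f w * snd (marked_value i w)) * c i (0, 1))"
  proof (rule sum.cong)
    fix i assume "i \<in> {..<n}"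
    then have "f w * (marked_sign i w * c i (marked_value i w)) =
        marked_sign i w * f w * fst (marked_value i w) * c i (1, 0) +
        marked_sign i w * f w * snd (marked_value i w) * c i (0, 1)" for w
      using c[of i "marked_value i w"] by (simp add: algebra_simps)
    then show "(\<Sum>w\<in>?W. f w * (marked_sign i w * c i (marked_value i w))) =
      (\<Sum>w\<in>?W. marked_sign i w * f w * fst (marked_value i w)) * c i (1, 0) +
      (\<Sum>w\<in>?W. marked_sign i w * f w * snd (marked_value i w)) * c i (0, 1)"
      by (simp add: sum.distrib sum_distrib_right)
  qed simp
  also have "\<dots> = 0"
    using marks by (simp add: marks_vanish_def)
  finally show "\<phi> (polynomial_value A f b) = \<phi> (if n = 3
      then ((\<Sum>w\<in>?W. f w) / 6) \<odot>\<^bsub>A\<^esub> symmetric_cube (b 0) (b 1) (b 2) else \<zero>)"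
    using b by (simp add: functional_simps[OF \<phi>])
next
  show "polynomial_value A f b \<in> carrier A"
    unfolding polynomial_value_def using b by (intro M.finsum_closed) (auto simp: eval_monomial_closed)
qed (use b in simp)

end

section \<open>The Koszul sign\<close>

definition koszul_list :: "(nat \<Rightarrow> bit) \<Rightarrow> nat list \<Rightarrow> 'f::comm_ring_1" where
  "koszul_list p l = (- 1) ^ card {(i, j). i < j \<and> j < length l \<and>
    (l ! j < l ! i \<and> p (l ! i) = 1 \<and> p (l ! j) = 1)}"

lemma koszul_sign_letters: "koszul_sign p w = koszul_list p (letters w)"
  by (simp add: koszul_sign_def koszul_list_def)

lemma koszul_list_Nil [simp]: "koszul_list p [] = 1"
  by (simp add: koszul_list_def)

lemma koszul_list_Cons:
  "koszul_list p (t # l) =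
    (- 1) ^ length (filter (\<lambda>y. y < t \<and> p t = 1 \<and> p y = 1) l) * koszul_list p l"
  using card_inversions_Cons[where R = "\<lambda>x y. y < x \<and> p x = 1 \<and> p y = 1" and t = t and l = l]
  by (simp add: koszul_list_def power_add)

lemma koszul_list_append:
  "koszul_list p (l @ m) = koszul_list p l * koszul_list p m *
    (\<Prod>t\<leftarrow>l. (- 1) ^ length (filter (\<lambda>y. y < t \<and> p t = 1 \<and> p y = 1) m))"
  by (induction l) (simp_all add: koszul_list_Cons power_add mult_ac)

lemma koszul_list_even: "(\<And>x. x \<in> set l \<Longrightarrow> p x = 0) \<Longrightarrow> koszul_list p l = 1"
  by (induction l) (simp_all add: koszul_list_Cons)

lemma koszul_list_square: "koszul_list p l * koszul_list p l = (1 :: 'f::comm_ring_1)"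
  unfolding koszul_list_def by (simp flip: power_add mult_2)

text \<open>An even letter takes part in no Koszul inversion, just like a deleted one.\<close>

lemma permutation_sign_filter:
  "permutation_sign (filter (\<lambda>y. y \<noteq> i) l) = koszul_list (\<lambda>k. if k = i then 0 else 1) l"
proof (induction l)
  case (Cons t l)
  have "length (filter (\<lambda>y. y < t) (filter (\<lambda>y. y \<noteq> i) l)) =
      length (filter (\<lambda>y. y < t \<and> (if y = i then 0 else 1 :: bit) = 1) l)"
    by (induction l) auto
  with Cons show ?case
    by (simp add: koszul_list_Cons permutation_sign_Cons)
qed simp

lemma marked_sign_koszul: "marked_sign i w = koszul_sign (\<lambda>k. if k = i then 0 else 1) w"
  by (simp add: marked_sign_def koszul_sign_letters permutation_sign_filter)

lemma grassmann_sign_empty [simp]: "grassmann_sign {} U = 1" "grassmann_sign T {} = 1"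
  by (simp_all add: grassmann_sign_def)

lemma grassmann_sign_union_left:
  assumes "finite S" "finite T" "finite U" "S \<inter> T = {}"
  shows "grassmann_sign (S \<union> T) U = grassmann_sign S U * grassmann_sign T U"
proof -
  have "{(t, u). t \<in> S \<union> T \<and> u \<in> U \<and> u < t} =
      {(t, u). t \<in> S \<and> u \<in> U \<and> u < t} \<union> {(t, u). t \<in> T \<and> u \<in> U \<and> u < t}"
    by auto
  moreover have "finite {(t, u). t \<in> R \<and> u \<in> U \<and> u < t}" if "finite R" for R :: "nat set"
    by (rule finite_subset[of _ "R \<times> U"]) (use assms that in auto)
  moreover have "{(t, u). t \<in> S \<and> u \<in> U \<and> u < t} \<inter> {(t, u). t \<in> T \<and> u \<in> U \<and> u < t} = {}"
    using assms by auto
  ultimately have "card {(t, u). t \<in> S \<union> T \<and> u \<in> U \<and> u < t} =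
      card {(t, u). t \<in> S \<and> u \<in> U \<and> u < t} + card {(t, u). t \<in> T \<and> u \<in> U \<and> u < t}"
    using assms by (simp add: card_Un_disjoint)
  then show ?thesis
    by (simp add: grassmann_sign_def power_add)
qed

lemma grassmann_sign_union_right:
  assumes "finite S" "finite T" "finite U" "S \<inter> T = {}"
  shows "grassmann_sign U (S \<union> T) = grassmann_sign U S * grassmann_sign U T"
proof -
  have "{(t, u). t \<in> U \<and> u \<in> S \<union> T \<and> u < t} =
      {(t, u). t \<in> U \<and> u \<in> S \<and> u < t} \<union> {(t, u). t \<in> U \<and> u \<in> T \<and> u < t}"
    by auto
  moreover have "finite {(t, u). t \<in> U \<and> u \<in> R \<and> u < t}" if "finite R" for R :: "nat set"
    by (rule finite_subset[of _ "U \<times> R"]) (use assms that in auto)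
  moreover have "{(t, u). t \<in> U \<and> u \<in> S \<and> u < t} \<inter> {(t, u). t \<in> U \<and> u \<in> T \<and> u < t} = {}"
    using assms by auto
  ultimately have "card {(t, u). t \<in> U \<and> u \<in> S \<union> T \<and> u < t} =
      card {(t, u). t \<in> U \<and> u \<in> S \<and> u < t} + card {(t, u). t \<in> U \<and> u \<in> T \<and> u < t}"
    using assms by (simp add: card_Un_disjoint)
  then show ?thesis
    by (simp add: grassmann_sign_def power_add)
qed

text \<open>Each pair in \<open>T \<times> U\<close> is an inversion for exactly one of the two
  orders, so the two exponents add up to \<open>card T * card U\<close>.\<close>

lemma grassmann_sign_commute:
  assumes "finite T" "finite U" "T \<inter> U = {}"
  shows "(grassmann_sign T U :: 'f::field) = (- 1) ^ (card T * card U) * grassmann_sign U T"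
proof -
  let ?R = "\<lambda>T U. {(t, u). t \<in> T \<and> u \<in> U \<and> u < (t :: nat)}"
  have fin: "finite (?R T U)" if "finite T" "finite U" for T U
    by (rule finite_subset[of _ "T \<times> U"]) (use that in auto)
  have "T \<times> U = ?R T U \<union> prod.swap ` ?R U T"
    using assms(3) by (auto simp: image_iff)
  moreover have "?R T U \<inter> prod.swap ` ?R U T = {}"
    by auto
  moreover have "card (prod.swap ` ?R U T) = card (?R U T)"
    by (intro card_image) simp
  ultimately have "card (T \<times> U) = card (?R T U) + card (?R U T)"
    using assms fin by (simp only: card_Un_disjoint finite_imageI)
  then have "card (?R T U) + card (?R U T) = card T * card U"
    by (simp add: card_cartesian_product)
  then have "(- 1) ^ (card T * card U) = (grassmann_sign T U :: 'f) * grassmann_sign U T"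
    by (simp add: grassmann_sign_def flip: power_add)
  moreover have "(grassmann_sign U T :: 'f) * grassmann_sign U T = 1"
    by (simp add: grassmann_sign_def flip: power_add mult_2)
  ultimately show ?thesis
    by (simp add: mult.assoc)
qed

lemma grassmann_sign_less:
  "(\<And>t u. t \<in> T \<Longrightarrow> u \<in> U \<Longrightarrow> t < u) \<Longrightarrow> grassmann_sign T U = 1"
proof -
  assume "\<And>t u. t \<in> T \<Longrightarrow> u \<in> U \<Longrightarrow> t < u"
  then have "{(t, u). t \<in> T \<and> u \<in> U \<and> u < t} = {}"
    by (auto dest: less_asym)
  then show ?thesis
    unfolding grassmann_sign_def by (metis card.empty power_0)
qed

lemma of_nat_bit: "(of_nat n :: bit) = of_bool (odd n)"
  by (induction n) auto

lemma minus_1_power_bit: "(- 1 :: 'f::comm_ring_1) ^ n = (if (of_nat n :: bit) = 1 then - 1 else 1)"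
  by (simp add: of_nat_bit)

section \<open>Superalgebras\<close>

text \<open>Additive inverses come from the scalar \<open>- 1\<close>, by distributivity and
  \<open>0 x = 0\<close>.\<close>

lemma nonassoc_algebraI:
  fixes A :: "('f::field, 'a, 'm) module_scheme" (structure)
  assumes "\<zero> \<in> carrier A" "\<And>x y. \<lbrakk>x \<in> carrier A; y \<in> carrier A\<rbrakk> \<Longrightarrow> x \<oplus> y \<in> carrier A"
    "\<And>c x. x \<in> carrier A \<Longrightarrow> c \<odot>\<^bsub>A\<^esub> x \<in> carrier A"
    "\<And>x y. \<lbrakk>x \<in> carrier A; y \<in> carrier A\<rbrakk> \<Longrightarrow> x \<otimes> y \<in> carrier A"
    "\<And>x y z. \<lbrakk>x \<in> carrier A; y \<in> carrier A; z \<in> carrier A\<rbrakk> \<Longrightarrow> (x \<oplus> y) \<oplus> z = x \<oplus> (y \<oplus> z)"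
    "\<And>x y. \<lbrakk>x \<in> carrier A; y \<in> carrier A\<rbrakk> \<Longrightarrow> x \<oplus> y = y \<oplus> x"
    "\<And>x. x \<in> carrier A \<Longrightarrow> \<zero> \<oplus> x = x"
    "\<And>x. x \<in> carrier A \<Longrightarrow> 0 \<odot>\<^bsub>A\<^esub> x = \<zero>" "\<And>x. x \<in> carrier A \<Longrightarrow> 1 \<odot>\<^bsub>A\<^esub> x = x"
    "\<And>a b x. x \<in> carrier A \<Longrightarrow> (a + b) \<odot>\<^bsub>A\<^esub> x = a \<odot>\<^bsub>A\<^esub> x \<oplus> b \<odot>\<^bsub>A\<^esub> x"
    "\<And>a x y. \<lbrakk>x \<in> carrier A; y \<in> carrier A\<rbrakk> \<Longrightarrow> a \<odot>\<^bsub>A\<^esub> (x \<oplus> y) = a \<odot>\<^bsub>A\<^esub> x \<oplus> a \<odot>\<^bsub>A\<^esub> y"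
    "\<And>a b x. x \<in> carrier A \<Longrightarrow> (a * b) \<odot>\<^bsub>A\<^esub> x = a \<odot>\<^bsub>A\<^esub> (b \<odot>\<^bsub>A\<^esub> x)"
    "\<And>x y z. \<lbrakk>x \<in> carrier A; y \<in> carrier A; z \<in> carrier A\<rbrakk> \<Longrightarrow> (x \<oplus> y) \<otimes> z = x \<otimes> z \<oplus> y \<otimes> z"
    "\<And>x y z. \<lbrakk>x \<in> carrier A; y \<in> carrier A; z \<in> carrier A\<rbrakk> \<Longrightarrow> z \<otimes> (x \<oplus> y) = z \<otimes> x \<oplus> z \<otimes> y"
    "\<And>c x y. \<lbrakk>x \<in> carrier A; y \<in> carrier A\<rbrakk> \<Longrightarrow> (c \<odot>\<^bsub>A\<^esub> x) \<otimes> y = c \<odot>\<^bsub>A\<^esub> (x \<otimes> y)"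
    "\<And>c x y. \<lbrakk>x \<in> carrier A; y \<in> carrier A\<rbrakk> \<Longrightarrow> x \<otimes> (c \<odot>\<^bsub>A\<^esub> y) = c \<odot>\<^bsub>A\<^esub> (x \<otimes> y)"
  shows "nonassoc_algebra A"
proof -
  have "\<exists>y\<in>carrier A. y \<oplus> x = \<zero>" if "x \<in> carrier A" for x
    using assms(3)[OF that, of "- 1"] assms(10)[OF that, of "- 1" 1] assms(8,9)[OF that] by auto
  then have "abelian_group A"
    using assms(1-7) by (intro abelian_groupI) auto
  then have "module (ring_of_type_algebra :: 'f ring) A"
    using assms by (intro moduleI) (simp_all add: cring_from_type_algebra)
  then show ?thesis
    using assms by (intro nonassoc_algebra.intro nonassoc_algebra_axioms.intro) simp_all
qed

context superalgebra
begin

lemma homog_carrier: "x \<in> homog A i \<Longrightarrow> x \<in> carrier A"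
  using submoduleE(1)[OF homog_submodule] by auto

lemma homog_zero [simp]: "\<zero> \<in> homog A i"
  using homog_submodule subgroup.one_closed unfolding submodule_def by fastforce

lemma homog_add: "x \<in> homog A i \<Longrightarrow> y \<in> homog A i \<Longrightarrow> x \<oplus> y \<in> homog A i"
  using submoduleE(5)[OF homog_submodule] by auto

lemma homog_smult: "x \<in> homog A i \<Longrightarrow> c \<odot>\<^bsub>A\<^esub> x \<in> homog A i"
  using submoduleE(4)[OF homog_submodule] by auto

lemma homog_finsum: "(\<And>x. x \<in> I \<Longrightarrow> g x \<in> homog A i) \<Longrightarrow> finsum A g I \<in> homog A i"
proof (induction I rule: infinite_finite_induct)
  case (insert x I)
  then show ?case
    by (subst M.finsum_insert) (auto intro: homog_add homog_carrier)
qed (simp_all add: M.finsum_infinite)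

end

definition super_sign :: "bit \<Rightarrow> bit \<Rightarrow> 'f::comm_ring_1" where
  "super_sign i j = (if i = 1 \<and> j = 1 then - 1 else 1)"

lemma super_sign_card:
  "super_sign (of_nat (card S)) (of_nat (card T)) = (- 1) ^ (card S * card T)"
  unfolding super_sign_def minus_1_power_bit by (simp add: of_nat_bit)

text \<open>The superized linear forms of the alternative laws, with the sign of the transposition
  of two arguments. In characteristic 0 they are equivalent to the conditions on the Grassmann
  envelope, as the next section shows. The metabelian law consists of one monomial and carries no
  sign.\<close>

definition super_laws :: "('f::field, 'a, 'm) superalgebra_scheme \<Rightarrow> bool" where
  "super_laws A \<longleftrightarrow> superalgebra A \<and>
    (\<forall>i j k. \<forall>x\<in>homog A i. \<forall>y\<in>homog A j. \<forall>z\<in>homog A k.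
      associator A x y z \<oplus>\<^bsub>A\<^esub> super_sign i j \<odot>\<^bsub>A\<^esub> associator A y x z = \<zero>\<^bsub>A\<^esub> \<and>
      associator A x y z \<oplus>\<^bsub>A\<^esub> super_sign j k \<odot>\<^bsub>A\<^esub> associator A x z y = \<zero>\<^bsub>A\<^esub>) \<and>
    (\<forall>x\<in>carrier A. \<forall>y\<in>carrier A. \<forall>z\<in>carrier A. \<forall>t\<in>carrier A.
      (x \<otimes>\<^bsub>A\<^esub> y) \<otimes>\<^bsub>A\<^esub> (z \<otimes>\<^bsub>A\<^esub> t) = \<zero>\<^bsub>A\<^esub>)"

section \<open>The Grassmann envelope\<close>

lemma (in nonassoc_algebra) linear_functional_combination:
  assumes "linear_functional A \<phi>" "linear_functional A \<psi>"
  shows "linear_functional A (\<lambda>x. \<phi> x + \<psi> x)" "linear_functional A (\<lambda>x. \<phi> x - \<psi> x)"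
  using assms by (auto simp: linear_functional_def algebra_simps)

context superalgebra
begin

abbreviation G :: "('f, nat set \<Rightarrow> 'a) module" where
  "G \<equiv> grassmann_envelope A"

definition single :: "nat set \<Rightarrow> 'a \<Rightarrow> nat set \<Rightarrow> 'a" where
  "single S x T = (if T = S then x else \<zero>)"

lemma envelope_simps [simp]:
  "ring.zero G = (\<lambda>S. \<zero>)" "V \<oplus>\<^bsub>G\<^esub> Y = (\<lambda>S. V S \<oplus> Y S)" "c \<odot>\<^bsub>G\<^esub> V = (\<lambda>S. c \<odot>\<^bsub>A\<^esub> V S)"
  by (simp_all add: grassmann_envelope_def)

lemma envelope_carrier:
  "V \<in> carrier G \<longleftrightarrow> finite {S. V S \<noteq> \<zero>} \<and> (\<forall>S. infinite S \<longrightarrow> V S = \<zero>) \<and>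
    (\<forall>S. V S \<in> homog A (of_nat (card S)))"
  by (simp add: grassmann_envelope_def)

lemma envelope_mult: "(V \<otimes>\<^bsub>G\<^esub> Y) S = (if finite S
    then \<Oplus>\<^bsub>A\<^esub>T\<in>Pow S. grassmann_sign T (S - T) \<odot>\<^bsub>A\<^esub> (V T \<otimes> Y (S - T)) else \<zero>)"
  by (simp add: grassmann_envelope_def)

lemma envelope_component: "V \<in> carrier G \<Longrightarrow> V S \<in> carrier A"
  by (auto simp: envelope_carrier intro: homog_carrier)

lemma envelope_homog: "V \<in> carrier G \<Longrightarrow> V S \<in> homog A (of_nat (card S))"
  by (auto simp: envelope_carrier)

lemma envelope_infinite: "V \<in> carrier G \<Longrightarrow> infinite S \<Longrightarrow> V S = \<zero>"
  by (auto simp: envelope_carrier)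

lemma functional_envelope_mult:
  assumes "linear_functional A \<theta>" "V \<in> carrier G" "Y \<in> carrier G" "finite S"
  shows "\<theta> ((V \<otimes>\<^bsub>G\<^esub> Y) S) =
    (\<Sum>T\<in>Pow S. grassmann_sign T (S - T) * \<theta> (V T \<otimes> Y (S - T)))"
  using assms
  by (simp add: envelope_mult functional_finsum envelope_component functional_smult)

lemma envelope_mult_closed:
  assumes V: "V \<in> carrier G" and Y: "Y \<in> carrier G"
  shows "V \<otimes>\<^bsub>G\<^esub> Y \<in> carrier G"
  unfolding envelope_carrier
proof (intro conjI allI impI)
  show "(V \<otimes>\<^bsub>G\<^esub> Y) S = \<zero>" if "infinite S" for S
    using that by (simp add: envelope_mult)
  show "(V \<otimes>\<^bsub>G\<^esub> Y) S \<in> homog A (of_nat (card S))" for S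
  proof (cases "finite S")
    case True
    have "grassmann_sign T (S - T) \<odot>\<^bsub>A\<^esub> (V T \<otimes> Y (S - T)) \<in> homog A (of_nat (card S))"
      if "T \<in> Pow S" for T
    proof -
      have "card S = card T + card (S - T)"
        using True that card_mono[of S T] by (auto simp: card_Diff_subset finite_subset)
      then have "(of_nat (card S) :: bit) = of_nat (card T) + of_nat (card (S - T))"
        by simp
      then show ?thesis
        using homog_mult[OF envelope_homog[OF V] envelope_homog[OF Y], of T "S - T"]
        by (auto intro: homog_smult)
    qed
    with True show ?thesis
      by (auto simp: envelope_mult intro!: homog_finsum)
  qed (simp add: envelope_mult)
  \<comment> \<open>A nonzero coefficient at \<open>S\<close> comes from a splitting of
    \<open>S\<close> into a set of the support of \<open>V\<close> and one of the support of
    \<open>Y\<close>; there are finitely many such pairs.\<close>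
  have "{S. (V \<otimes>\<^bsub>G\<^esub> Y) S \<noteq> \<zero>} \<subseteq> (\<lambda>(T, U). T \<union> U) ` ({S. V S \<noteq> \<zero>} \<times> {S. Y S \<noteq> \<zero>})"
  proof
    fix S assume S: "S \<in> {S. (V \<otimes>\<^bsub>G\<^esub> Y) S \<noteq> \<zero>}"
    have "\<exists>T\<in>Pow S. V T \<noteq> \<zero> \<and> Y (S - T) \<noteq> \<zero>"
    proof (rule ccontr)
      assume *: "\<not> ?thesis"
      have "grassmann_sign T (S - T) \<odot>\<^bsub>A\<^esub> (V T \<otimes> Y (S - T)) = \<zero>" if "T \<in> Pow S" for T
      proof -
        from * that consider "V T = \<zero>" | "Y (S - T) = \<zero>"
          by auto
        then show ?thesis
          using envelope_component[OF V, of T] envelope_component[OF Y, of "S - T"] by cases simp_all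
      qed
      then have "(V \<otimes>\<^bsub>G\<^esub> Y) S = \<zero>"
        by (auto simp: envelope_mult intro!: M.add.finprod_one_eqI)
      with S show False
        by simp
    qed
    then obtain T where "T \<subseteq> S" "V T \<noteq> \<zero>" "Y (S - T) \<noteq> \<zero>"
      by auto
    then have "(T, S - T) \<in> {S. V S \<noteq> \<zero>} \<times> {S. Y S \<noteq> \<zero>}" "S = T \<union> (S - T)"
      by auto
    then show "S \<in> (\<lambda>(T, U). T \<union> U) ` ({S. V S \<noteq> \<zero>} \<times> {S. Y S \<noteq> \<zero>})"
      by (metis (mono_tags, lifting) case_prod_conv image_eqI)
  qed
  then show "finite {S. (V \<otimes>\<^bsub>G\<^esub> Y) S \<noteq> \<zero>}"
    by (rule finite_subset) (use V Y in \<open>auto simp: envelope_carrier\<close>)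
qed

lemma envelope_add_closed:
  assumes "V \<in> carrier G" "Y \<in> carrier G"
  shows "V \<oplus>\<^bsub>G\<^esub> Y \<in> carrier G"
proof -
  have "finite {S. V S \<oplus> Y S \<noteq> \<zero>}"
    by (rule finite_subset[of _ "{S. V S \<noteq> \<zero>} \<union> {S. Y S \<noteq> \<zero>}"])
      (use assms in \<open>auto simp: envelope_carrier\<close>)
  with assms show ?thesis
    by (auto simp: envelope_carrier intro: homog_add)
qed

lemma envelope_smult_closed:
  assumes "V \<in> carrier G"
  shows "c \<odot>\<^bsub>G\<^esub> V \<in> carrier G"
proof -
  have "finite {S. c \<odot>\<^bsub>A\<^esub> V S \<noteq> \<zero>}"
    by (rule finite_subset[of _ "{S. V S \<noteq> \<zero>}"]) (use assms in \<open>auto simp: envelope_carrier\<close>)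
  with assms show ?thesis
    by (auto simp: envelope_carrier intro: homog_smult)
qed

lemma envelope_eqI:
  assumes "V \<in> carrier G" "Y \<in> carrier G"
    "\<And>S \<theta>. finite S \<Longrightarrow> linear_functional A \<theta> \<Longrightarrow> \<theta> (V S) = \<theta> (Y S)"
  shows "V = Y"
proof
  fix S
  show "V S = Y S"
    using assms by (cases "finite S")
      (auto simp: envelope_infinite intro!: eq_by_functionals envelope_component)
qed

lemma envelope_nonassoc_algebra: "nonassoc_algebra G"
proof (rule nonassoc_algebraI)
  fix c :: 'f and V Y Z assume V: "V \<in> carrier G" and Y: "Y \<in> carrier G" and Z: "Z \<in> carrier G"
  note [simp] = envelope_component[OF V] envelope_component[OF Y] envelope_component[OF Z]
  show "(V \<oplus>\<^bsub>G\<^esub> Y) \<otimes>\<^bsub>G\<^esub> Z = V \<otimes>\<^bsub>G\<^esub> Z \<oplus>\<^bsub>G\<^esub> Y \<otimes>\<^bsub>G\<^esub> Z"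
    by (rule envelope_eqI) (intro envelope_mult_closed envelope_add_closed V Y Z,
      intro envelope_mult_closed envelope_add_closed V Y Z,
      use V Y Z envelope_add_closed[OF V Y] in \<open>simp add: functional_envelope_mult functional_add
        envelope_component envelope_mult_closed mult_add_left sum.distrib ring_distribs\<close>)
  show "Z \<otimes>\<^bsub>G\<^esub> (V \<oplus>\<^bsub>G\<^esub> Y) = Z \<otimes>\<^bsub>G\<^esub> V \<oplus>\<^bsub>G\<^esub> Z \<otimes>\<^bsub>G\<^esub> Y"
    by (rule envelope_eqI) (intro envelope_mult_closed envelope_add_closed V Y Z,
      intro envelope_mult_closed envelope_add_closed V Y Z,
      use V Y Z envelope_add_closed[OF V Y] in \<open>simp add: functional_envelope_mult functional_add
        envelope_component envelope_mult_closed mult_add_right sum.distrib ring_distribs\<close>)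
  show "(c \<odot>\<^bsub>G\<^esub> V) \<otimes>\<^bsub>G\<^esub> Y = c \<odot>\<^bsub>G\<^esub> (V \<otimes>\<^bsub>G\<^esub> Y)"
    by (rule envelope_eqI) (intro envelope_mult_closed envelope_smult_closed V Y Z,
      intro envelope_mult_closed envelope_smult_closed V Y Z,
      use V Y Z envelope_smult_closed[OF V, of c] in \<open>simp add: functional_envelope_mult
        functional_smult envelope_component envelope_mult_closed smult_mult_left sum_distrib_left mult_ac\<close>)
  show "V \<otimes>\<^bsub>G\<^esub> (c \<odot>\<^bsub>G\<^esub> Y) = c \<odot>\<^bsub>G\<^esub> (V \<otimes>\<^bsub>G\<^esub> Y)"
    by (rule envelope_eqI) (intro envelope_mult_closed envelope_smult_closed V Y Z,
      intro envelope_mult_closed envelope_smult_closed V Y Z,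
      use V Y Z envelope_smult_closed[OF Y, of c] in \<open>simp add: functional_envelope_mult
        functional_smult envelope_component envelope_mult_closed smult_mult_right sum_distrib_left mult_ac\<close>)
next
  show "\<zero>\<^bsub>G\<^esub> \<in> carrier G"
    by (simp add: envelope_carrier)
qed (use envelope_add_closed envelope_smult_closed envelope_mult_closed in
    \<open>auto simp: M.a_ac envelope_component smult_add_scalar smult_add smult_mult\<close>)

sublocale env: nonassoc_algebra G
  by (rule envelope_nonassoc_algebra)

lemma single_closed:
  assumes "finite S" "x \<in> homog A (of_nat (card S))"
  shows "single S x \<in> carrier G"
proof -
  have "finite {T. single S x T \<noteq> \<zero>}"
    by (rule finite_subset[of _ "{S}"]) (auto simp: single_def)
  with assms show ?thesis
    by (auto simp: envelope_carrier single_def)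
qed

lemma single_mult:
  assumes S: "finite S" "x \<in> homog A (of_nat (card S))" and T: "finite T" "y \<in> homog A (of_nat (card T))"
  shows "single S x \<otimes>\<^bsub>G\<^esub> single T y =
    (if S \<inter> T = {} then single (S \<union> T) (grassmann_sign S T \<odot>\<^bsub>A\<^esub> (x \<otimes> y)) else \<zero>\<^bsub>G\<^esub>)"
    (is "_ = ?r")
proof (rule envelope_eqI)
  have xy: "x \<in> carrier A" "y \<in> carrier A"
    using S T by (auto intro: homog_carrier)
  show "single S x \<otimes>\<^bsub>G\<^esub> single T y \<in> carrier G"
    by (intro envelope_mult_closed single_closed S T)
  have "grassmann_sign S T \<odot>\<^bsub>A\<^esub> (x \<otimes> y) \<in> homog A (of_nat (card (S \<union> T)))" if "S \<inter> T = {}"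
    using homog_smult[OF homog_mult[OF S(2) T(2)]] S T that by (simp add: card_Un_disjoint)
  then show "?r \<in> carrier G"
    using S T by (simp add: single_closed env.zero_closed[simplified])
  fix U \<theta> assume U: "finite (U :: nat set)" and \<theta>: "linear_functional A \<theta>"
  have "\<theta> ((single S x \<otimes>\<^bsub>G\<^esub> single T y) U) =
      (\<Sum>P\<in>Pow U. grassmann_sign P (U - P) * \<theta> (single S x P \<otimes> single T y (U - P)))"
    by (intro functional_envelope_mult \<theta> single_closed S T U)
  also have "\<dots> = (\<Sum>P\<in>Pow U. if P = S then (if U - S = T then grassmann_sign S T * \<theta> (x \<otimes> y) else 0) else 0)"
    using xy functional_zero[OF \<theta>] by (intro sum.cong) (auto simp: single_def)
  also have "\<dots> = (if S \<subseteq> U \<and> U - S = T then grassmann_sign S T * \<theta> (x \<otimes> y) else 0)"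
    using U by (simp add: sum.delta')
  also have "\<dots> = \<theta> (?r U)"
    using xy functional_zero[OF \<theta>] functional_smult[OF \<theta>] by (auto simp: single_def)
  finally show "\<theta> ((single S x \<otimes>\<^bsub>G\<^esub> single T y) U) = \<theta> (?r U)" .
qed

lemma envelope_induct [consumes 1, case_names zero single add]:
  assumes "V \<in> carrier G" "P (\<lambda>S. \<zero>)"
    "\<And>S x. finite S \<Longrightarrow> x \<in> homog A (of_nat (card S)) \<Longrightarrow> P (single S x)"
    "\<And>V Y. V \<in> carrier G \<Longrightarrow> Y \<in> carrier G \<Longrightarrow> P V \<Longrightarrow> P Y \<Longrightarrow> P (V \<oplus>\<^bsub>G\<^esub> Y)"
  shows "P V"
proof -
  have "finite F \<Longrightarrow> V \<in> carrier G \<Longrightarrow> {S. V S \<noteq> \<zero>} = F \<Longrightarrow> P V" for F V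
  proof (induction F arbitrary: V rule: finite_induct)
    case empty
    then have "V = (\<lambda>S. \<zero>)"
      by auto
    with assms(2) show ?case
      by simp
  next
    case (insert S F)
    let ?Y = "\<lambda>T. if T = S then \<zero> else V T"
    have "{T. ?Y T \<noteq> \<zero>} = F"
      using insert by auto
    moreover from this have Y: "?Y \<in> carrier G"
      using insert by (simp add: envelope_carrier)
    ultimately have "P ?Y"
      using insert by blast
    moreover have "finite S"
      using insert envelope_infinite by blast
    moreover have "V = ?Y \<oplus>\<^bsub>G\<^esub> single S (V S)"
      using envelope_component[OF insert.prems(1)] by (auto simp: single_def)
    moreover have "V S \<in> homog A (of_nat (card S))"
      by (rule envelope_homog[OF insert.prems(1)])
    ultimately have "P (?Y \<oplus>\<^bsub>G\<^esub> single S (V S))"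
      using Y by (intro assms(3,4) single_closed)
    then show ?case
      by (rule ssubst[where P = P, OF \<open>V = ?Y \<oplus>\<^bsub>G\<^esub> single S (V S)\<close>])
  qed
  with assms(1) show ?thesis
    by (auto simp: envelope_carrier)
qed

lemma functional_on_singles:
  assumes "V \<in> carrier G" "linear_functional G \<phi>"
    "\<And>S x. finite S \<Longrightarrow> x \<in> homog A (of_nat (card S)) \<Longrightarrow> \<phi> (single S x) = 0"
  shows "\<phi> V = 0"
  using assms(1)
proof (induction rule: envelope_induct)
  case zero
  show ?case
    using env.functional_zero[OF assms(2)] by simp
next
  case (add V Y)
  then show ?case
    using env.functional_add[OF assms(2), of V Y] by simp
qed (rule assms(3))

lemma linear_functional_component:
  "linear_functional A \<theta> \<Longrightarrow> linear_functional G (\<lambda>V. \<theta> (V S))"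
  unfolding linear_functional_def by (simp add: envelope_component)

text \<open>The sign of \<open>e_S e_T e_U\<close> relative to the basis element of the union, for
  disjoint sets. It does not depend on the bracketing.\<close>

definition triple_sign :: "nat set \<Rightarrow> nat set \<Rightarrow> nat set \<Rightarrow> 'f" where
  "triple_sign S T U = grassmann_sign S T * grassmann_sign S U * grassmann_sign T U"

context
  fixes S T U :: "nat set" and x y z
  assumes fin: "finite S" "finite T" "finite U"
    and xyz: "x \<in> homog A (of_nat (card S))" "y \<in> homog A (of_nat (card T))"
      "z \<in> homog A (of_nat (card U))"
begin

lemma single_triple:
  assumes "S \<inter> T = {}" "S \<inter> U = {}" "T \<inter> U = {}"
  shows "(single S x \<otimes>\<^bsub>G\<^esub> single T y) \<otimes>\<^bsub>G\<^esub> single U z =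
      single (S \<union> T \<union> U) (triple_sign S T U \<odot>\<^bsub>A\<^esub> ((x \<otimes> y) \<otimes> z))"
    "single S x \<otimes>\<^bsub>G\<^esub> (single T y \<otimes>\<^bsub>G\<^esub> single U z) =
      single (S \<union> T \<union> U) (triple_sign S T U \<odot>\<^bsub>A\<^esub> (x \<otimes> (y \<otimes> z)))"
proof -
  have c [simp]: "x \<in> carrier A" "y \<in> carrier A" "z \<in> carrier A"
    using xyz by (auto intro: homog_carrier)
  have xy: "grassmann_sign S T \<odot>\<^bsub>A\<^esub> (x \<otimes> y) \<in> homog A (of_nat (card (S \<union> T)))"
    and yz: "grassmann_sign T U \<odot>\<^bsub>A\<^esub> (y \<otimes> z) \<in> homog A (of_nat (card (T \<union> U)))"
    using homog_smult[OF homog_mult[OF xyz(1,2)]] homog_smult[OF homog_mult[OF xyz(2,3)]] fin assms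
    by (simp_all add: card_Un_disjoint)
  have "(S \<union> T) \<inter> U = {}" "S \<inter> (T \<union> U) = {}"
    using assms by auto
  then show "(single S x \<otimes>\<^bsub>G\<^esub> single T y) \<otimes>\<^bsub>G\<^esub> single U z =
      single (S \<union> T \<union> U) (triple_sign S T U \<odot>\<^bsub>A\<^esub> ((x \<otimes> y) \<otimes> z))"
    "single S x \<otimes>\<^bsub>G\<^esub> (single T y \<otimes>\<^bsub>G\<^esub> single U z) =
      single (S \<union> T \<union> U) (triple_sign S T U \<odot>\<^bsub>A\<^esub> (x \<otimes> (y \<otimes> z)))"
    using single_mult[OF fin(1) xyz(1) fin(2) xyz(2)] single_mult[OF fin(2) xyz(2) fin(3) xyz(3)]
      single_mult[OF finite_UnI[OF fin(1,2)] xy fin(3) xyz(3)]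
      single_mult[OF fin(1) xyz(1) finite_UnI[OF fin(2,3)] yz] assms
    by (simp_all add: triple_sign_def grassmann_sign_union_left[OF fin assms(1)]
        grassmann_sign_union_right[OF fin(2,3,1) assms(3)]
        smult_mult_left smult_mult_right smult_mult[symmetric] mult_ac Un_assoc)
qed

lemma single_triple_zero:
  assumes "\<not> (S \<inter> T = {} \<and> S \<inter> U = {} \<and> T \<inter> U = {})"
  shows "(single S x \<otimes>\<^bsub>G\<^esub> single T y) \<otimes>\<^bsub>G\<^esub> single U z = \<zero>\<^bsub>G\<^esub>"
    "single S x \<otimes>\<^bsub>G\<^esub> (single T y \<otimes>\<^bsub>G\<^esub> single U z) = \<zero>\<^bsub>G\<^esub>"
proof -
  have c [simp]: "x \<in> carrier A" "y \<in> carrier A" "z \<in> carrier A"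
    using xyz by (auto intro: homog_carrier)
  have xy: "grassmann_sign S T \<odot>\<^bsub>A\<^esub> (x \<otimes> y) \<in> homog A (of_nat (card (S \<union> T)))" if "S \<inter> T = {}"
    using homog_smult[OF homog_mult[OF xyz(1,2)]] fin that by (simp_all add: card_Un_disjoint)
  have yz: "grassmann_sign T U \<odot>\<^bsub>A\<^esub> (y \<otimes> z) \<in> homog A (of_nat (card (T \<union> U)))" if "T \<inter> U = {}"
    using homog_smult[OF homog_mult[OF xyz(2,3)]] fin that by (simp_all add: card_Un_disjoint)
  show "(single S x \<otimes>\<^bsub>G\<^esub> single T y) \<otimes>\<^bsub>G\<^esub> single U z = \<zero>\<^bsub>G\<^esub>"
  proof (cases "S \<inter> T = {}")
    case True
    with assms have "(S \<union> T) \<inter> U \<noteq> {}"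
      by auto
    with True show ?thesis
      using single_mult[OF fin(1) xyz(1) fin(2) xyz(2)] single_mult[OF _ xy fin(3) xyz(3)] fin by simp
  next
    case False
    then show ?thesis
      using single_mult[OF fin(1) xyz(1) fin(2) xyz(2)] env.mult_zero_left[OF single_closed[OF fin(3) xyz(3)]]
      by simp
  qed
  show "single S x \<otimes>\<^bsub>G\<^esub> (single T y \<otimes>\<^bsub>G\<^esub> single U z) = \<zero>\<^bsub>G\<^esub>"
  proof (cases "T \<inter> U = {}")
    case True
    with assms have "S \<inter> (T \<union> U) \<noteq> {}"
      by auto
    with True show ?thesis
      using single_mult[OF fin(2) xyz(2) fin(3) xyz(3)] single_mult[OF fin(1) xyz(1) _ yz] fin by simp
  next
    case False
    then show ?thesis
      using single_mult[OF fin(2) xyz(2) fin(3) xyz(3)] env.mult_zero_right[OF single_closed[OF fin(1) xyz(1)]]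
      by simp
  qed
qed

end

lemma triple_sign_swap:
  fixes S T U :: "nat set"
  assumes "finite S" "finite T" "finite U" "S \<inter> T = {}" "S \<inter> U = {}" "T \<inter> U = {}"
  shows "triple_sign T S U = super_sign (of_nat (card S)) (of_nat (card T)) * triple_sign S T U"
    "triple_sign S U T = super_sign (of_nat (card T)) (of_nat (card U)) * triple_sign S T U"
proof -
  have "(grassmann_sign T S :: 'f) = (- 1) ^ (card S * card T) * grassmann_sign S T"
    "(grassmann_sign U T :: 'f) = (- 1) ^ (card T * card U) * grassmann_sign T U"
    using assms by (simp_all add: grassmann_sign_commute[of T S] grassmann_sign_commute[of U T]
        Int_commute mult.commute)
  then show "triple_sign T S U = super_sign (of_nat (card S)) (of_nat (card T)) * triple_sign S T U"
    "triple_sign S U T = super_sign (of_nat (card T)) (of_nat (card U)) * triple_sign S T U"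
    by (simp_all add: triple_sign_def super_sign_card mult_ac)
qed

text \<open>Both bracketings carry the same \<open>triple_sign\<close>, so an associator in the
  envelope is, up to this sign, an associator in \<open>A\<close> with the union as its Grassmann
  factor.\<close>

lemma associator_singles:
  assumes fin: "finite S" "finite T" "finite U"
    and xyz: "x \<in> homog A (of_nat (card S))" "y \<in> homog A (of_nat (card T))"
      "z \<in> homog A (of_nat (card U))"
    and \<phi>: "linear_functional G \<phi>"
  shows "\<phi> ((single S x \<otimes>\<^bsub>G\<^esub> single T y) \<otimes>\<^bsub>G\<^esub> single U z) -
      \<phi> (single S x \<otimes>\<^bsub>G\<^esub> (single T y \<otimes>\<^bsub>G\<^esub> single U z)) =
    (if S \<inter> T = {} \<and> S \<inter> U = {} \<and> T \<inter> U = {}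
     then triple_sign S T U * \<phi> (single (S \<union> T \<union> U) (associator A x y z)) else 0)"
proof (cases "S \<inter> T = {} \<and> S \<inter> U = {} \<and> T \<inter> U = {}")
  case True
  have c [simp]: "x \<in> carrier A" "y \<in> carrier A" "z \<in> carrier A"
    using xyz by (auto intro: homog_carrier)
  have card: "of_nat (card (S \<union> T \<union> U)) = (of_nat (card S) + of_nat (card T) + of_nat (card U) :: bit)"
    using True fin by (simp add: card_Un_disjoint Int_Un_distrib2)
  have h: "(x \<otimes> y) \<otimes> z \<in> homog A (of_nat (card (S \<union> T \<union> U)))"
    "x \<otimes> (y \<otimes> z) \<in> homog A (of_nat (card (S \<union> T \<union> U)))"
    using homog_mult[OF homog_mult[OF xyz(1,2)] xyz(3)] homog_mult[OF xyz(1) homog_mult[OF xyz(2,3)]]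
    unfolding card by (simp_all only: add.assoc)
  have lin: "\<phi> (single (S \<union> T \<union> U) (c \<odot>\<^bsub>A\<^esub> v)) = c * \<phi> (single (S \<union> T \<union> U) v)"
    if "v \<in> homog A (of_nat (card (S \<union> T \<union> U)))" for c v
  proof -
    have "single (S \<union> T \<union> U) (c \<odot>\<^bsub>A\<^esub> v) = c \<odot>\<^bsub>G\<^esub> single (S \<union> T \<union> U) v"
      by (auto simp: single_def)
    then show ?thesis
      using env.functional_smult[OF \<phi> single_closed[OF _ that]] fin by simp
  qed
  have "single (S \<union> T \<union> U) ((x \<otimes> y) \<otimes> z) =
      single (S \<union> T \<union> U) (associator A x y z) \<oplus>\<^bsub>G\<^esub> single (S \<union> T \<union> U) (x \<otimes> (y \<otimes> z))"
    by (auto simp: single_def associator_def a_minus_def M.a_assoc M.l_neg)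
  moreover have "associator A x y z \<in> homog A (of_nat (card (S \<union> T \<union> U)))"
    using homog_add[OF h(1) homog_smult[OF h(2), of "- 1"]]
    by (simp add: associator_def a_minus_def smult_uminus_1)
  ultimately have "\<phi> (single (S \<union> T \<union> U) (associator A x y z)) =
      \<phi> (single (S \<union> T \<union> U) ((x \<otimes> y) \<otimes> z)) - \<phi> (single (S \<union> T \<union> U) (x \<otimes> (y \<otimes> z)))"
    using env.functional_add[OF \<phi> single_closed single_closed[OF _ h(2)]] fin by simp
  with True h show ?thesis
    by (simp add: single_triple[OF fin xyz] lin flip: right_diff_distrib)
next
  case False
  then show ?thesis
    unfolding if_not_P[OF False] using single_triple_zero[OF fin xyz False] by simp
qed

text \<open>Interchanging two Grassmann factors changes \<open>triple_sign\<close> by exactly the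
  \<open>super_sign\<close> in the law of \<open>A\<close>. Hence \<open>triple_sign\<close> can be
  taken out, and what remains is the super law.\<close>

lemma single_super_law:
  assumes "super_laws A" and fin: "finite S" "finite T" "finite U"
    and xyz: "x \<in> homog A (of_nat (card S))" "y \<in> homog A (of_nat (card T))"
      "z \<in> homog A (of_nat (card U))"
    and \<phi>: "linear_functional G \<phi>"
  shows "\<phi> ((single S x \<otimes>\<^bsub>G\<^esub> single T y) \<otimes>\<^bsub>G\<^esub> single U z) -
      \<phi> (single S x \<otimes>\<^bsub>G\<^esub> (single T y \<otimes>\<^bsub>G\<^esub> single U z)) +
      (\<phi> ((single T y \<otimes>\<^bsub>G\<^esub> single S x) \<otimes>\<^bsub>G\<^esub> single U z) -
      \<phi> (single T y \<otimes>\<^bsub>G\<^esub> (single S x \<otimes>\<^bsub>G\<^esub> single U z))) = 0" (is ?L)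
    and "\<phi> ((single S x \<otimes>\<^bsub>G\<^esub> single T y) \<otimes>\<^bsub>G\<^esub> single U z) -
      \<phi> (single S x \<otimes>\<^bsub>G\<^esub> (single T y \<otimes>\<^bsub>G\<^esub> single U z)) +
      (\<phi> ((single S x \<otimes>\<^bsub>G\<^esub> single U z) \<otimes>\<^bsub>G\<^esub> single T y) -
      \<phi> (single S x \<otimes>\<^bsub>G\<^esub> (single U z \<otimes>\<^bsub>G\<^esub> single T y))) = 0" (is ?R)
proof -
  have "?L \<and> ?R"
  proof (cases "S \<inter> T = {} \<and> S \<inter> U = {} \<and> T \<inter> U = {}")
    case True
    have c [simp]: "x \<in> carrier A" "y \<in> carrier A" "z \<in> carrier A"
      using xyz by (auto intro: homog_carrier)
    let ?s = "\<lambda>v. \<phi> (single (S \<union> T \<union> U) v)"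
    have card: "of_nat (card (S \<union> T \<union> U)) = (of_nat (card S) + of_nat (card T) + of_nat (card U) :: bit)"
      using True fin by (simp add: card_Un_disjoint Int_Un_distrib2)
    have assoc: "associator A u v w \<in> homog A (i + j + k)"
      if "u \<in> homog A i" "v \<in> homog A j" "w \<in> homog A k" for u v w i j k
      using homog_add[OF homog_mult[OF homog_mult[OF that(1,2)] that(3)]
          homog_smult[OF homog_mult[OF that(1) homog_mult[OF that(2,3)], folded add.assoc], of "- 1"]]
        that[THEN homog_carrier]
      by (simp add: associator_def a_minus_def smult_uminus_1)
    have h: "associator A y x z \<in> homog A (of_nat (card (S \<union> T \<union> U)))"
      "associator A x z y \<in> homog A (of_nat (card (S \<union> T \<union> U)))"
      "associator A x y z \<in> homog A (of_nat (card (S \<union> T \<union> U)))"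
      using assoc[OF xyz] assoc[OF xyz(2,1,3)] assoc[OF xyz(1,3,2)] unfolding card
      by (simp_all only: add_ac)
    have lin: "\<phi> (single (S \<union> T \<union> U) (u \<oplus> c \<odot>\<^bsub>A\<^esub> v)) = ?s u + c * ?s v"
      if "u \<in> homog A (of_nat (card (S \<union> T \<union> U)))" "v \<in> homog A (of_nat (card (S \<union> T \<union> U)))" for u c v
    proof -
      have "single (S \<union> T \<union> U) (u \<oplus> c \<odot>\<^bsub>A\<^esub> v) =
          single (S \<union> T \<union> U) u \<oplus>\<^bsub>G\<^esub> c \<odot>\<^bsub>G\<^esub> single (S \<union> T \<union> U) v"
        by (auto simp: single_def)
      then show ?thesis
        using single_closed[OF _ that(1)] single_closed[OF _ that(2)] fin
        by (simp only: env.functional_simps[OF \<phi>] env.smult_in finite_Un)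
    qed
    have z: "?s \<zero> = 0"
    proof -
      have "single (S \<union> T \<union> U) \<zero> = \<zero>\<^bsub>G\<^esub>"
        by (auto simp: single_def)
      then show ?thesis
        using env.functional_zero[OF \<phi>] by simp
    qed
    have "associator A x y z \<oplus> super_sign (of_nat (card S)) (of_nat (card T)) \<odot>\<^bsub>A\<^esub> associator A y x z = \<zero>"
      "associator A x y z \<oplus> super_sign (of_nat (card T)) (of_nat (card U)) \<odot>\<^bsub>A\<^esub> associator A x z y = \<zero>"
      using assms(1) xyz unfolding super_laws_def by blast+
    then have "?s (associator A x y z) + super_sign (of_nat (card S)) (of_nat (card T)) * ?s (associator A y x z) = 0"
      "?s (associator A x y z) + super_sign (of_nat (card T)) (of_nat (card U)) * ?s (associator A x z y) = 0"
      using lin[OF h(3,1)] lin[OF h(3,2)] z by metis+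
    moreover have "T \<union> S \<union> U = S \<union> T \<union> U" "S \<union> U \<union> T = S \<union> T \<union> U"
      by auto
    ultimately show ?thesis
      using True unfolding associator_singles[OF fin xyz \<phi>] associator_singles[OF fin(2,1,3) xyz(2,1,3) \<phi>]
        associator_singles[OF fin(1,3,2) xyz(1,3,2) \<phi>]
      by (simp add: Int_commute triple_sign_swap[OF fin] mult.assoc mult.left_commute
          flip: distrib_left)
  next
    case False
    then show ?thesis
      unfolding associator_singles[OF fin xyz \<phi>] associator_singles[OF fin(2,1,3) xyz(2,1,3) \<phi>]
        associator_singles[OF fin(1,3,2) xyz(1,3,2) \<phi>]
      by (auto simp: Int_commute)
  qed
  then show ?L ?R
    by simp_all
qed

lemma functional_on_homog:
  assumes "x \<in> carrier A" "linear_functional A \<phi>" "\<And>i y. y \<in> homog A i \<Longrightarrow> \<phi> y = 0"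
  shows "\<phi> x = 0"
proof -
  obtain y z where "y \<in> homog A 0" "z \<in> homog A 1" "x = y \<oplus> z"
    using assms(1) homog_sum unfolding set_add_def' by blast
  then show ?thesis
    using assms(2,3) by (simp add: functional_add homog_carrier)
qed

lemma single_quadruple:
  assumes "\<And>x y z t. \<lbrakk>x \<in> carrier A; y \<in> carrier A; z \<in> carrier A; t \<in> carrier A\<rbrakk> \<Longrightarrow>
      (x \<otimes> y) \<otimes> (z \<otimes> t) = \<zero>"
    and fin: "finite S" "finite T" "finite U" "finite W"
    and xyzt: "x \<in> homog A (of_nat (card S))" "y \<in> homog A (of_nat (card T))"
      "z \<in> homog A (of_nat (card U))" "t \<in> homog A (of_nat (card W))"
  shows "(single S x \<otimes>\<^bsub>G\<^esub> single T y) \<otimes>\<^bsub>G\<^esub> (single U z \<otimes>\<^bsub>G\<^esub> single W t) = \<zero>\<^bsub>G\<^esub>"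
proof (cases "S \<inter> T = {} \<and> U \<inter> W = {}")
  case True
  have xy: "grassmann_sign S T \<odot>\<^bsub>A\<^esub> (x \<otimes> y) \<in> homog A (of_nat (card (S \<union> T)))"
    using homog_smult[OF homog_mult[OF xyzt(1,2)]] fin True by (simp_all add: card_Un_disjoint)
  have zt: "grassmann_sign U W \<odot>\<^bsub>A\<^esub> (z \<otimes> t) \<in> homog A (of_nat (card (U \<union> W)))"
    using homog_smult[OF homog_mult[OF xyzt(3,4)]] fin True by (simp_all add: card_Un_disjoint)
  have "(x \<otimes> y) \<otimes> (z \<otimes> t) = \<zero>"
    using assms(1) xyzt homog_carrier by blast
  then show ?thesis
    using True xyzt[THEN homog_carrier] single_mult[OF fin(1) xyzt(1) fin(2) xyzt(2)]
      single_mult[OF fin(3) xyzt(3) fin(4) xyzt(4)]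
      single_mult[OF finite_UnI[OF fin(1,2)] xy finite_UnI[OF fin(3,4)] zt]
    by (auto simp: smult_mult_left smult_mult_right single_def)
next
  case False
  have "single S x \<otimes>\<^bsub>G\<^esub> single T y \<in> carrier G" "single U z \<otimes>\<^bsub>G\<^esub> single W t \<in> carrier G"
    by (intro envelope_mult_closed single_closed fin xyzt)+
  with False show ?thesis
    using single_mult[OF fin(1) xyzt(1) fin(2) xyzt(2)] single_mult[OF fin(3) xyzt(3) fin(4) xyzt(4)]
      env.mult_zero_left env.mult_zero_right by auto
qed

end

text \<open>The linearised identities of the envelope are multilinear, hence it suffices to check
  them on the spanning set of the elements \<open>e\<^sub>S \<otimes> x\<close>.\<close>

theorem super_laws_imp_alt_metabelian:
  fixes A :: "('f::field_char_0, 'a, 'm) superalgebra_scheme" (structure)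
  assumes laws: "super_laws A"
  shows "alt_metabelian_superalgebra A"
proof -
  interpret superalgebra A
    using laws by (simp add: super_laws_def)
  note mL = env.linear_functional_mult_left and mR = env.linear_functional_mult_right
    and comb = env.linear_functional_combination
  have L: "\<phi> ((V \<otimes>\<^bsub>G\<^esub> Y) \<otimes>\<^bsub>G\<^esub> Z) - \<phi> (V \<otimes>\<^bsub>G\<^esub> (Y \<otimes>\<^bsub>G\<^esub> Z)) +
      (\<phi> ((Y \<otimes>\<^bsub>G\<^esub> V) \<otimes>\<^bsub>G\<^esub> Z) - \<phi> (Y \<otimes>\<^bsub>G\<^esub> (V \<otimes>\<^bsub>G\<^esub> Z))) = 0" (is "?L V Y Z = 0")
    if V: "V \<in> carrier G" and Y: "Y \<in> carrier G" and Z: "Z \<in> carrier G"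
      and \<phi>: "linear_functional G \<phi>" for V Y Z \<phi>
  proof (rule functional_on_singles[OF V])
    show "linear_functional G (\<lambda>V. ?L V Y Z)"
      by (intro comb mL[OF mR] mR[OF mL] mR[OF mR] mL[OF mL] mR mL \<phi> Y Z envelope_mult_closed)
    fix S x assume x: "finite (S :: nat set)" "x \<in> homog A (of_nat (card S))"
    note V' = single_closed[OF x]
    show "?L (single S x) Y Z = 0"
    proof (rule functional_on_singles[OF Y])
      show "linear_functional G (\<lambda>Y. ?L (single S x) Y Z)"
        by (intro comb mL[OF mR] mR[OF mL] mR[OF mR] mL[OF mL] mR mL \<phi> V' Z envelope_mult_closed)
      fix T y assume y: "finite (T :: nat set)" "y \<in> homog A (of_nat (card T))"
      note Y' = single_closed[OF y]
      show "?L (single S x) (single T y) Z = 0"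
      proof (rule functional_on_singles[OF Z])
        show "linear_functional G (\<lambda>Z. ?L (single S x) (single T y) Z)"
          by (intro comb mL[OF mL] mL \<phi> V' Y' envelope_mult_closed)
      qed (rule single_super_law(1)[OF laws x(1) y(1) _ x(2) y(2) _ \<phi>])
    qed
  qed
  have R: "\<phi> ((V \<otimes>\<^bsub>G\<^esub> Y) \<otimes>\<^bsub>G\<^esub> Z) - \<phi> (V \<otimes>\<^bsub>G\<^esub> (Y \<otimes>\<^bsub>G\<^esub> Z)) +
      (\<phi> ((V \<otimes>\<^bsub>G\<^esub> Z) \<otimes>\<^bsub>G\<^esub> Y) - \<phi> (V \<otimes>\<^bsub>G\<^esub> (Z \<otimes>\<^bsub>G\<^esub> Y))) = 0" (is "?R V Y Z = 0")
    if V: "V \<in> carrier G" and Y: "Y \<in> carrier G" and Z: "Z \<in> carrier G"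
      and \<phi>: "linear_functional G \<phi>" for V Y Z \<phi>
  proof (rule functional_on_singles[OF V])
    show "linear_functional G (\<lambda>V. ?R V Y Z)"
      by (intro comb mR[OF mR] mR \<phi> Y Z envelope_mult_closed)
    fix S x assume x: "finite (S :: nat set)" "x \<in> homog A (of_nat (card S))"
    note V' = single_closed[OF x]
    show "?R (single S x) Y Z = 0"
    proof (rule functional_on_singles[OF Y])
      show "linear_functional G (\<lambda>Y. ?R (single S x) Y Z)"
        by (intro comb mL[OF mR] mR[OF mL] mR[OF mR] mL[OF mL] mR mL \<phi> V' Z envelope_mult_closed)
      fix T y assume y: "finite (T :: nat set)" "y \<in> homog A (of_nat (card T))"
      note Y' = single_closed[OF y]
      show "?R (single S x) (single T y) Z = 0"
      proof (rule functional_on_singles[OF Z])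
        show "linear_functional G (\<lambda>Z. ?R (single S x) (single T y) Z)"
          by (intro comb mL[OF mR] mR[OF mL] mR[OF mR] mL[OF mL] mR mL \<phi> V' Y' envelope_mult_closed)
      qed (rule single_super_law(2)[OF laws x(1) y(1) _ x(2) y(2) _ \<phi>])
    qed
  qed
  have M: "\<phi> ((V \<otimes>\<^bsub>G\<^esub> Y) \<otimes>\<^bsub>G\<^esub> (Z \<otimes>\<^bsub>G\<^esub> W)) = 0"
    if V: "V \<in> carrier G" and Y: "Y \<in> carrier G" and Z: "Z \<in> carrier G" and W: "W \<in> carrier G"
      and \<phi>: "linear_functional G \<phi>" for V Y Z W \<phi>
  proof (rule functional_on_singles[OF V])
    show "linear_functional G (\<lambda>V. \<phi> ((V \<otimes>\<^bsub>G\<^esub> Y) \<otimes>\<^bsub>G\<^esub> (Z \<otimes>\<^bsub>G\<^esub> W)))"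
      by (intro mR[OF mR] \<phi> Y Z W envelope_mult_closed)
    fix S x assume x: "finite (S :: nat set)" "x \<in> homog A (of_nat (card S))"
    show "\<phi> ((single S x \<otimes>\<^bsub>G\<^esub> Y) \<otimes>\<^bsub>G\<^esub> (Z \<otimes>\<^bsub>G\<^esub> W)) = 0"
    proof (rule functional_on_singles[OF Y])
      show "linear_functional G (\<lambda>Y. \<phi> ((single S x \<otimes>\<^bsub>G\<^esub> Y) \<otimes>\<^bsub>G\<^esub> (Z \<otimes>\<^bsub>G\<^esub> W)))"
        by (intro mL[OF mR] \<phi> Z W single_closed x envelope_mult_closed)
      fix T y assume y: "finite (T :: nat set)" "y \<in> homog A (of_nat (card T))"
      show "\<phi> ((single S x \<otimes>\<^bsub>G\<^esub> single T y) \<otimes>\<^bsub>G\<^esub> (Z \<otimes>\<^bsub>G\<^esub> W)) = 0"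
      proof (rule functional_on_singles[OF Z])
        show "linear_functional G (\<lambda>Z. \<phi> ((single S x \<otimes>\<^bsub>G\<^esub> single T y) \<otimes>\<^bsub>G\<^esub> (Z \<otimes>\<^bsub>G\<^esub> W)))"
          by (intro mR[OF mL] \<phi> W single_closed x y envelope_mult_closed)
        fix U z assume z: "finite (U :: nat set)" "z \<in> homog A (of_nat (card U))"
        show "\<phi> ((single S x \<otimes>\<^bsub>G\<^esub> single T y) \<otimes>\<^bsub>G\<^esub> (single U z \<otimes>\<^bsub>G\<^esub> W)) = 0"
        proof (rule functional_on_singles[OF W])
          show "linear_functional G
              (\<lambda>W. \<phi> ((single S x \<otimes>\<^bsub>G\<^esub> single T y) \<otimes>\<^bsub>G\<^esub> (single U z \<otimes>\<^bsub>G\<^esub> W)))"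
            by (intro mL[OF mL] \<phi> single_closed x y z envelope_mult_closed)
          fix P t assume t: "finite (P :: nat set)" "t \<in> homog A (of_nat (card P))"
          have "(x \<otimes> y) \<otimes> (z \<otimes> t) = \<zero>"
            if "x \<in> carrier A" "y \<in> carrier A" "z \<in> carrier A" "t \<in> carrier A" for x y z t
            using laws that unfolding super_laws_def by blast
          then show "\<phi> ((single S x \<otimes>\<^bsub>G\<^esub> single T y) \<otimes>\<^bsub>G\<^esub> (single U z \<otimes>\<^bsub>G\<^esub> single P t)) = 0"
            using single_quadruple[OF _ x(1) y(1) z(1) t(1) x(2) y(2) z(2) t(2)]
              env.functional_zero[OF \<phi>] by metis
        qed
      qed
    qed
  qed
  have "alt_metabelian_algebra G"
  proof (unfold_locales)
    fix V Y assume V: "V \<in> carrier G" and Y: "Y \<in> carrier G"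
    show "associator G V V Y = \<zero>\<^bsub>G\<^esub>"
    proof (rule env.eq_by_functionals)
      fix \<phi> assume \<phi>: "linear_functional G \<phi>"
      show "\<phi> (associator G V V Y) = \<phi> \<zero>\<^bsub>G\<^esub>"
        \<comment> \<open>For equal arguments the linearised law is twice the alternative
          law.\<close>
        using L[OF V V Y \<phi>] V Y unfolding associator_def
        by (simp only: env.functional_simps[OF \<phi>] env.mult_in) (simp flip: mult_2)
    qed (simp_all only: env.associator_closed V Y env.zero_closed)
    show "associator G V Y Y = \<zero>\<^bsub>G\<^esub>"
    proof (rule env.eq_by_functionals)
      fix \<phi> assume \<phi>: "linear_functional G \<phi>"
      show "\<phi> (associator G V Y Y) = \<phi> \<zero>\<^bsub>G\<^esub>"
        using R[OF V Y Y \<phi>] V Y unfolding associator_def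
        by (simp only: env.functional_simps[OF \<phi>] env.mult_in) (simp flip: mult_2)
    qed (simp_all only: env.associator_closed V Y env.zero_closed)
    fix Z W assume Z: "Z \<in> carrier G" and W: "W \<in> carrier G"
    show "(V \<otimes>\<^bsub>G\<^esub> Y) \<otimes>\<^bsub>G\<^esub> (Z \<otimes>\<^bsub>G\<^esub> W) = \<zero>\<^bsub>G\<^esub>"
      by (rule env.eq_by_functionals)
        (simp_all only: M[OF V Y Z W] env.functional_zero env.mult_in env.zero_closed V Y Z W)
  qed
  then show ?thesis
    unfolding alt_metabelian_superalgebra_def using superalgebra_axioms by blast
qed

text \<open>The laws of the envelope are evaluated at elements \<open>e_S \<otimes> x\<close> with
  disjoint sets \<open>S\<close> of the right parity. The component at the union of these sets is
  the super law up to a nonzero sign.\<close>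

theorem alt_metabelian_imp_super_laws:
  fixes A :: "('f::field_char_0, 'a, 'm) superalgebra_scheme" (structure)
  assumes alt: "alt_metabelian_superalgebra A"
  shows "super_laws A"
proof -
  interpret superalgebra A
    using alt by (simp add: alt_metabelian_superalgebra_def)
  interpret GA: alt_metabelian_algebra_char_0 G
    using alt by (simp add: alt_metabelian_superalgebra_def alt_metabelian_algebra_char_0_def)
  \<comment> \<open>A set of Grassmann generators of parity \<open>i\<close>, empty or
    \<open>{m}\<close>; different \<open>m\<close> keep the arguments of a law disjoint.\<close>
  define B :: "nat \<Rightarrow> bit \<Rightarrow> nat set" where "B m i = (if i = 1 then {m} else {})" for m i
  have B: "finite (B m i)" "of_nat (card (B m i)) = i" "m \<noteq> m' \<Longrightarrow> B m i \<inter> B m' i' = {}" for m m' i i'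
    by (auto simp: B_def)
  have laws: "associator A x y z \<oplus> super_sign i j \<odot>\<^bsub>A\<^esub> associator A y x z = \<zero> \<and>
      associator A x y z \<oplus> super_sign j k \<odot>\<^bsub>A\<^esub> associator A x z y = \<zero>"
    if xyz: "x \<in> homog A i" "y \<in> homog A j" "z \<in> homog A k" for x y z i j k
  proof -
    let ?S = "B 0 i" and ?T = "B 1 j" and ?U = "B 2 k"
    have xyz': "x \<in> homog A (of_nat (card ?S))" "y \<in> homog A (of_nat (card ?T))"
      "z \<in> homog A (of_nat (card ?U))"
      using xyz B by simp_all
    have c [simp]: "x \<in> carrier A" "y \<in> carrier A" "z \<in> carrier A"
      using xyz by (auto intro: homog_carrier)
    have disj: "?S \<inter> ?T = {}" "?S \<inter> ?U = {}" "?T \<inter> ?U = {}"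
      using B(3) by simp_all
    have nz: "triple_sign ?S ?T ?U \<noteq> 0"
      by (simp add: triple_sign_def grassmann_sign_def)
    have un: "?T \<union> ?S \<union> ?U = ?S \<union> ?T \<union> ?U" "?S \<union> ?U \<union> ?T = ?S \<union> ?T \<union> ?U"
      by auto
    have \<theta>: "\<theta> (associator A x y z) + super_sign i j * \<theta> (associator A y x z) = 0 \<and>
        \<theta> (associator A x y z) + super_sign j k * \<theta> (associator A x z y) = 0"
      if \<theta>: "linear_functional A \<theta>" for \<theta>
    proof -
      let ?\<phi> = "\<lambda>V. \<theta> (V (?S \<union> ?T \<union> ?U))"
      note \<phi> = linear_functional_component[OF \<theta>, of "?S \<union> ?T \<union> ?U"]
      note s = single_closed[OF B(1) xyz'(1)] single_closed[OF B(1) xyz'(2)] single_closed[OF B(1) xyz'(3)]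
      have val: "?\<phi> (single (?S \<union> ?T \<union> ?U) v) = \<theta> v" for v
        by (simp add: single_def)
      note e = associator_singles[OF B(1) B(1) B(1) xyz' \<phi>]
        associator_singles[OF B(1) B(1) B(1) xyz'(2,1,3) \<phi>]
        associator_singles[OF B(1) B(1) B(1) xyz'(1,3,2) \<phi>]
      have "triple_sign ?S ?T ?U * \<theta> (associator A x y z) + triple_sign ?T ?S ?U * \<theta> (associator A y x z) = 0"
        "triple_sign ?S ?T ?U * \<theta> (associator A x y z) + triple_sign ?S ?U ?T * \<theta> (associator A x z y) = 0"
        using GA.linearised_left_alternative[OF \<phi> s] GA.linearised_right_alternative[OF \<phi> s] e disj
        unfolding un val by (simp_all add: Int_commute algebra_simps)
      then have "triple_sign ?S ?T ?U * (\<theta> (associator A x y z) + super_sign i j * \<theta> (associator A y x z)) = 0"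
        "triple_sign ?S ?T ?U * (\<theta> (associator A x y z) + super_sign j k * \<theta> (associator A x z y)) = 0"
        unfolding triple_sign_swap[OF B(1) B(1) B(1) disj] B(2) by (simp_all add: distrib_left mult_ac)
      with nz show ?thesis
        by simp
    qed
    show ?thesis
      by (intro conjI eq_by_functionals)
        (simp_all add: functional_add functional_smult functional_zero \<theta>)
  qed
  have metab: "\<theta> ((x \<otimes> y) \<otimes> (z \<otimes> t)) = 0"
    if xyzt: "x \<in> homog A i" "y \<in> homog A j" "z \<in> homog A k" "t \<in> homog A l"
      and \<theta>: "linear_functional A \<theta>" for x y z t i j k l \<theta>
  proof -
    let ?S = "B 0 i" and ?T = "B 1 j" and ?U = "B 2 k" and ?W = "B 3 l"
    have xyzt': "x \<in> homog A (of_nat (card ?S))" "y \<in> homog A (of_nat (card ?T))"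
      "z \<in> homog A (of_nat (card ?U))" "t \<in> homog A (of_nat (card ?W))"
      using xyzt B by simp_all
    have c [simp]: "x \<in> carrier A" "y \<in> carrier A" "z \<in> carrier A" "t \<in> carrier A"
      using xyzt by (auto intro: homog_carrier)
    have disj: "?S \<inter> ?T = {}" "?U \<inter> ?W = {}" "(?S \<union> ?T) \<inter> (?U \<union> ?W) = {}"
      using B(3) by (simp_all add: Int_Un_distrib Int_Un_distrib2)
    have xy: "grassmann_sign ?S ?T \<odot>\<^bsub>A\<^esub> (x \<otimes> y) \<in> homog A (of_nat (card (?S \<union> ?T)))"
      using homog_smult[OF homog_mult[OF xyzt'(1,2)]] B(1) disj by (simp add: card_Un_disjoint)
    have zt: "grassmann_sign ?U ?W \<odot>\<^bsub>A\<^esub> (z \<otimes> t) \<in> homog A (of_nat (card (?U \<union> ?W)))"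
      using homog_smult[OF homog_mult[OF xyzt'(3,4)]] B(1) disj by (simp add: card_Un_disjoint)
    have "(single ?S x \<otimes>\<^bsub>G\<^esub> single ?T y) \<otimes>\<^bsub>G\<^esub> (single ?U z \<otimes>\<^bsub>G\<^esub> single ?W t) = \<zero>\<^bsub>G\<^esub>"
      by (intro GA.metabelian single_closed B(1) xyzt')
    then have "single (?S \<union> ?T \<union> (?U \<union> ?W)) (grassmann_sign (?S \<union> ?T) (?U \<union> ?W) \<odot>\<^bsub>A\<^esub>
        ((grassmann_sign ?S ?T \<odot>\<^bsub>A\<^esub> (x \<otimes> y)) \<otimes> (grassmann_sign ?U ?W \<odot>\<^bsub>A\<^esub> (z \<otimes> t)))) = \<zero>\<^bsub>G\<^esub>"
      using single_mult[OF B(1) xyzt'(1) B(1) xyzt'(2)] single_mult[OF B(1) xyzt'(3) B(1) xyzt'(4)]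
        single_mult[OF finite_UnI[OF B(1) B(1)] xy finite_UnI[OF B(1) B(1)] zt] disj
      by simp
    then have "grassmann_sign (?S \<union> ?T) (?U \<union> ?W) \<odot>\<^bsub>A\<^esub>
        ((grassmann_sign ?S ?T \<odot>\<^bsub>A\<^esub> (x \<otimes> y)) \<otimes> (grassmann_sign ?U ?W \<odot>\<^bsub>A\<^esub> (z \<otimes> t))) = \<zero>"
      by (metis (no_types, lifting) envelope_simps(1) single_def)
    then have "\<theta> (grassmann_sign (?S \<union> ?T) (?U \<union> ?W) \<odot>\<^bsub>A\<^esub>
        ((grassmann_sign ?S ?T \<odot>\<^bsub>A\<^esub> (x \<otimes> y)) \<otimes> (grassmann_sign ?U ?W \<odot>\<^bsub>A\<^esub> (z \<otimes> t)))) = 0"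
      using functional_zero[OF \<theta>] by metis
    then show ?thesis
      by (simp add: smult_mult_left smult_mult_right functional_smult[OF \<theta>] grassmann_sign_def)
  qed
  \<comment> \<open>The metabelian law is known for homogeneous elements; by linearity one argument
    after the other is made arbitrary.\<close>
  have "(x \<otimes> y) \<otimes> (z \<otimes> t) = \<zero>"
    if xyzt: "x \<in> carrier A" "y \<in> carrier A" "z \<in> carrier A" "t \<in> carrier A" for x y z t
  proof (rule eq_by_functionals)
    note mL = linear_functional_mult_left and mR = linear_functional_mult_right
    fix \<theta> assume \<theta>: "linear_functional A \<theta>"
    have "\<theta> ((x \<otimes> y) \<otimes> (z \<otimes> t)) = 0"
    proof (rule functional_on_homog[OF xyzt(1)])
      show "linear_functional A (\<lambda>x. \<theta> ((x \<otimes> y) \<otimes> (z \<otimes> t)))"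
        by (intro mR[OF mR] \<theta> xyzt mult_closed)
      fix i x assume x: "x \<in> homog A i"
      show "\<theta> ((x \<otimes> y) \<otimes> (z \<otimes> t)) = 0"
      proof (rule functional_on_homog[OF xyzt(2)])
        show "linear_functional A (\<lambda>y. \<theta> ((x \<otimes> y) \<otimes> (z \<otimes> t)))"
          by (intro mL[OF mR] \<theta> xyzt homog_carrier[OF x] mult_closed)
        fix j y assume y: "y \<in> homog A j"
        show "\<theta> ((x \<otimes> y) \<otimes> (z \<otimes> t)) = 0"
        proof (rule functional_on_homog[OF xyzt(3)])
          show "linear_functional A (\<lambda>z. \<theta> ((x \<otimes> y) \<otimes> (z \<otimes> t)))"
            by (intro mR[OF mL] \<theta> xyzt homog_carrier[OF x] homog_carrier[OF y] mult_closed)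
          fix k z assume z: "z \<in> homog A k"
          show "\<theta> ((x \<otimes> y) \<otimes> (z \<otimes> t)) = 0"
          proof (rule functional_on_homog[OF xyzt(4)])
            show "linear_functional A (\<lambda>t. \<theta> ((x \<otimes> y) \<otimes> (z \<otimes> t)))"
              by (intro mL[OF mL] \<theta> homog_carrier[OF x] homog_carrier[OF y] homog_carrier[OF z] mult_closed)
          qed (rule metab[OF x y z _ \<theta>])
        qed
      qed
    qed
    then show "\<theta> ((x \<otimes> y) \<otimes> (z \<otimes> t)) = \<theta> \<zero>"
      by (simp add: functional_zero[OF \<theta>])
  qed (simp_all add: xyzt)
  with laws show ?thesis
    unfolding super_laws_def using superalgebra_axioms by blast
qed

section \<open>Superidentities via the Grassmann envelope\<close>

lemma eval_monomial_cong:
  "(\<And>x. x \<in> set (letters w) \<Longrightarrow> a x = b x) \<Longrightarrow> eval_monomial A a w = eval_monomial A b w"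
  by (induction w) auto

lemma multilinear_letters:
  "multilinear_polynomial n f \<Longrightarrow> f w \<noteq> 0 \<Longrightarrow> x \<in> set (letters w) \<longleftrightarrow> x < n"
  "multilinear_polynomial n f \<Longrightarrow> f w \<noteq> 0 \<Longrightarrow> distinct (letters w)"
  by (auto simp: multilinear_polynomial_def)

lemma (in superalgebra) eval_monomial_homog:
  assumes "\<And>x. x \<in> set (letters w) \<Longrightarrow> a x \<in> homog A (p x)"
  shows "eval_monomial A a w \<in> homog A (\<Sum>x\<leftarrow>letters w. p x)"
  using assms by (induction w) (auto simp del: add_bit_eq_xor intro: homog_mult)

text \<open>Parities are realised by finite sets \<open>B i\<close> of Grassmann generators, those of \<open>B i\<close>
  preceding those of \<open>B j\<close> for \<open>i < j\<close>.\<close>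

locale parity_blocks = superalgebra A
  for A :: "('f::field, 'a, 'm) superalgebra_scheme" (structure) +
  fixes B :: "nat \<Rightarrow> nat set" and p :: "nat \<Rightarrow> bit"
  assumes block_finite: "finite (B i)"
    and block_less: "\<lbrakk>i < j; s \<in> B i; t \<in> B j\<rbrakk> \<Longrightarrow> s < t"
    and block_card: "of_nat (card (B i)) = p i"
begin

lemma block_disjoint:
  assumes "i \<noteq> j"
  shows "B i \<inter> B j = {}"
proof -
  have False if "t \<in> B i" "t \<in> B j" for t
    using block_less[OF _ that] block_less[OF _ that(2,1)] assms by (cases i j rule: linorder_cases) auto
  then show ?thesis
    by auto
qed

lemma block_union_disjoint:
  assumes "I \<inter> J = {}"
  shows "\<Union> (B ` I) \<inter> \<Union> (B ` J) = {}"
proof -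
  have "B i \<inter> B j = {}" if "i \<in> I" "j \<in> J" for i j
    using assms that by (intro block_disjoint) auto
  then show ?thesis
    by auto
qed

text \<open>The block of \<open>t\<close> has to cross the blocks of all \<open>y < t\<close> in
  \<open>l\<close>. Crossing costs a sign exactly if both blocks have odd cardinality.\<close>

lemma grassmann_sign_block:
  "distinct (t # l) \<Longrightarrow> (grassmann_sign (B t) (\<Union> (B ` set l)) :: 'f) =
    (- 1) ^ length (filter (\<lambda>y. y < t \<and> p t = 1 \<and> p y = 1) l)"
proof (induction l)
  case (Cons y l)
  have "B y \<inter> \<Union> (B ` set l) = {}"
    using block_union_disjoint[of "{y}" "set l"] Cons.prems by auto
  then have "grassmann_sign (B t) (\<Union> (B ` set (y # l))) =
      grassmann_sign (B t) (B y) * (grassmann_sign (B t) (\<Union> (B ` set l)) :: 'f)"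
    by (simp add: grassmann_sign_union_right block_finite)
  also have "(grassmann_sign (B t) (B y) :: 'f) = (if y < t \<and> p t = 1 \<and> p y = 1 then - 1 else 1)"
  proof (cases "y < t")
    case True
    then have "(grassmann_sign (B t) (B y) :: 'f) = (- 1) ^ (card (B t) * card (B y))"
      using grassmann_sign_commute[of "B t" "B y", where 'f = 'f] block_finite block_disjoint[of t y]
      by (auto simp: grassmann_sign_less block_less)
    also have "\<dots> = super_sign (p t) (p y)"
      by (simp flip: super_sign_card block_card)
    finally show ?thesis
      using True by (simp add: super_sign_def)
  next
    case False
    with Cons.prems have "t < y"
      by auto
    then show ?thesis
      using False by (auto simp: grassmann_sign_less block_less)
  qed
  finally show ?case
    using Cons by simp
qed simp

lemma grassmann_sign_blocks:
  "distinct (l @ m) \<Longrightarrow> (grassmann_sign (\<Union> (B ` set l)) (\<Union> (B ` set m)) :: 'f) =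
    (\<Prod>t\<leftarrow>l. (- 1) ^ length (filter (\<lambda>y. y < t \<and> p t = 1 \<and> p y = 1) m))"
proof (induction l)
  case (Cons t l)
  have "B t \<inter> \<Union> (B ` set l) = {}"
    using block_union_disjoint[of "{t}" "set l"] Cons.prems by auto
  then show ?case
    using Cons by (simp add: grassmann_sign_union_left block_finite grassmann_sign_block)
qed simp

lemma card_blocks: "distinct l \<Longrightarrow> of_nat (card (\<Union> (B ` set l))) = (\<Sum>x\<leftarrow>l. p x)"
proof (induction l)
  case (Cons t l)
  have "B t \<inter> \<Union> (B ` set l) = {}"
    using block_union_disjoint[of "{t}" "set l"] Cons.prems by auto
  then show ?case
    using Cons by (simp add: card_Un_disjoint block_finite block_card del: add_bit_eq_xor)
qed simp

text \<open>The Koszul sign is the Grassmann sign of reordering the blocks. For a product both split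
  into the signs of the two factors and the sign of the crossing, and the latter agree by
  \<open>koszul_list_append\<close> and \<open>grassmann_sign_blocks\<close>.\<close>

lemma eval_monomial_envelope:
  assumes "distinct (letters w)" "\<And>x. x \<in> set (letters w) \<Longrightarrow> a x \<in> homog A (p x)"
  shows "eval_monomial G (\<lambda>i. single (B i) (a i)) w =
    single (\<Union> (B ` set (letters w))) (koszul_sign p w \<odot>\<^bsub>A\<^esub> eval_monomial A a w)"
  using assms
proof (induction w)
  case (Gen x)
  then show ?case
    by (simp add: koszul_sign_letters koszul_list_Cons homog_carrier)
next
  case (Prod u v)
  let ?U = "\<Union> (B ` set (letters u))" and ?V = "\<Union> (B ` set (letters v))"
  have h: "koszul_sign p w \<odot>\<^bsub>A\<^esub> eval_monomial A a w \<in> homog A (of_nat (card (\<Union> (B ` set (letters w)))))"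
    if "w = u \<or> w = v" for w
    using Prod.prems that by (auto simp: card_blocks intro!: homog_smult eval_monomial_homog)
  have c: "eval_monomial A a u \<in> carrier A" "eval_monomial A a v \<in> carrier A"
    using Prod.prems by (auto intro!: eval_monomial_closed intro: homog_carrier)
  have "eval_monomial G (\<lambda>i. single (B i) (a i)) (Prod u v) =
      single ?U (koszul_sign p u \<odot>\<^bsub>A\<^esub> eval_monomial A a u) \<otimes>\<^bsub>G\<^esub>
      single ?V (koszul_sign p v \<odot>\<^bsub>A\<^esub> eval_monomial A a v)"
    using Prod by simp
  also have "\<dots> = single (?U \<union> ?V) (grassmann_sign ?U ?V \<odot>\<^bsub>A\<^esub>
      ((koszul_sign p u \<odot>\<^bsub>A\<^esub> eval_monomial A a u) \<otimes> (koszul_sign p v \<odot>\<^bsub>A\<^esub> eval_monomial A a v)))"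
    using Prod.prems block_union_disjoint[of "set (letters u)" "set (letters v)"]
    by (subst single_mult[OF _ h _ h]) (auto simp: block_finite)
  also have "\<dots> = single (?U \<union> ?V) (koszul_sign p (Prod u v) \<odot>\<^bsub>A\<^esub> eval_monomial A a (Prod u v))"
    using c Prod.prems
    by (simp add: smult_mult_left smult_mult_right koszul_sign_letters koszul_list_append
        grassmann_sign_blocks mult_ac flip: smult_mult)
  finally show ?case
    by (simp add: image_Un)
qed

text \<open>All monomials of a multilinear \<open>f\<close> get the same Grassmann factor, the union
  of all blocks, so this single component carries the whole superidentity.\<close>

lemma polynomial_value_envelope:
  assumes f: "multilinear_polynomial n f" and a: "\<And>i. i < n \<Longrightarrow> a i \<in> homog A (p i)"
    and b: "\<And>i. i < n \<Longrightarrow> b i = single (B i) (a i)"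
  shows "polynomial_value G f b (\<Union> (B ` {..<n})) = superization_value A f p a"
proof (rule eq_by_functionals)
  let ?U = "\<Union> (B ` {..<n})"
  have bG: "eval_monomial G b w \<in> carrier G" if "f w \<noteq> 0" for w
    using multilinear_letters[OF f that] a b block_finite block_card
    by (intro env.eval_monomial_closed) (auto intro!: single_closed)
  have aA: "eval_monomial A a w \<in> carrier A" if "f w \<noteq> 0" for w
    using multilinear_letters[OF f that] a by (intro eval_monomial_closed) (auto intro: homog_carrier)
  show "polynomial_value G f b ?U \<in> carrier A"
    unfolding polynomial_value_def using bG
    by (intro envelope_component env.finsum_closed) (auto simp del: envelope_simps)
  show "superization_value A f p a \<in> carrier A"
    unfolding superization_value_def using aA by (intro M.finsum_closed) auto
  fix \<theta> assume \<theta>: "linear_functional A \<theta>"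
  have "\<theta> (eval_monomial G b w ?U) = koszul_sign p w * \<theta> (eval_monomial A a w)" if w: "f w \<noteq> 0" for w
  proof -
    have "eval_monomial G b w = eval_monomial G (\<lambda>i. single (B i) (a i)) w"
      using multilinear_letters[OF f w] b by (intro eval_monomial_cong) auto
    moreover have "set (letters w) = {..<n}"
      using multilinear_letters[OF f w] by auto
    ultimately show ?thesis
      using eval_monomial_envelope[of w a] multilinear_letters[OF f w] a aA[OF w]
      by (simp add: single_def functional_smult[OF \<theta>])
  qed
  then have *: "\<theta> ((f w \<odot>\<^bsub>G\<^esub> eval_monomial G b w) ?U) =
      \<theta> ((koszul_sign p w * f w) \<odot>\<^bsub>A\<^esub> eval_monomial A a w)" if "f w \<noteq> 0" for w
    using that aA[OF that] envelope_component[OF bG[OF that]] by (simp add: functional_smult[OF \<theta>])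
  have "\<theta> (polynomial_value G f b ?U) = (\<Sum>w\<in>{w. f w \<noteq> 0}. \<theta> ((f w \<odot>\<^bsub>G\<^esub> eval_monomial G b w) ?U))"
    unfolding polynomial_value_def
    by (rule env.functional_finsum[OF linear_functional_component[OF \<theta>]])
      (auto simp del: envelope_simps intro: bG)
  also have "\<dots> = \<theta> (superization_value A f p a)"
    unfolding superization_value_def using * aA
    by (subst functional_finsum[OF \<theta>]) (auto intro!: sum.cong)
  finally show "\<theta> (polynomial_value G f b ?U) = \<theta> (superization_value A f p a)" .
qed

end

theorem superidentity_via_envelope:
  fixes A :: "('f::field, 'a, 'm) superalgebra_scheme"
  assumes "superalgebra A" "multilinear_polynomial n f"
    "\<And>b. (\<And>i. b i \<in> carrier (grassmann_envelope A)) \<Longrightarrow>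
      polynomial_value (grassmann_envelope A) f b = \<zero>\<^bsub>grassmann_envelope A\<^esub>"
  shows "satisfies_superidentity A n f"
  unfolding satisfies_superidentity_def
proof (intro allI impI)
  fix p a assume a: "\<forall>i<n. a i \<in> homog A (p i)"
  interpret superalgebra A
    by fact
  define B :: "nat \<Rightarrow> nat set" where "B i = (if p i = 1 then {i} else {})" for i
  interpret parity_blocks A B p
    by unfold_locales (auto simp: B_def split: if_splits)
  define b where "b i = (if i < n then single (B i) (a i) else \<zero>\<^bsub>G\<^esub>)" for i
  have "b i \<in> carrier G" for i
    using a block_finite block_card env.zero_closed by (auto simp: b_def intro!: single_closed)
  then have "polynomial_value G f b = \<zero>\<^bsub>G\<^esub>"
    using assms(3) by blast
  then show "superization_value A f p a = \<zero>\<^bsub>A\<^esub>"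
    using polynomial_value_envelope[OF assms(2), of a b] a by (simp add: b_def)
qed

section \<open>Homomorphisms and quotients\<close>

definition algebra_hom ::
    "('f::field, 'a, 'm) module_scheme \<Rightarrow> ('f, 'b, 'k) module_scheme \<Rightarrow> ('a \<Rightarrow> 'b) \<Rightarrow> bool" where
  "algebra_hom A Q h \<longleftrightarrow> (\<forall>x\<in>carrier A. h x \<in> carrier Q) \<and>
    (\<forall>x\<in>carrier A. \<forall>y\<in>carrier A. h (x \<oplus>\<^bsub>A\<^esub> y) = h x \<oplus>\<^bsub>Q\<^esub> h y \<and> h (x \<otimes>\<^bsub>A\<^esub> y) = h x \<otimes>\<^bsub>Q\<^esub> h y) \<and>
    (\<forall>c. \<forall>x\<in>carrier A. h (c \<odot>\<^bsub>A\<^esub> x) = c \<odot>\<^bsub>Q\<^esub> h x)"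

lemma linear_functional_hom:
  "algebra_hom A Q h \<Longrightarrow> linear_functional Q \<phi> \<Longrightarrow> linear_functional A (\<lambda>x. \<phi> (h x))"
  by (simp add: algebra_hom_def linear_functional_def)

lemma eval_monomial_hom:
  assumes "nonassoc_algebra A" "algebra_hom A Q h" "\<And>x. x \<in> set (letters w) \<Longrightarrow> a x \<in> carrier A"
  shows "eval_monomial Q (\<lambda>x. h (a x)) w = h (eval_monomial A a w)"
  using assms(3)
proof (induction w)
  case (Prod u v)
  have "eval_monomial A a u \<in> carrier A" "eval_monomial A a v \<in> carrier A"
    using Prod.prems by (auto intro!: nonassoc_algebra.eval_monomial_closed[OF assms(1)])
  with Prod show ?case
    using assms(2) by (simp add: algebra_hom_def)
qed simp

lemma superization_value_closed:
  assumes "nonassoc_algebra A" "multilinear_polynomial n f" "\<And>i. i < n \<Longrightarrow> a i \<in> carrier A"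
  shows "superization_value A f p a \<in> carrier A"
proof -
  interpret nonassoc_algebra A
    by fact
  show ?thesis
    unfolding superization_value_def using multilinear_letters[OF assms(2)] assms(3)
    by (intro M.finsum_closed) (auto intro!: eval_monomial_closed)
qed

lemma superization_value_cong:
  assumes "nonassoc_algebra A" "multilinear_polynomial n f"
    "\<And>i. i < n \<Longrightarrow> a i = b i" "\<And>i. i < n \<Longrightarrow> b i \<in> carrier A"
  shows "superization_value A f p a = superization_value A f p b"
proof -
  interpret nonassoc_algebra A
    by fact
  have "eval_monomial A a w = eval_monomial A b w" "eval_monomial A b w \<in> carrier A" if "f w \<noteq> 0" for w
    using multilinear_letters[OF assms(2) that] assms(3,4)
    by (auto intro!: eval_monomial_cong eval_monomial_closed)
  then show ?thesis
    unfolding superization_value_def by (intro M.finsum_cong') auto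
qed

lemma functional_superization_value:
  assumes "nonassoc_algebra A" "multilinear_polynomial n f" "\<And>i. i < n \<Longrightarrow> a i \<in> carrier A"
    "linear_functional A \<phi>"
  shows "\<phi> (superization_value A f p a) =
    (\<Sum>w\<in>{w. f w \<noteq> 0}. koszul_sign p w * f w * \<phi> (eval_monomial A a w))"
proof -
  interpret nonassoc_algebra A
    by fact
  have "eval_monomial A a w \<in> carrier A" if "f w \<noteq> 0" for w
    using multilinear_letters[OF assms(2) that] assms(3) by (intro eval_monomial_closed) auto
  then show ?thesis
    unfolding superization_value_def
    by (subst functional_finsum[OF assms(4)]) (auto simp: functional_smult[OF assms(4)])
qed

lemma superization_value_hom:
  assumes "nonassoc_algebra A" "nonassoc_algebra Q" "algebra_hom A Q h"
    "multilinear_polynomial n f" "\<And>i. i < n \<Longrightarrow> a i \<in> carrier A"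
  shows "superization_value Q f p (\<lambda>i. h (a i)) = h (superization_value A f p a)"
proof (rule nonassoc_algebra.eq_by_functionals[OF assms(2)])
  have h: "h x \<in> carrier Q" if "x \<in> carrier A" for x
    using assms(3) that by (simp add: algebra_hom_def)
  show "superization_value Q f p (\<lambda>i. h (a i)) \<in> carrier Q"
    by (rule superization_value_closed[OF assms(2,4)]) (use assms(5) h in auto)
  show "h (superization_value A f p a) \<in> carrier Q"
    by (rule h[OF superization_value_closed[OF assms(1,4,5)]])
  fix \<phi> assume \<phi>: "linear_functional Q \<phi>"
  have "eval_monomial Q (\<lambda>i. h (a i)) w = h (eval_monomial A a w)" if "f w \<noteq> 0" for w
    using multilinear_letters[OF assms(4) that] assms(5) by (intro eval_monomial_hom assms) auto
  then show "\<phi> (superization_value Q f p (\<lambda>i. h (a i))) = \<phi> (h (superization_value A f p a))"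
    using functional_superization_value[OF assms(2,4) h[OF assms(5)] \<phi>]
      functional_superization_value[OF assms(1,4,5) linear_functional_hom[OF assms(3) \<phi>]]
    by simp
qed

text \<open>Serves twice: for the projection to the cosets of a graded ideal, and for copying a
  superalgebra along an injection. The premise \<open>disj\<close> says that the images of the even
  and the odd part meet in zero only.\<close>

lemma superalgebra_image:
  fixes A :: "('f::field, 'a, 'm) superalgebra_scheme" and Q :: "('f, 'b, 'k) superalgebra_scheme"
  assumes "superalgebra A" and car: "carrier Q = h ` carrier A"
    and add: "\<And>x y. \<lbrakk>x \<in> carrier A; y \<in> carrier A\<rbrakk> \<Longrightarrow> h x \<oplus>\<^bsub>Q\<^esub> h y = h (x \<oplus>\<^bsub>A\<^esub> y)"
    and mult: "\<And>x y. \<lbrakk>x \<in> carrier A; y \<in> carrier A\<rbrakk> \<Longrightarrow> h x \<otimes>\<^bsub>Q\<^esub> h y = h (x \<otimes>\<^bsub>A\<^esub> y)"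
    and smult: "\<And>c x. x \<in> carrier A \<Longrightarrow> c \<odot>\<^bsub>Q\<^esub> h x = h (c \<odot>\<^bsub>A\<^esub> x)"
    and zero: "\<zero>\<^bsub>Q\<^esub> = h \<zero>\<^bsub>A\<^esub>"
    and hom: "\<And>i. homog Q i = h ` homog A i"
    and disj: "\<And>x y. \<lbrakk>x \<in> homog A 0; y \<in> homog A 1; h x = h y\<rbrakk> \<Longrightarrow> h x = h \<zero>\<^bsub>A\<^esub>"
  shows "superalgebra Q"
proof -
  interpret A: superalgebra A
    by fact
  have "nonassoc_algebra Q"
    by (rule nonassoc_algebraI; unfold car zero; (elim imageE)?; simp only: add mult smult A.zero_closed
        A.a_closed A.mult_closed A.smult_in imageI A.a_assoc A.l_zero A.smult_0 A.smult_1 A.smult_add_scalar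
        A.smult_add A.smult_mult A.mult_add_left A.mult_add_right A.smult_mult_left A.smult_mult_right)
      (auto simp: A.a_comm)
  then interpret Q: nonassoc_algebra Q .
  show ?thesis
  proof (intro superalgebra.intro superalgebra_axioms.intro)
    fix i j
    show "nonassoc_algebra Q" ..
    show "submodule (homog Q i) ring_of_type_algebra Q"
    proof (rule Q.submoduleI)
      show "homog Q i \<subseteq> carrier Q"
        using A.homog_carrier by (auto simp: car hom)
      show "\<zero>\<^bsub>Q\<^esub> \<in> homog Q i"
        by (simp add: zero hom)
      have sm: "c \<odot>\<^bsub>Q\<^esub> x \<in> homog Q i" if "x \<in> homog Q i" for c x
        using that by (auto simp: hom smult A.homog_carrier intro!: imageI A.homog_smult)
      then show "\<And>a x. x \<in> homog Q i \<Longrightarrow> a \<odot>\<^bsub>Q\<^esub> x \<in> homog Q i" .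
      show "\<ominus>\<^bsub>Q\<^esub> x \<in> homog Q i" if "x \<in> homog Q i" for x
        using sm[OF that, of "- 1"] that \<open>homog Q i \<subseteq> carrier Q\<close> by (auto simp: Q.smult_uminus_1)
      show "x \<oplus>\<^bsub>Q\<^esub> y \<in> homog Q i" if "x \<in> homog Q i" "y \<in> homog Q i" for x y
        using that by (auto simp: hom add A.homog_carrier intro!: imageI A.homog_add)
    qed
    show "homog Q 0 <+>\<^bsub>Q\<^esub> homog Q 1 = carrier Q"
      unfolding hom car A.homog_sum[symmetric] set_add_def'
      by (auto simp: add A.homog_carrier image_UN)
    show "homog Q 0 \<inter> homog Q 1 = {\<zero>\<^bsub>Q\<^esub>}"
      using disj A.homog_zero by (fastforce simp: hom zero)
    show "x \<otimes>\<^bsub>Q\<^esub> y \<in> homog Q (i + j)" if "x \<in> homog Q i" "y \<in> homog Q j" for x y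
      using that by (auto simp del: add_bit_eq_xor simp: hom mult A.homog_carrier intro!: imageI A.homog_mult)
  qed
qed

context nonassoc_algebra
begin

context
  fixes J
  assumes J: "submodule J (ring_of_type_algebra :: 'f ring) A"
begin

lemma submodule_carrier: "j \<in> J \<Longrightarrow> j \<in> carrier A"
  and submodule_zero: "\<zero> \<in> J"
  and submodule_add: "j \<in> J \<Longrightarrow> k \<in> J \<Longrightarrow> j \<oplus> k \<in> J"
  and submodule_uminus: "j \<in> J \<Longrightarrow> \<ominus> j \<in> J"
  and submodule_smult: "j \<in> J \<Longrightarrow> c \<odot>\<^bsub>A\<^esub> j \<in> J"
proof -
  show "j \<in> J \<Longrightarrow> j \<in> carrier A" "j \<in> J \<Longrightarrow> k \<in> J \<Longrightarrow> j \<oplus> k \<in> J" "j \<in> J \<Longrightarrow> \<ominus> j \<in> J"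
    "j \<in> J \<Longrightarrow> c \<odot>\<^bsub>A\<^esub> j \<in> J"
    using submoduleE[OF J] by auto
  show "\<zero> \<in> J"
    using subgroup.one_closed[OF submodule.axioms(1)[OF J]] by simp
qed

lemma coset_elem: "x \<in> J +> a \<longleftrightarrow> (\<exists>j\<in>J. x = j \<oplus> a)"
  by (auto simp: a_r_coset_def')

lemma coset_absorb:
  assumes j: "j \<in> J" and a: "a \<in> carrier A"
  shows "J +> (j \<oplus> a) = J +> a"
proof -
  have eqs: "k \<oplus> (j \<oplus> a) = (k \<oplus> j) \<oplus> a" "k \<oplus> a = (k \<oplus> \<ominus> j) \<oplus> (j \<oplus> a)" if "k \<in> J" for k
    using submodule_carrier[OF that] submodule_carrier[OF j] a
    by (simp_all add: M.a_assoc M.r_neg1)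
  show ?thesis
  proof (intro subset_antisym subsetI)
    fix x assume "x \<in> J +> (j \<oplus> a)"
    then obtain k where "k \<in> J" "x = k \<oplus> (j \<oplus> a)"
      by (auto simp: coset_elem)
    then show "x \<in> J +> a"
      using eqs(1) submodule_add j coset_elem by metis
  next
    fix x assume "x \<in> J +> a"
    then obtain k where "k \<in> J" "x = k \<oplus> a"
      by (auto simp: coset_elem)
    then show "x \<in> J +> (j \<oplus> a)"
      using eqs(2) submodule_add submodule_uminus j coset_elem by metis
  qed
qed

lemma coset_self: "a \<in> carrier A \<Longrightarrow> a \<in> J +> a"
  using submodule_zero by (auto simp: coset_elem intro!: bexI[of _ \<zero>])

lemma coset_eq_iff:
  assumes "a \<in> carrier A" "b \<in> carrier A"
  shows "J +> a = J +> b \<longleftrightarrow> a \<ominus> b \<in> J"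
proof
  assume "J +> a = J +> b"
  then obtain j where "j \<in> J" "a = j \<oplus> b"
    using coset_self[OF assms(1)] coset_elem by auto
  then show "a \<ominus> b \<in> J"
    using assms submodule_carrier[of j] by (simp add: a_minus_def M.a_assoc M.r_neg)
next
  assume "a \<ominus> b \<in> J"
  moreover have "a = (a \<ominus> b) \<oplus> b"
    using assms by (simp add: a_minus_def M.a_assoc M.l_neg)
  ultimately show "J +> a = J +> b"
    using coset_absorb[of "a \<ominus> b" b] assms by simp
qed

lemma coset_zero: "J +> \<zero> = J"
  using submodule_carrier by (auto simp: coset_elem)

lemma coset_add:
  assumes "a \<in> carrier A" "b \<in> carrier A"
  shows "set_add A (J +> a) (J +> b) = J +> (a \<oplus> b)"
proof -
  have eqs: "(j \<oplus> a) \<oplus> (k \<oplus> b) = (j \<oplus> k) \<oplus> (a \<oplus> b)" "j \<oplus> (a \<oplus> b) = (j \<oplus> a) \<oplus> (\<zero> \<oplus> b)"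
    if "j \<in> J" "k \<in> J" for j k
    using that assms submodule_carrier by (simp_all add: M.a_ac)
  show ?thesis
  proof (intro subset_antisym subsetI)
    fix x assume "x \<in> set_add A (J +> a) (J +> b)"
    then obtain j k where "j \<in> J" "k \<in> J" "x = (j \<oplus> a) \<oplus> (k \<oplus> b)"
      by (auto simp: set_add_def' coset_elem)
    then show "x \<in> J +> (a \<oplus> b)"
      using eqs(1) submodule_add coset_elem by metis
  next
    fix x assume "x \<in> J +> (a \<oplus> b)"
    then obtain j where "j \<in> J" "x = (j \<oplus> a) \<oplus> (\<zero> \<oplus> b)"
      using eqs(2) submodule_zero by (auto simp: coset_elem)
    then have "j \<oplus> a \<in> J +> a" "\<zero> \<oplus> b \<in> J +> b"
      using submodule_zero by (auto simp: coset_elem)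
    then show "x \<in> set_add A (J +> a) (J +> b)"
      unfolding set_add_def' \<open>x = _\<close> by blast
  qed
qed

lemma coset_smult:
  assumes "a \<in> carrier A"
  shows "(\<Union>x\<in>J +> a. J +> (c \<odot>\<^bsub>A\<^esub> x)) = J +> (c \<odot>\<^bsub>A\<^esub> a)"
proof -
  have "J +> (c \<odot>\<^bsub>A\<^esub> x) = J +> (c \<odot>\<^bsub>A\<^esub> a)" if x: "x \<in> J +> a" for x
  proof -
    obtain j where "j \<in> J" "x = j \<oplus> a"
      using x coset_elem by auto
    then show ?thesis
      using coset_absorb[OF submodule_smult] assms submodule_carrier by (simp add: smult_add)
  qed
  then have "(\<Union>x\<in>J +> a. J +> (c \<odot>\<^bsub>A\<^esub> x)) = (\<Union>x\<in>J +> a. J +> (c \<odot>\<^bsub>A\<^esub> a))"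
    by (intro SUP_cong) simp_all
  moreover have "J +> a \<noteq> {}"
    using coset_self[OF assms] by blast
  ultimately show ?thesis
    by simp
qed

lemma coset_mult:
  assumes "a \<in> carrier A" "b \<in> carrier A"
    and ideal: "\<And>a j. a \<in> carrier A \<Longrightarrow> j \<in> J \<Longrightarrow> a \<otimes> j \<in> J \<and> j \<otimes> a \<in> J"
  shows "rcoset_mult A J (J +> a) (J +> b) = J +> (a \<otimes> b)"
proof -
  have "J +> (x \<otimes> y) = J +> (a \<otimes> b)" if xy: "x \<in> J +> a" "y \<in> J +> b" for x y
  proof -
    obtain j k where jk: "j \<in> J" "x = j \<oplus> a" "k \<in> J" "y = k \<oplus> b"
      using xy coset_elem by auto
    then have "x \<otimes> y = (j \<otimes> (k \<oplus> b) \<oplus> a \<otimes> k) \<oplus> a \<otimes> b"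
      using assms submodule_carrier by (simp add: mult_add_left mult_add_right M.a_ac)
    moreover have "j \<otimes> (k \<oplus> b) \<oplus> a \<otimes> k \<in> J"
      using assms jk submodule_carrier by (intro submodule_add) auto
    ultimately show ?thesis
      using coset_absorb assms by simp
  qed
  then have "rcoset_mult A J (J +> a) (J +> b) = (\<Union>x\<in>J +> a. \<Union>y\<in>J +> b. J +> (a \<otimes> b))"
    unfolding rcoset_mult_def by (intro SUP_cong) simp_all
  moreover have "J +> a \<noteq> {}" "J +> b \<noteq> {}"
    using coset_self[OF assms(1)] coset_self[OF assms(2)] by blast+
  ultimately show ?thesis
    by simp
qed

end

end

context superalgebra
begin

lemma homog_decompose:
  assumes "x \<in> carrier A"
  obtains y z where "y \<in> homog A 0" "z \<in> homog A 1" "x = y \<oplus> z"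
  using assms homog_sum unfolding set_add_def' by blast

lemma homog_unique:
  assumes "y \<in> homog A 0" "z \<in> homog A 1" "y' \<in> homog A 0" "z' \<in> homog A 1" "y \<oplus> z = y' \<oplus> z'"
  shows "y = y'" "z = z'"
proof -
  note c [simp] = assms(1-4)[THEN homog_carrier]
  have "y \<ominus> y' = z' \<ominus> z"
  proof (rule eq_by_functionals)
    fix \<phi> assume \<phi>: "linear_functional A \<phi>"
    have "\<phi> y + \<phi> z = \<phi> y' + \<phi> z'"
      using assms(5) functional_add[OF \<phi>, of y z] functional_add[OF \<phi>, of y' z'] by simp
    then show "\<phi> (y \<ominus> y') = \<phi> (z' \<ominus> z)"
      by (simp add: functional_minus[OF \<phi>] algebra_simps)
  qed simp_all
  moreover have "y \<ominus> y' \<in> homog A 0" "z' \<ominus> z \<in> homog A 1"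
    using assms homog_add homog_smult[of _ _ "- 1"] by (simp_all add: a_minus_def flip: smult_uminus_1)
  ultimately have "y \<ominus> y' = \<zero>" "z' \<ominus> z = \<zero>"
    using homog_disjoint by auto
  then show "y = y'" "z = z'"
    by (simp_all add: a_minus_def M.minus_equality[symmetric] M.add.inv_solve_right')
qed

end

context
  fixes A :: "('f::field, 'a) superalgebra" (structure) and J
  assumes A: "superalgebra A" and J: "graded_ideal J A"
begin

interpretation superalgebra A
  by (rule A)

lemma graded_ideal_submodule: "submodule J (ring_of_type_algebra :: 'f ring) A"
  using J by (simp add: graded_ideal_def)

lemma graded_ideal_mult: "a \<in> carrier A \<Longrightarrow> j \<in> J \<Longrightarrow> a \<otimes> j \<in> J \<and> j \<otimes> a \<in> J"
  using J by (simp add: graded_ideal_def)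

lemma graded_ideal_components:
  assumes "y \<in> homog A 0" "z \<in> homog A 1" "y \<oplus> z \<in> J"
  shows "y \<in> J" "z \<in> J"
proof -
  have "y \<oplus> z \<in> set_add A (J \<inter> homog A 0) (J \<inter> homog A 1)"
    using J assms(3) by (simp add: graded_ideal_def)
  then obtain y' z' where "y' \<in> J \<inter> homog A 0" "z' \<in> J \<inter> homog A 1" "y \<oplus> z = y' \<oplus> z'"
    unfolding set_add_def' by auto
  then show "y \<in> J" "z \<in> J"
    using homog_unique[OF assms(1,2), of y' z'] by auto
qed

lemma quotient_simps:
  "carrier (quotient_superalgebra A J) = (\<lambda>a. J +> a) ` carrier A"
  "\<lbrakk>x \<in> carrier A; y \<in> carrier A\<rbrakk> \<Longrightarrow>
    (J +> x) \<oplus>\<^bsub>quotient_superalgebra A J\<^esub> (J +> y) = J +> (x \<oplus> y)"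
  "\<lbrakk>x \<in> carrier A; y \<in> carrier A\<rbrakk> \<Longrightarrow>
    (J +> x) \<otimes>\<^bsub>quotient_superalgebra A J\<^esub> (J +> y) = J +> (x \<otimes> y)"
  "x \<in> carrier A \<Longrightarrow> c \<odot>\<^bsub>quotient_superalgebra A J\<^esub> (J +> x) = J +> (c \<odot>\<^bsub>A\<^esub> x)"
  "\<zero>\<^bsub>quotient_superalgebra A J\<^esub> = J +> \<zero>"
  "homog (quotient_superalgebra A J) i = (\<lambda>a. J +> a) ` homog A i"
  by (auto simp: quotient_superalgebra_def A_RCOSETS_def' coset_add coset_mult coset_smult coset_zero
      graded_ideal_submodule graded_ideal_mult)

lemma quotient_is_superalgebra: "superalgebra (quotient_superalgebra A J)"
proof (rule superalgebra_image[OF A quotient_simps])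
  fix x y assume xy: "x \<in> homog A 0" "y \<in> homog A 1" "J +> x = J +> y"
  then have "x \<ominus> y \<in> J"
    using coset_eq_iff[OF graded_ideal_submodule] homog_carrier by blast
  then have "x \<in> J"
    using graded_ideal_components[of x "\<ominus> y"] homog_smult[OF xy(2), of "- 1"] xy
    by (simp add: a_minus_def smult_uminus_1 homog_carrier)
  then show "J +> x = J +> \<zero>"
    using coset_absorb[OF graded_ideal_submodule, of x \<zero>] xy by (simp add: homog_carrier)
qed

lemma quotient_hom: "algebra_hom A (quotient_superalgebra A J) (\<lambda>a. J +> a)"
  unfolding algebra_hom_def by (simp add: quotient_simps)

lemma quotient_zero_iff:
  "a \<in> carrier A \<Longrightarrow> J +> a = \<zero>\<^bsub>quotient_superalgebra A J\<^esub> \<longleftrightarrow> a \<in> J"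
  using coset_eq_iff[OF graded_ideal_submodule, of a \<zero>] M.minus_equality[of \<zero> \<zero>]
  by (simp add: quotient_simps a_minus_def)

text \<open>Homogeneous elements of the quotient lift to homogeneous elements. In this form the
  condition on \<open>J\<close> is mere membership, which is compatible with intersections of
  ideals.\<close>

lemma quotient_superidentity_iff:
  assumes "multilinear_polynomial n f"
  shows "satisfies_superidentity (quotient_superalgebra A J) n f \<longleftrightarrow>
    (\<forall>p a. (\<forall>i<n. a i \<in> homog A (p i)) \<longrightarrow> superization_value A f p a \<in> J)"
proof -
  let ?Q = "quotient_superalgebra A J"
  interpret Q: superalgebra ?Q
    by (rule quotient_is_superalgebra)
  have val: "superization_value ?Q f p (\<lambda>i. J +> a i) = \<zero>\<^bsub>?Q\<^esub> \<longleftrightarrow> superization_value A f p a \<in> J"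
    if "\<forall>i<n. a i \<in> homog A (p i)" for p a
  proof -
    have c: "a i \<in> carrier A" if "i < n" for i
      using that \<open>\<forall>i<n. a i \<in> homog A (p i)\<close> homog_carrier by blast
    show ?thesis
      using superization_value_hom[OF nonassoc_algebra_axioms Q.nonassoc_algebra_axioms quotient_hom assms c]
        quotient_zero_iff[OF superization_value_closed[OF nonassoc_algebra_axioms assms c]]
      by simp
  qed
  show ?thesis
    unfolding satisfies_superidentity_def
  proof (intro iffI allI impI)
    fix p a assume *: "\<forall>p a. (\<forall>i<n. a i \<in> homog A (p i)) \<longrightarrow> superization_value A f p a \<in> J"
      and a: "\<forall>i<n. a i \<in> homog ?Q (p i)"
    have "\<forall>i. \<exists>x. i < n \<longrightarrow> x \<in> homog A (p i) \<and> a i = J +> x"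
      using a by (auto simp: quotient_simps)
    then obtain b where b: "\<And>i. i < n \<Longrightarrow> b i \<in> homog A (p i) \<and> a i = J +> b i"
      by metis
    then have "superization_value ?Q f p (\<lambda>i. J +> b i) = \<zero>\<^bsub>?Q\<^esub>"
      using val * by auto
    moreover have "b i \<in> carrier A" if "i < n" for i
      using b[OF that] homog_carrier by blast
    then have "superization_value ?Q f p a = superization_value ?Q f p (\<lambda>i. J +> b i)"
      using b by (intro superization_value_cong[OF Q.nonassoc_algebra_axioms assms])
        (auto simp: quotient_simps)
    ultimately show "superization_value ?Q f p a = \<zero>\<^bsub>?Q\<^esub>"
      by simp
  next
    fix p a assume *: "\<forall>p a. (\<forall>i<n. a i \<in> homog ?Q (p i)) \<longrightarrow> superization_value ?Q f p a = \<zero>\<^bsub>?Q\<^esub>"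
      and a: "\<forall>i<n. a i \<in> homog A (p i)"
    then have "superization_value ?Q f p (\<lambda>i. J +> a i) = \<zero>\<^bsub>?Q\<^esub>"
      by (simp add: quotient_simps)
    with val a show "superization_value A f p a \<in> J"
      by auto
  qed
qed

end

section \<open>Free superalgebras\<close>

abbreviation in_generators :: "nat \<Rightarrow> nat \<Rightarrow> (nat + nat) monomial \<Rightarrow> bool" where
  "in_generators r s w \<equiv> set (letters w) \<subseteq> generators r s"

lemma free_carrier: "h \<in> carrier (free_superalgebra r s) \<longleftrightarrow>
    finite {w. h w \<noteq> 0} \<and> (\<forall>w. h w \<noteq> 0 \<longrightarrow> in_generators r s w)"
  by (simp add: free_superalgebra_def Let_def)

lemma free_homog: "h \<in> homog (free_superalgebra r s) p \<longleftrightarrow>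
    h \<in> carrier (free_superalgebra r s) \<and> (\<forall>w. h w \<noteq> 0 \<longrightarrow> monomial_parity w = p)"
  by (simp add: free_superalgebra_def Let_def)

lemma free_simps [simp]:
  "ring.zero (free_superalgebra r s) = (\<lambda>w. 0)"
  "x \<oplus>\<^bsub>free_superalgebra r s\<^esub> y = (\<lambda>w. x w + y w)"
  "c \<odot>\<^bsub>free_superalgebra r s\<^esub> x = (\<lambda>w. c * x w)"
  "x \<otimes>\<^bsub>free_superalgebra r s\<^esub> y = (\<lambda>w. case w of Gen x \<Rightarrow> 0 | Prod u v \<Rightarrow> x u * y v)"
  by (simp_all add: free_superalgebra_def Let_def)

lemma monomial_parity_simps:
  "monomial_parity (Gen (Inl i)) = 0" "monomial_parity (Gen (Inr i)) = 1"
  "monomial_parity (Prod u v) = monomial_parity u + monomial_parity v"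
  by (simp_all add: monomial_parity_def del: add_bit_eq_xor)

lemma free_add_closed:
  assumes "x \<in> carrier (free_superalgebra r s)" "y \<in> carrier (free_superalgebra r s)"
  shows "(\<lambda>w. x w + y w) \<in> carrier (free_superalgebra r s)"
proof -
  have "finite {w. x w + y w \<noteq> 0}"
    by (rule finite_subset[of _ "{w. x w \<noteq> 0} \<union> {w. y w \<noteq> 0}"])
      (use assms in \<open>auto simp: free_carrier\<close>)
  moreover have "in_generators r s w" if "x w + y w \<noteq> 0" for w
    using assms that unfolding free_carrier by (cases "x w = 0") auto
  ultimately show ?thesis
    by (simp add: free_carrier)
qed

lemma free_smult_closed:
  assumes "x \<in> carrier (free_superalgebra r s)"
  shows "(\<lambda>w. c * x w) \<in> carrier (free_superalgebra r s)"
proof -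
  have "finite {w. c * x w \<noteq> 0}"
    by (rule finite_subset[of _ "{w. x w \<noteq> 0}"]) (use assms in \<open>auto simp: free_carrier\<close>)
  with assms show ?thesis
    by (simp add: free_carrier)
qed

lemma free_mult_support:
  fixes x y :: "'x monomial \<Rightarrow> 'f::field"
  shows "{w. (case w of Gen z \<Rightarrow> 0 | Prod u v \<Rightarrow> x u * y v) \<noteq> 0} =
    (\<lambda>(u, v). Prod u v) ` ({u. x u \<noteq> 0} \<times> {v. y v \<noteq> 0})"
proof (intro subset_antisym subsetI)
  fix w assume "w \<in> {w. (case w of Gen z \<Rightarrow> 0 | Prod u v \<Rightarrow> x u * y v) \<noteq> 0}"
  then show "w \<in> (\<lambda>(u, v). Prod u v) ` ({u. x u \<noteq> 0} \<times> {v. y v \<noteq> 0})"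
    by (cases w) auto
qed auto

lemma free_mult_closed:
  assumes "x \<in> carrier (free_superalgebra r s)" "y \<in> carrier (free_superalgebra r s)"
  shows "(\<lambda>w. case w of Gen z \<Rightarrow> 0 | Prod u v \<Rightarrow> x u * y v) \<in> carrier (free_superalgebra r s)"
proof -
  have "in_generators r s w" if "(case w of Gen z \<Rightarrow> 0 | Prod u v \<Rightarrow> x u * y v) \<noteq> 0" for w
    using assms that unfolding free_carrier by (cases w) auto
  with assms show ?thesis
    by (simp add: free_carrier free_mult_support)
qed

lemma free_is_nonassoc_algebra: "nonassoc_algebra (free_superalgebra r s)"
  by (rule nonassoc_algebraI)
    (auto simp: fun_eq_iff algebra_simps free_add_closed free_smult_closed free_mult_closed
      split: monomial.split, simp add: free_carrier)

interpretation free: nonassoc_algebra "free_superalgebra r s"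
  by (rule free_is_nonassoc_algebra)

lemma free_is_superalgebra: "superalgebra (free_superalgebra r s :: ('f::field, _) superalgebra)"
proof (intro superalgebra.intro superalgebra_axioms.intro free_is_nonassoc_algebra)
  let ?A = "free_superalgebra r s :: ('f, _) superalgebra"
  fix i j
  have sm: "c \<odot>\<^bsub>?A\<^esub> x \<in> homog ?A i" if "x \<in> homog ?A i" for c x
    using that by (auto simp: free_homog free_smult_closed)
  show "submodule (homog ?A i) ring_of_type_algebra ?A"
  proof (rule free.submoduleI)
    show "homog ?A i \<subseteq> carrier ?A"
      by (auto simp: free_homog)
    show "\<zero>\<^bsub>?A\<^esub> \<in> homog ?A i"
      by (simp add: free_homog free_carrier)
    show "\<And>c x. x \<in> homog ?A i \<Longrightarrow> c \<odot>\<^bsub>?A\<^esub> x \<in> homog ?A i"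
      by (rule sm)
    show "\<ominus>\<^bsub>?A\<^esub> x \<in> homog ?A i" if "x \<in> homog ?A i" for x
    proof -
      have "\<ominus>\<^bsub>?A\<^esub> x = (- 1) \<odot>\<^bsub>?A\<^esub> x"
        using that by (intro free.smult_uminus_1[symmetric]) (simp add: free_homog)
      then show ?thesis
        using sm[OF that, of "- 1"] by simp
    qed
    show "x \<oplus>\<^bsub>?A\<^esub> y \<in> homog ?A i" if xy: "x \<in> homog ?A i" "y \<in> homog ?A i" for x y
    proof -
      have "monomial_parity w = i" if "x w + y w \<noteq> 0" for w
        using xy that unfolding free_homog by (cases "x w = 0") auto
      with xy show ?thesis
        by (auto simp: free_homog free_add_closed)
    qed
  qed
  show "homog ?A 0 <+>\<^bsub>?A\<^esub> homog ?A 1 = carrier ?A"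
  proof (intro subset_antisym subsetI)
    fix x assume "x \<in> homog ?A 0 <+>\<^bsub>?A\<^esub> homog ?A 1"
    then show "x \<in> carrier ?A"
      unfolding set_add_def' by (auto simp: free_homog free_add_closed)
  next
    fix x assume x: "x \<in> carrier ?A"
    let ?x = "\<lambda>p w. if monomial_parity w = p then x w else 0"
    have "finite {w. ?x p w \<noteq> 0}" for p
      by (rule finite_subset[of _ "{w. x w \<noteq> 0}"]) (use x in \<open>auto simp: free_carrier\<close>)
    then have "?x p \<in> homog ?A p" for p
      using x by (auto simp: free_homog free_carrier split: if_splits)
    moreover have "x = ?x 0 \<oplus>\<^bsub>?A\<^esub> ?x 1"
      by auto
    ultimately show "x \<in> homog ?A 0 <+>\<^bsub>?A\<^esub> homog ?A 1"
      unfolding set_add_def' by blast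
  qed
  show "homog ?A 0 \<inter> homog ?A 1 = {\<zero>\<^bsub>?A\<^esub>}"
  proof (intro subset_antisym subsetI)
    fix x assume x: "x \<in> homog ?A 0 \<inter> homog ?A 1"
    have "x w = 0" for w
    proof (rule ccontr)
      assume "x w \<noteq> 0"
      with x have "monomial_parity w = 0" "monomial_parity w = 1"
        by (auto simp: free_homog)
      then show False
        by simp
    qed
    then show "x \<in> {\<zero>\<^bsub>?A\<^esub>}"
      by auto
  qed (auto simp: free_homog free_carrier)
  show "x \<otimes>\<^bsub>?A\<^esub> y \<in> homog ?A (i + j)" if xy: "x \<in> homog ?A i" "y \<in> homog ?A j" for x y
  proof -
    have "monomial_parity w = i + j" if "(case w of Gen z \<Rightarrow> 0 | Prod u v \<Rightarrow> x u * y v) \<noteq> 0" for w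
      using xy that unfolding free_homog
      by (cases w) (auto simp: monomial_parity_simps simp del: add_bit_eq_xor)
    with xy show ?thesis
      by (auto simp: free_homog free_mult_closed)
  qed
qed

definition basis_element :: "'x monomial \<Rightarrow> 'x monomial \<Rightarrow> 'f::field" where
  "basis_element w v = (if v = w then 1 else 0)"

lemma basis_element_support: "{v. basis_element w v \<noteq> (0 :: 'f::field)} = {w}"
  by (auto simp: basis_element_def)

lemma basis_element_homog:
  "in_generators r s w \<Longrightarrow> basis_element w \<in> homog (free_superalgebra r s) (monomial_parity w)"
  by (simp add: free_homog free_carrier basis_element_support) (simp add: basis_element_def)

text \<open>The map of the universal property: it sends generators to their images under
  \<open>g\<close> and is extended linearly from the basis of monomials.\<close>

definition evaluate ::
    "('f::field, 'a, 'm) module_scheme \<Rightarrow> ('x \<Rightarrow> 'a) \<Rightarrow> ('x monomial \<Rightarrow> 'f) \<Rightarrow> 'a" where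
  "evaluate M g h = (\<Oplus>\<^bsub>M\<^esub>w\<in>{w. h w \<noteq> 0}. h w \<odot>\<^bsub>M\<^esub> eval_monomial M g w)"

context nonassoc_algebra
begin

context
  fixes g :: "nat + nat \<Rightarrow> 'a" and r s
  assumes g: "\<And>x. x \<in> generators r s \<Longrightarrow> g x \<in> carrier A"
begin

lemma eval_generators: "in_generators r s w \<Longrightarrow> eval_monomial A g w \<in> carrier A"
  using g by (auto intro!: eval_monomial_closed)

lemma evaluate_closed: "h \<in> carrier (free_superalgebra r s) \<Longrightarrow> evaluate A g h \<in> carrier A"
  unfolding evaluate_def using eval_generators by (intro M.finsum_closed) (auto simp: free_carrier)

lemma functional_evaluate:
  assumes "h \<in> carrier (free_superalgebra r s)" "linear_functional A \<phi>"
    "finite W" "{w. h w \<noteq> 0} \<subseteq> W"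
  shows "\<phi> (evaluate A g h) = (\<Sum>w\<in>W. h w * \<phi> (eval_monomial A g w))"
proof -
  have "\<phi> (evaluate A g h) = (\<Sum>w\<in>{w. h w \<noteq> 0}. h w * \<phi> (eval_monomial A g w))"
    unfolding evaluate_def using assms(1) eval_generators
    by (subst functional_finsum[OF assms(2)]) (auto simp: free_carrier functional_smult[OF assms(2)])
  also have "\<dots> = (\<Sum>w\<in>W. h w * \<phi> (eval_monomial A g w))"
    using assms by (intro sum.mono_neutral_left) auto
  finally show ?thesis .
qed

lemma evaluate_basis_element:
  "in_generators r s w \<Longrightarrow> evaluate A g (basis_element w) = eval_monomial A g w"
  using eval_generators[of w] by (simp add: evaluate_def basis_element_support)
    (simp add: basis_element_def)

text \<open>Monomials factor uniquely, so the support of a product is in bijection with the pairs of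
  monomials from the two supports.\<close>

lemma evaluate_mult:
  assumes h: "h \<in> carrier (free_superalgebra r s)" and k: "k \<in> carrier (free_superalgebra r s)"
  shows "evaluate A g (h \<otimes>\<^bsub>free_superalgebra r s\<^esub> k) = evaluate A g h \<otimes> evaluate A g k"
proof (rule eq_by_functionals)
  let ?H = "{w. h w \<noteq> 0}" and ?K = "{w. k w \<noteq> 0}"
  have fin: "finite ?H" "finite ?K"
    using h k by (auto simp: free_carrier)
  fix \<phi> assume \<phi>: "linear_functional A \<phi>"
  have "\<phi> (evaluate A g h \<otimes> evaluate A g k) =
      (\<Sum>u\<in>?H. h u * \<phi> (eval_monomial A g u \<otimes> evaluate A g k))"
    by (rule functional_evaluate[OF h linear_functional_mult_right[OF \<phi> evaluate_closed[OF k]] fin(1)]) simp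
  also have "\<dots> = (\<Sum>u\<in>?H. h u * (\<Sum>v\<in>?K. k v * \<phi> (eval_monomial A g u \<otimes> eval_monomial A g v)))"
  proof (rule sum.cong)
    fix u assume "u \<in> ?H"
    then have "eval_monomial A g u \<in> carrier A"
      using h eval_generators by (auto simp: free_carrier)
    then show "h u * \<phi> (eval_monomial A g u \<otimes> evaluate A g k) =
        h u * (\<Sum>v\<in>?K. k v * \<phi> (eval_monomial A g u \<otimes> eval_monomial A g v))"
      using functional_evaluate[OF k linear_functional_mult_left[OF \<phi>] fin(2)] by simp
  qed simp
  also have "\<dots> = (\<Sum>(u, v)\<in>?H \<times> ?K. h u * k v * \<phi> (eval_monomial A g (Prod u v)))"
    by (simp add: sum_distrib_left sum.cartesian_product mult_ac)
  also have "\<dots> = (\<Sum>w\<in>(\<lambda>(u, v). Prod u v) ` (?H \<times> ?K).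
      (h \<otimes>\<^bsub>free_superalgebra r s\<^esub> k) w * \<phi> (eval_monomial A g w))"
    by (subst sum.reindex) (auto simp: inj_on_def intro!: sum.cong)
  also have "\<dots> = \<phi> (evaluate A g (h \<otimes>\<^bsub>free_superalgebra r s\<^esub> k))"
    using fin by (intro functional_evaluate[symmetric] \<phi>)
      (simp_all add: free_mult_closed h k free_mult_support)
  finally show "\<phi> (evaluate A g (h \<otimes>\<^bsub>free_superalgebra r s\<^esub> k)) =
      \<phi> (evaluate A g h \<otimes> evaluate A g k)" by simp
qed (use h k evaluate_closed in \<open>simp_all add: free_mult_closed\<close>)

lemma evaluate_hom: "algebra_hom (free_superalgebra r s) A (evaluate A g)"
  unfolding algebra_hom_def
proof (intro conjI ballI allI)
  fix h k :: "(nat + nat) monomial \<Rightarrow> 'f" and c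
  assume h: "h \<in> carrier (free_superalgebra r s)"
  then show "evaluate A g h \<in> carrier A"
    by (rule evaluate_closed)
  have fin: "finite {w. h w \<noteq> 0}"
    using h by (simp add: free_carrier)
  show "evaluate A g (c \<odot>\<^bsub>free_superalgebra r s\<^esub> h) = c \<odot>\<^bsub>A\<^esub> evaluate A g h"
  proof (rule eq_by_functionals)
    fix \<phi> assume \<phi>: "linear_functional A \<phi>"
    show "\<phi> (evaluate A g (c \<odot>\<^bsub>free_superalgebra r s\<^esub> h)) = \<phi> (c \<odot>\<^bsub>A\<^esub> evaluate A g h)"
      using functional_evaluate[OF free_smult_closed[OF h] \<phi> fin, of c]
        functional_evaluate[OF h \<phi> fin] functional_smult[OF \<phi> evaluate_closed[OF h], of c]
      by (auto simp: sum_distrib_left mult.assoc)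
  qed (simp_all add: evaluate_closed h free_smult_closed)
  assume k: "k \<in> carrier (free_superalgebra r s)"
  show "evaluate A g (h \<otimes>\<^bsub>free_superalgebra r s\<^esub> k) = evaluate A g h \<otimes> evaluate A g k"
    by (rule evaluate_mult[OF h k])
  show "evaluate A g (h \<oplus>\<^bsub>free_superalgebra r s\<^esub> k) = evaluate A g h \<oplus> evaluate A g k"
  proof (rule eq_by_functionals)
    let ?W = "{w. h w \<noteq> 0} \<union> {w. k w \<noteq> 0}"
    have W: "finite ?W"
      using h k by (simp add: free_carrier)
    fix \<phi> assume \<phi>: "linear_functional A \<phi>"
    have "\<phi> (evaluate A g (\<lambda>w. h w + k w)) = (\<Sum>w\<in>?W. (h w + k w) * \<phi> (eval_monomial A g w))"
      by (rule functional_evaluate[OF free_add_closed[OF h k] \<phi> W]) auto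
    then show "\<phi> (evaluate A g (h \<oplus>\<^bsub>free_superalgebra r s\<^esub> k)) = \<phi> (evaluate A g h \<oplus> evaluate A g k)"
      using functional_evaluate[OF h \<phi> W] functional_evaluate[OF k \<phi> W]
      by (simp add: functional_add[OF \<phi>] evaluate_closed h k ring_distribs sum.distrib)
  qed (simp_all add: evaluate_closed h k free_add_closed)
qed

end

end

lemma associator_hom:
  assumes A: "nonassoc_algebra A" and Q: "nonassoc_algebra Q" and h: "algebra_hom A Q h"
    and xyz: "x \<in> carrier A" "y \<in> carrier A" "z \<in> carrier A"
  shows "associator Q (h x) (h y) (h z) = h (associator A x y z)"
proof (rule nonassoc_algebra.eq_by_functionals[OF Q])
  interpret A: nonassoc_algebra A by (rule A)
  interpret Q: nonassoc_algebra Q by (rule Q)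
  have hc: "h x \<in> carrier Q" if "x \<in> carrier A" for x
    using h that by (simp add: algebra_hom_def)
  have hm: "h (x \<otimes>\<^bsub>A\<^esub> y) = h x \<otimes>\<^bsub>Q\<^esub> h y" if "x \<in> carrier A" "y \<in> carrier A" for x y
    using h that by (simp add: algebra_hom_def)
  show "associator Q (h x) (h y) (h z) \<in> carrier Q" "h (associator A x y z) \<in> carrier Q"
    using xyz by (simp_all add: hc)
  fix \<phi> assume \<phi>: "linear_functional Q \<phi>"
  show "\<phi> (associator Q (h x) (h y) (h z)) = \<phi> (h (associator A x y z))"
    using xyz A.functional_minus[OF linear_functional_hom[OF h \<phi>]]
    by (simp add: associator_def Q.functional_minus[OF \<phi>] hc hm)
qed

section \<open>Relatively free superalgebras\<close>

text \<open>The expressions in the laws, formed in \<open>A\<close>, are sent to zero by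
  \<open>h\<close> and therefore lie in \<open>J\<close>.\<close>

lemma super_laws_quotient:
  fixes A :: "('f::field, 'a) superalgebra" and M :: "('f, 'b, 'm) superalgebra_scheme"
  assumes A: "superalgebra A" and J: "graded_ideal J A" and M: "super_laws M"
    and h: "algebra_hom A M h" and hom: "\<And>x i. x \<in> homog A i \<Longrightarrow> h x \<in> homog M i"
    and ker: "\<And>x. x \<in> carrier A \<Longrightarrow> h x = \<zero>\<^bsub>M\<^esub> \<Longrightarrow> x \<in> J"
  shows "super_laws (quotient_superalgebra A J)"
proof -
  let ?Q = "quotient_superalgebra A J" and ?q = "\<lambda>a. J +>\<^bsub>A\<^esub> a"
  interpret A: superalgebra A by (rule A)
  interpret Q: superalgebra ?Q by (rule quotient_is_superalgebra[OF A J])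
  interpret M: superalgebra M using M by (simp add: super_laws_def)
  note qh = quotient_hom[OF A J] and qs = quotient_simps[OF A J]
  have zero: "?q x = \<zero>\<^bsub>?Q\<^esub>" if "x \<in> carrier A" "h x = \<zero>\<^bsub>M\<^esub>" for x
    using ker that quotient_zero_iff[OF A J] by blast
  have law: "associator ?Q (?q x) (?q y) (?q z) \<oplus>\<^bsub>?Q\<^esub> c \<odot>\<^bsub>?Q\<^esub> associator ?Q (?q x') (?q y') (?q z') = \<zero>\<^bsub>?Q\<^esub>"
    if "x \<in> carrier A" "y \<in> carrier A" "z \<in> carrier A" "x' \<in> carrier A" "y' \<in> carrier A" "z' \<in> carrier A"
      "associator M (h x) (h y) (h z) \<oplus>\<^bsub>M\<^esub> c \<odot>\<^bsub>M\<^esub> associator M (h x') (h y') (h z') = \<zero>\<^bsub>M\<^esub>" for x y z x' y' z' c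
  proof -
    have "h (associator A x y z \<oplus>\<^bsub>A\<^esub> c \<odot>\<^bsub>A\<^esub> associator A x' y' z') = \<zero>\<^bsub>M\<^esub>"
      using that h associator_hom[OF A.nonassoc_algebra_axioms M.nonassoc_algebra_axioms h]
      by (simp add: algebra_hom_def)
    then have "?q (associator A x y z \<oplus>\<^bsub>A\<^esub> c \<odot>\<^bsub>A\<^esub> associator A x' y' z') = \<zero>\<^bsub>?Q\<^esub>"
      using that by (intro zero) auto
    then show ?thesis
      using that associator_hom[OF A.nonassoc_algebra_axioms Q.nonassoc_algebra_axioms qh]
      by (simp add: qs)
  qed
  have laws: "associator M (h x) (h y) (h z) \<oplus>\<^bsub>M\<^esub> super_sign i j \<odot>\<^bsub>M\<^esub> associator M (h y) (h x) (h z) = \<zero>\<^bsub>M\<^esub>"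
    "associator M (h x) (h y) (h z) \<oplus>\<^bsub>M\<^esub> super_sign j k \<odot>\<^bsub>M\<^esub> associator M (h x) (h z) (h y) = \<zero>\<^bsub>M\<^esub>"
    if "x \<in> homog A i" "y \<in> homog A j" "z \<in> homog A k" for x y z i j k
    using M that[THEN hom] unfolding super_laws_def by blast+
  have metab: "(?q x \<otimes>\<^bsub>?Q\<^esub> ?q y) \<otimes>\<^bsub>?Q\<^esub> (?q z \<otimes>\<^bsub>?Q\<^esub> ?q t) = \<zero>\<^bsub>?Q\<^esub>"
    if xyzt: "x \<in> carrier A" "y \<in> carrier A" "z \<in> carrier A" "t \<in> carrier A" for x y z t
  proof -
    have "(h x \<otimes>\<^bsub>M\<^esub> h y) \<otimes>\<^bsub>M\<^esub> (h z \<otimes>\<^bsub>M\<^esub> h t) = \<zero>\<^bsub>M\<^esub>"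
      using M h xyzt by (simp add: super_laws_def algebra_hom_def)
    then have "h ((x \<otimes>\<^bsub>A\<^esub> y) \<otimes>\<^bsub>A\<^esub> (z \<otimes>\<^bsub>A\<^esub> t)) = \<zero>\<^bsub>M\<^esub>"
      using h xyzt by (simp add: algebra_hom_def)
    then show ?thesis
      using zero[of "(x \<otimes>\<^bsub>A\<^esub> y) \<otimes>\<^bsub>A\<^esub> (z \<otimes>\<^bsub>A\<^esub> t)"] xyzt by (simp add: qs)
  qed
  show ?thesis
    unfolding super_laws_def
  proof (intro conjI allI ballI)
    fix i j k x y z
    assume "x \<in> homog ?Q i" "y \<in> homog ?Q j" "z \<in> homog ?Q k"
    then obtain a b c where abc: "a \<in> homog A i" "b \<in> homog A j" "c \<in> homog A k"
      and xyz: "x = ?q a" "y = ?q b" "z = ?q c"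
      by (auto simp: qs)
    show "associator ?Q x y z \<oplus>\<^bsub>?Q\<^esub> super_sign i j \<odot>\<^bsub>?Q\<^esub> associator ?Q y x z = \<zero>\<^bsub>?Q\<^esub>"
      unfolding xyz by (intro law laws(1)[OF abc] abc[THEN A.homog_carrier])
    show "associator ?Q x y z \<oplus>\<^bsub>?Q\<^esub> super_sign j k \<odot>\<^bsub>?Q\<^esub> associator ?Q x z y = \<zero>\<^bsub>?Q\<^esub>"
      unfolding xyz by (intro law laws(2)[OF abc] abc[THEN A.homog_carrier])
  next
    show "superalgebra ?Q"
      by (rule quotient_is_superalgebra[OF A J])
  next
    fix x y z t
    assume "x \<in> carrier ?Q" "y \<in> carrier ?Q" "z \<in> carrier ?Q" "t \<in> carrier ?Q"
    then show "(x \<otimes>\<^bsub>?Q\<^esub> y) \<otimes>\<^bsub>?Q\<^esub> (z \<otimes>\<^bsub>?Q\<^esub> t) = \<zero>\<^bsub>?Q\<^esub>"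
      using metab by (auto simp: qs(1))
  qed
qed

lemma superalgebra_kernel_graded_ideal:
  fixes A :: "('f::field, 'a) superalgebra" and M :: "('f, 'b, 'm) superalgebra_scheme"
  assumes A: "superalgebra A" and M: "superalgebra M"
    and h: "algebra_hom A M h" and hom: "\<And>x i. x \<in> homog A i \<Longrightarrow> h x \<in> homog M i"
  shows "graded_ideal {x \<in> carrier A. h x = \<zero>\<^bsub>M\<^esub>} A" (is "graded_ideal ?J A")
proof -
  interpret A: superalgebra A by (rule A)
  interpret M: superalgebra M by (rule M)
  have h0: "h \<zero>\<^bsub>A\<^esub> = \<zero>\<^bsub>M\<^esub>"
    using h A.smult_0[of "\<zero>\<^bsub>A\<^esub>"] by (metis A.zero_closed M.smult_0 algebra_hom_def)
  have sm: "c \<odot>\<^bsub>A\<^esub> x \<in> ?J" if "x \<in> ?J" for c x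
    using that h by (auto simp: algebra_hom_def)
  have "submodule ?J (ring_of_type_algebra :: 'f ring) A"
  proof (rule A.submoduleI)
    show "\<ominus>\<^bsub>A\<^esub> x \<in> ?J" if "x \<in> ?J" for x
      using sm[OF that, of "- 1"] that by (simp add: A.smult_uminus_1)
  qed (use h h0 sm in \<open>auto simp: algebra_hom_def\<close>)
  moreover have "a \<otimes>\<^bsub>A\<^esub> x \<in> ?J" "x \<otimes>\<^bsub>A\<^esub> a \<in> ?J" if "a \<in> carrier A" "x \<in> ?J" for a x
    using that h by (auto simp: algebra_hom_def)
  moreover have "?J = (?J \<inter> homog A 0) <+>\<^bsub>A\<^esub> (?J \<inter> homog A 1)"
  proof (intro subset_antisym subsetI)
    fix x assume x: "x \<in> ?J"
    then obtain y z where yz: "y \<in> homog A 0" "z \<in> homog A 1" "x = y \<oplus>\<^bsub>A\<^esub> z"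
      using A.homog_decompose by blast
    then have "h y \<oplus>\<^bsub>M\<^esub> h z = \<zero>\<^bsub>M\<^esub> \<oplus>\<^bsub>M\<^esub> \<zero>\<^bsub>M\<^esub>"
      using x h by (simp add: algebra_hom_def A.homog_carrier)
    then have "h y = \<zero>\<^bsub>M\<^esub>" "h z = \<zero>\<^bsub>M\<^esub>"
      using M.homog_unique[of "h y" "h z" "\<zero>\<^bsub>M\<^esub>" "\<zero>\<^bsub>M\<^esub>"] yz hom by auto
    with yz have "y \<in> ?J \<inter> homog A 0" "z \<in> ?J \<inter> homog A 1"
      by (auto simp: A.homog_carrier)
    with yz show "x \<in> (?J \<inter> homog A 0) <+>\<^bsub>A\<^esub> (?J \<inter> homog A 1)"
      unfolding set_add_def' by blast
  next
    fix x assume "x \<in> (?J \<inter> homog A 0) <+>\<^bsub>A\<^esub> (?J \<inter> homog A 1)"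
    then show "x \<in> ?J"
      unfolding set_add_def' using h by (auto simp: algebra_hom_def)
  qed
  ultimately show ?thesis
    by (simp add: graded_ideal_def)
qed

lemma graded_ideal_Inter:
  fixes A :: "('f::field, 'a) superalgebra"
  assumes A: "superalgebra A" and F: "F \<noteq> {}" "\<And>J. J \<in> F \<Longrightarrow> graded_ideal J A"
  shows "graded_ideal (\<Inter>F) A"
proof -
  interpret A: superalgebra A by (rule A)
  note sub = graded_ideal_submodule[OF A F(2)]
  have "submodule (\<Inter>F) (ring_of_type_algebra :: 'f ring) A"
  proof (rule A.submoduleI)
    show "\<Inter>F \<subseteq> carrier A"
      using F(1) A.submodule_carrier[OF sub] by blast
  qed (use A.submodule_zero[OF sub] A.submodule_add[OF sub] A.submodule_uminus[OF sub]
      A.submodule_smult[OF sub] in auto)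
  moreover have "a \<otimes>\<^bsub>A\<^esub> x \<in> \<Inter>F" "x \<otimes>\<^bsub>A\<^esub> a \<in> \<Inter>F" if "a \<in> carrier A" "x \<in> \<Inter>F" for a x
    using that graded_ideal_mult[OF A F(2)] by auto
  moreover have "\<Inter>F = (\<Inter>F \<inter> homog A 0) <+>\<^bsub>A\<^esub> (\<Inter>F \<inter> homog A 1)"
  proof (intro subset_antisym subsetI)
    fix x assume x: "x \<in> \<Inter>F"
    moreover from x F(1) have "x \<in> carrier A"
      using A.submodule_carrier[OF sub] by blast
    then obtain y z where yz: "y \<in> homog A 0" "z \<in> homog A 1" "x = y \<oplus>\<^bsub>A\<^esub> z"
      using A.homog_decompose by blast
    ultimately have "y \<in> \<Inter>F" "z \<in> \<Inter>F"
      using graded_ideal_components[OF A F(2) yz(1,2)] by auto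
    with yz show "x \<in> (\<Inter>F \<inter> homog A 0) <+>\<^bsub>A\<^esub> (\<Inter>F \<inter> homog A 1)"
      unfolding set_add_def' by auto
  next
    fix x assume "x \<in> (\<Inter>F \<inter> homog A 0) <+>\<^bsub>A\<^esub> (\<Inter>F \<inter> homog A 1)"
    then show "x \<in> \<Inter>F"
      unfolding set_add_def' using A.submodule_add[OF sub] by auto
  qed
  ultimately show ?thesis
    by (simp add: graded_ideal_def)
qed

definition alt_metabelian_ideals ::
    "nat \<Rightarrow> nat \<Rightarrow> ((nat + nat) monomial \<Rightarrow> 'f::field) set set" where
  "alt_metabelian_ideals r s = {J. graded_ideal J (free_superalgebra r s) \<and>
    alt_metabelian_superalgebra (quotient_superalgebra (free_superalgebra r s) J)}"

definition homogeneous_images ::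
    "('f::field, 'a, 'm) superalgebra_scheme \<Rightarrow> nat \<Rightarrow> nat \<Rightarrow> (nat + nat \<Rightarrow> 'a) \<Rightarrow> bool" where
  "homogeneous_images M r s g \<longleftrightarrow> (\<forall>i<r. g (Inl i) \<in> homog M 0) \<and> (\<forall>i<s. g (Inr i) \<in> homog M 1)"

lemma (in superalgebra) homogeneous_images_carrier:
  "homogeneous_images A r s g \<Longrightarrow> x \<in> generators r s \<Longrightarrow> g x \<in> carrier A"
  by (auto simp: homogeneous_images_def generators_def homog_carrier)

lemma (in superalgebra) evaluate_homog:
  assumes g: "homogeneous_images A r s g" and h: "h \<in> homog (free_superalgebra r s) p"
  shows "evaluate A g h \<in> homog A p"
proof -
  have "eval_monomial A g w \<in> homog A p" if "h w \<noteq> 0" for w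
  proof -
    have "eval_monomial A g w \<in> homog A (\<Sum>x\<leftarrow>letters w. case x of Inl _ \<Rightarrow> 0 | Inr _ \<Rightarrow> 1)"
    proof (rule eval_monomial_homog)
      fix x assume "x \<in> set (letters w)"
      then have "x \<in> generators r s"
        using h that by (auto simp: free_homog free_carrier)
      then show "g x \<in> homog A (case x of Inl _ \<Rightarrow> 0 | Inr _ \<Rightarrow> 1)"
        using g by (auto simp: homogeneous_images_def generators_def)
    qed
    then show ?thesis
      using h that by (simp add: free_homog monomial_parity_def)
  qed
  then show ?thesis
    unfolding evaluate_def by (intro homog_finsum homog_smult) auto
qed

text \<open>Freeness in the form that is used later: every evaluation in a superalgebra with the
  laws vanishes on \<open>alt_metabelian_ideal\<close>, so such evaluations refute superidentities
  of the free superalgebra.\<close>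

lemma evaluation_kernel:
  fixes M :: "('f::field_char_0, 'a, 'm) superalgebra_scheme"
  assumes M: "super_laws M" and g: "homogeneous_images M r s g"
  shows "{h \<in> carrier (free_superalgebra r s). evaluate M g h = \<zero>\<^bsub>M\<^esub>} \<in> alt_metabelian_ideals r s"
proof -
  interpret M: superalgebra M using M by (simp add: super_laws_def)
  note gc = M.homogeneous_images_carrier[OF g]
  note h = M.evaluate_hom[OF gc]
  note J = superalgebra_kernel_graded_ideal[OF free_is_superalgebra M.superalgebra_axioms h
      M.evaluate_homog[OF g]]
  have "super_laws (quotient_superalgebra (free_superalgebra r s)
      {h \<in> carrier (free_superalgebra r s). evaluate M g h = \<zero>\<^bsub>M\<^esub>})"
    by (rule super_laws_quotient[OF free_is_superalgebra J M h M.evaluate_homog[OF g]]) auto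
  then show ?thesis
    using J super_laws_imp_alt_metabelian by (simp add: alt_metabelian_ideals_def)
qed

definition identities :: "nat \<Rightarrow> nat \<Rightarrow> nat \<Rightarrow> (nat monomial \<Rightarrow> 'f::field) \<Rightarrow> bool" where
  "identities r s n f \<longleftrightarrow> multilinear_polynomial n f \<and>
    satisfies_superidentity (free_alt_metabelian_superalgebra r s) n f"

text \<open>An intersection over an empty family would be the whole type. That the family is
  inhabited is shown later by sending all generators to zero.\<close>

lemma alt_metabelian_ideal_graded:
  assumes "alt_metabelian_ideals r s \<noteq> ({} :: ((nat + nat) monomial \<Rightarrow> 'f::field) set set)"
  shows "graded_ideal (alt_metabelian_ideal r s :: (_ \<Rightarrow> 'f) set) (free_superalgebra r s)"
  unfolding alt_metabelian_ideal_def using assms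
  by (intro graded_ideal_Inter free_is_superalgebra) (auto simp: alt_metabelian_ideals_def)

section \<open>Three superalgebras\<close>

lemma superalgebraI:
  fixes A :: "('f::field, 'a, 'm) superalgebra_scheme" (structure)
  assumes "nonassoc_algebra A"
    and car: "\<And>i x. x \<in> homog A i \<Longrightarrow> x \<in> carrier A" and zero: "\<And>i. \<zero> \<in> homog A i"
    and add: "\<And>i x y. x \<in> homog A i \<Longrightarrow> y \<in> homog A i \<Longrightarrow> x \<oplus> y \<in> homog A i"
    and smult: "\<And>i c x. x \<in> homog A i \<Longrightarrow> c \<odot>\<^bsub>A\<^esub> x \<in> homog A i"
    and dec: "\<And>x. x \<in> carrier A \<Longrightarrow> \<exists>y\<in>homog A 0. \<exists>z\<in>homog A 1. x = y \<oplus> z"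
    and disj: "\<And>x. x \<in> homog A 0 \<Longrightarrow> x \<in> homog A 1 \<Longrightarrow> x = \<zero>"
    and mult: "\<And>i j x y. x \<in> homog A i \<Longrightarrow> y \<in> homog A j \<Longrightarrow> x \<otimes> y \<in> homog A (i + j)"
  shows "superalgebra A"
proof (intro superalgebra.intro superalgebra_axioms.intro assms)
  interpret nonassoc_algebra A by fact
  fix i j
  show "submodule (homog A i) ring_of_type_algebra A"
  proof (rule submoduleI)
    show "\<ominus> x \<in> homog A i" if "x \<in> homog A i" for x
      using smult[OF that, of "- 1"] car[OF that] by (simp add: smult_uminus_1)
  qed (use car zero add smult in auto)
  show "homog A 0 <+>\<^bsub>A\<^esub> homog A 1 = carrier A"
    unfolding set_add_def' using dec car by fastforce
  show "homog A 0 \<inter> homog A 1 = {\<zero>}"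
    using disj zero by auto
qed

lemma associative_super_laws:
  fixes A :: "('f::field, 'a, 'm) superalgebra_scheme" (structure)
  assumes A: "superalgebra A"
    and assoc: "\<And>x y z. \<lbrakk>x \<in> carrier A; y \<in> carrier A; z \<in> carrier A\<rbrakk> \<Longrightarrow> (x \<otimes> y) \<otimes> z = x \<otimes> (y \<otimes> z)"
    and metab: "\<And>x y z t. \<lbrakk>x \<in> carrier A; y \<in> carrier A; z \<in> carrier A; t \<in> carrier A\<rbrakk> \<Longrightarrow>
      (x \<otimes> y) \<otimes> (z \<otimes> t) = \<zero>"
  shows "super_laws A"
proof -
  interpret superalgebra A by (rule A)
  have "associator A x y z = \<zero>" if "x \<in> carrier A" "y \<in> carrier A" "z \<in> carrier A" for x y z
    using that by (simp add: associator_def assoc a_minus_def M.r_neg)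
  then show ?thesis
    using A metab by (simp add: super_laws_def homog_carrier)
qed

text \<open>The strictly upper triangular \<open>4 \<times> 4\<close> matrices with the entries \<open>12\<close>, \<open>23\<close>, \<open>34\<close>,
  \<open>13\<close>, \<open>24\<close>, \<open>14\<close>, graded by the distance from the diagonal or purely even.\<close>

type_synonym 'f triangular = "'f \<times> 'f \<times> 'f \<times> 'f \<times> 'f \<times> 'f"

definition triangular_algebra :: "bool \<Rightarrow> ('f::field, 'f triangular) superalgebra" where
  "triangular_algebra graded = \<lparr>carrier = UNIV,
    monoid.mult = (\<lambda>(a, b, c, d, e, g) (a', b', c', d', e', g').
      (0, 0, 0, a * b', b * c', a * e' + d * c')),
    one = undefined, ring.zero = (0, 0, 0, 0, 0, 0),
    add = (\<lambda>(a, b, c, d, e, g) (a', b', c', d', e', g').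
      (a + a', b + b', c + c', d + d', e + e', g + g')),
    module.smult = (\<lambda>k (a, b, c, d, e, g). (k * a, k * b, k * c, k * d, k * e, k * g)),
    homog = (\<lambda>p. if graded
      then (if p = 0 then {(a, b, c, d, e, g). a = 0 \<and> b = 0 \<and> c = 0 \<and> g = 0}
        else {(a, b, c, d, e, g). d = 0 \<and> e = 0})
      else (if p = 0 then UNIV else {(0, 0, 0, 0, 0, 0)}))\<rparr>"

lemma triangular_simps [simp]:
  "carrier (triangular_algebra q) = UNIV"
  "ring.zero (triangular_algebra q) = (0, 0, 0, 0, 0, 0)"
  "(a, b, c, d, e, g) \<otimes>\<^bsub>triangular_algebra q\<^esub> (a', b', c', d', e', g') =
    (0, 0, 0, a * b', b * c', a * e' + d * c')"
  "(a, b, c, d, e, g) \<oplus>\<^bsub>triangular_algebra q\<^esub> (a', b', c', d', e', g') =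
    (a + a', b + b', c + c', d + d', e + e', g + g')"
  "k \<odot>\<^bsub>triangular_algebra q\<^esub> (a, b, c, d, e, g) = (k * a, k * b, k * c, k * d, k * e, k * g)"
  by (simp_all add: triangular_algebra_def)

lemma triangular_homog:
  "(a, b, c, d, e, g) \<in> homog (triangular_algebra True) p \<longleftrightarrow>
    (if p = 0 then a = 0 \<and> b = 0 \<and> c = 0 \<and> g = 0 else d = 0 \<and> e = 0)"
  "x \<in> homog (triangular_algebra False) p \<longleftrightarrow> p = 0 \<or> x = (0, 0, 0, 0, 0, 0)"
  by (auto simp: triangular_algebra_def)

lemma triangular_nonassoc_algebra: "nonassoc_algebra (triangular_algebra q)"
  by (rule nonassoc_algebraI) (auto simp: algebra_simps)

lemma triangular_superalgebra: "superalgebra (triangular_algebra q)"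
proof (rule superalgebraI[OF triangular_nonassoc_algebra]; cases q)
  fix x :: "'a triangular"
  obtain a b c d e g where x: "x = (a, b, c, d, e, g)"
    by (cases x) auto
  assume q
  then show "\<exists>y\<in>homog (triangular_algebra q) 0. \<exists>z\<in>homog (triangular_algebra q) 1.
      x = y \<oplus>\<^bsub>triangular_algebra q\<^esub> z"
    unfolding x by (intro bexI[of _ "(0, 0, 0, d, e, 0)"] bexI[of _ "(a, b, c, 0, 0, g)"])
      (simp_all add: triangular_homog)
next
  fix x :: "'a triangular"
  obtain a b c d e g where x: "x = (a, b, c, d, e, g)"
    by (cases x) auto
  assume "\<not> q"
  then show "\<exists>y\<in>homog (triangular_algebra q) 0. \<exists>z\<in>homog (triangular_algebra q) 1.
      x = y \<oplus>\<^bsub>triangular_algebra q\<^esub> z"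
    unfolding x by (intro bexI[of _ "(a, b, c, d, e, g)"] bexI[of _ "(0, 0, 0, 0, 0, 0)"])
      (simp_all add: triangular_homog)
qed (auto simp: triangular_homog split: if_splits)

lemma triangular_super_laws: "super_laws (triangular_algebra q)"
  by (rule associative_super_laws[OF triangular_superalgebra]) auto

text \<open>A superalgebra generated by one odd element \<open>x\<close>: a triple \<open>(c, u, v)\<close> stands for
  \<open>c x + \<Sum>\<^sub>m e\<^sub>m (u\<^sub>m + v\<^sub>m \<tau>)\<close>, where \<open>e\<^sub>0 = x\<^sup>2\<close>, \<open>e\<^sub>m k x = e\<^bsub>m+1\<^esub> k\<close> and
  \<open>x e\<^sub>m k = e\<^bsub>m+1\<^esub> (twist m k)\<close>. Infinite sums are allowed.\<close>

type_synonym 'f chain_element = "'f \<times> (nat \<Rightarrow> 'f) \<times> (nat \<Rightarrow> 'f)"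

definition chain_algebra :: "('f::field, 'f chain_element) superalgebra" where
  "chain_algebra = \<lparr>carrier = UNIV,
    monoid.mult = (\<lambda>(c, u, v) (c', u', v').
      (0, \<lambda>m. case m of 0 \<Rightarrow> c * c' | Suc m \<Rightarrow> u m * c' + c * fst (twist m (u' m, v' m)),
        \<lambda>m. case m of 0 \<Rightarrow> 0 | Suc m \<Rightarrow> v m * c' + c * snd (twist m (u' m, v' m)))),
    one = undefined, ring.zero = (0, \<lambda>_. 0, \<lambda>_. 0),
    add = (\<lambda>(c, u, v) (c', u', v'). (c + c', \<lambda>m. u m + u' m, \<lambda>m. v m + v' m)),
    module.smult = (\<lambda>k (c, u, v). (k * c, \<lambda>m. k * u m, \<lambda>m. k * v m)),
    homog = (\<lambda>p. {(c, u, v). (p = 0 \<longrightarrow> c = 0) \<and>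
      (\<forall>m. even m \<noteq> (p = 0) \<longrightarrow> u m = 0 \<and> v m = 0)})\<rparr>"

lemma chain_simps [simp]:
  "carrier chain_algebra = UNIV"
  "ring.zero chain_algebra = (0, \<lambda>_. 0, \<lambda>_. 0)"
  "(c, u, v) \<otimes>\<^bsub>chain_algebra\<^esub> (c', u', v') =
    (0, \<lambda>m. case m of 0 \<Rightarrow> c * c' | Suc m \<Rightarrow> u m * c' + c * fst (twist m (u' m, v' m)),
      \<lambda>m. case m of 0 \<Rightarrow> 0 | Suc m \<Rightarrow> v m * c' + c * snd (twist m (u' m, v' m)))"
  "(c, u, v) \<oplus>\<^bsub>chain_algebra\<^esub> (c', u', v') = (c + c', \<lambda>m. u m + u' m, \<lambda>m. v m + v' m)"
  "k \<odot>\<^bsub>chain_algebra\<^esub> (c, u, v) = (k * c, \<lambda>m. k * u m, \<lambda>m. k * v m)"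
  "(c, u, v) \<in> homog chain_algebra p \<longleftrightarrow>
    (p = 0 \<longrightarrow> c = 0) \<and> (\<forall>m. even m \<noteq> (p = 0) \<longrightarrow> u m = 0 \<and> v m = 0)"
  by (simp_all add: chain_algebra_def)

lemma chain_nonassoc_algebra: "nonassoc_algebra chain_algebra"
  by (rule nonassoc_algebraI)
    (auto simp: fun_eq_iff algebra_simps twist_def split: nat.split)

lemma chain_superalgebra: "superalgebra chain_algebra"
proof (rule superalgebraI[OF chain_nonassoc_algebra])
  fix x :: "'a chain_element"
  obtain c u v where x: "x = (c, u, v)"
    by (cases x) auto
  let ?f = "\<lambda>b w m. if even m = b then w m else (0 :: 'a)"
  show "\<exists>y\<in>homog chain_algebra 0. \<exists>z\<in>homog chain_algebra 1. x = y \<oplus>\<^bsub>chain_algebra\<^esub> z"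
    unfolding x
    by (intro bexI[of _ "(0, ?f True u, ?f True v)"] bexI[of _ "(c, ?f False u, ?f False v)"])
      (auto simp: fun_eq_iff)
next
  fix x :: "'a chain_element" assume "x \<in> homog chain_algebra 0" "x \<in> homog chain_algebra 1"
  then show "x = \<zero>\<^bsub>chain_algebra\<^esub>"
    by (cases x) (auto simp: fun_eq_iff)
next
  fix i j and x y :: "'a chain_element"
  assume "x \<in> homog chain_algebra i" "y \<in> homog chain_algebra j"
  then show "x \<otimes>\<^bsub>chain_algebra\<^esub> y \<in> homog chain_algebra (i + j)"
    by (cases x; cases y; cases i; cases j) (auto simp: twist_def split: nat.split)
qed auto

text \<open>For the generator \<open>x\<close> and \<open>v = e_m k\<close> the associators
  \<open>(x, x, v)\<close>, \<open>(x, v, x)\<close>, \<open>(v, x, x)\<close> are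
  \<open>e_(m+2)\<close> with the coefficients \<open>k\<close>, \<open>- (- 1)^m k\<close>,
  \<open>k\<close>, because \<open>\<lambda>_(m+1) \<lambda>_m = - 1\<close> and
  \<open>\<lambda>_(m+1) - \<lambda>_m = (- 1)^m\<close>. As \<open>v\<close> has the parity of
  \<open>m\<close>, these are the required signs. Associators with two arguments in the square
  vanish.\<close>

lemma chain_super_laws: "super_laws chain_algebra"
  unfolding super_laws_def
proof (intro conjI allI ballI)
  interpret superalgebra chain_algebra
    by (rule chain_superalgebra)
  fix i j k and x y z :: "'a chain_element"
  assume "x \<in> homog chain_algebra i" "y \<in> homog chain_algebra j" "z \<in> homog chain_algebra k"
  moreover obtain a b c u v w u' v' w' where "x = (a, u, u')" "y = (b, v, v')" "z = (c, w, w')"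
    by (cases x; cases y; cases z) auto
  ultimately show "associator chain_algebra x y z \<oplus>\<^bsub>chain_algebra\<^esub>
      super_sign i j \<odot>\<^bsub>chain_algebra\<^esub> associator chain_algebra y x z = \<zero>\<^bsub>chain_algebra\<^esub>"
    "associator chain_algebra x y z \<oplus>\<^bsub>chain_algebra\<^esub>
      super_sign j k \<odot>\<^bsub>chain_algebra\<^esub> associator chain_algebra x z y = \<zero>\<^bsub>chain_algebra\<^esub>"
    by (cases i; cases j; cases k;
        auto simp: associator_def a_minus_def smult_uminus_1[symmetric] fun_eq_iff twist_def
          super_sign_def algebra_simps split: nat.split)+
qed (use chain_superalgebra in \<open>auto simp: fun_eq_iff twist_def split: nat.split\<close>)

definition chain_generator :: "'f::field chain_element" where
  "chain_generator = (1, \<lambda>_. 0, \<lambda>_. 0)"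

definition chain_word :: "nat \<Rightarrow> 'f::field \<times> 'f \<Rightarrow> 'f chain_element" where
  "chain_word m k = (0, \<lambda>i. if i = m then fst k else 0, \<lambda>i. if i = m then snd k else 0)"

text \<open>In the last two equations \<open>m'\<close> is arbitrary, since
  \<open>chain_word m' (0, 0)\<close> is zero for all \<open>m'\<close>; it is chosen to fit the
  index expected in \<open>eval_chain_marked\<close>.\<close>

lemma chain_word_products:
  "chain_generator \<otimes>\<^bsub>chain_algebra\<^esub> chain_generator = chain_word 0 (1, 0)"
  "chain_word m k \<otimes>\<^bsub>chain_algebra\<^esub> chain_generator = chain_word (Suc m) k"
  "chain_generator \<otimes>\<^bsub>chain_algebra\<^esub> chain_word m k = chain_word (Suc m) (twist m k)"
  "fst x = 0 \<Longrightarrow> chain_word m k \<otimes>\<^bsub>chain_algebra\<^esub> x = chain_word m' (0, 0)"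
  "fst x = 0 \<Longrightarrow> x \<otimes>\<^bsub>chain_algebra\<^esub> chain_word m k = chain_word m' (0, 0)"
  by (cases x; auto simp: chain_generator_def chain_word_def fun_eq_iff twist_def split: nat.split)+

lemma eval_chain_generator:
  assumes "\<And>x. x \<in> set (letters w) \<Longrightarrow> a x = chain_generator"
  shows "mdegree w = 1 \<Longrightarrow> eval_monomial chain_algebra a w = chain_generator"
    "2 \<le> mdegree w \<Longrightarrow> fst (eval_monomial chain_algebra a w) = 0"
proof -
  show "mdegree w = 1 \<Longrightarrow> eval_monomial chain_algebra a w = chain_generator"
    using assms unfolding mdegree_eq_1 by auto
  show "2 \<le> mdegree w \<Longrightarrow> fst (eval_monomial chain_algebra a w) = 0"
    by (cases w) (auto simp: chain_algebra_def split: prod.split)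
qed

lemma letter_index_append:
  "letter_index x (l @ m) = (if x \<in> set l then letter_index x l else length l + letter_index x m)"
  by (induction l) (auto simp: letter_index_def)

lemma letter_index_less: "x \<in> set l \<Longrightarrow> letter_index x l < length l"
  by (induction l) (auto simp: letter_index_def)

text \<open>The recursion of \<open>mark_coeff\<close> copies the multiplication table of
  \<open>chain_algebra\<close>. The index is \<open>mdegree w - 1\<close> because \<open>e_0\<close>
  has degree 2 but replaces a single letter.\<close>

lemma eval_chain_marked:
  assumes "distinct (letters w)" "i \<in> set (letters w)"
  shows "eval_monomial chain_algebra (\<lambda>x. if x = i then chain_word 0 (1, 0) else chain_generator) w =
    (chain_word (mdegree w - 1) (mark_coeff w (letter_index i (letters w))) :: 'f::field chain_element)"
  using assms
proof (induction w)
  case (Prod u v)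
  let ?a = "\<lambda>x. if x = i then chain_word 0 (1, 0) else chain_generator :: 'f chain_element"
  note e = eval_chain_generator[of _ ?a]
  have uv: "1 \<le> mdegree u" "1 \<le> mdegree v"
    by (rule mdegree_ge_1)+
  show ?case
  proof (cases "i \<in> set (letters u)")
    case True
    with Prod.prems have v: "i \<notin> set (letters v)"
      by auto
    then have a: "?a x = chain_generator" if "x \<in> set (letters v)" for x
      using that by auto
    have u: "eval_monomial chain_algebra ?a u =
        chain_word (mdegree u - 1) (mark_coeff u (letter_index i (letters u)))"
      using Prod True by simp
    have less: "letter_index i (letters u) < mdegree u"
      by (rule letter_index_less[OF True])
    show ?thesis
    proof (cases "mdegree v = 1")
      case True
      then show ?thesis
        using u less e(1)[OF a, of v] uv \<open>i \<in> set (letters u)\<close>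
        by (simp add: chain_word_products letter_index_append)
    next
      case False
      with uv have "2 \<le> mdegree v"
        by simp
      then show ?thesis
        using u less e(2)[OF a, of v] False \<open>i \<in> set (letters u)\<close>
        by (simp add: chain_word_products(4)[of _ _ _ "mdegree (Prod u v) - 1"] letter_index_append)
    qed
  next
    case False
    with Prod.prems have v: "i \<in> set (letters v)"
      by auto
    have a: "?a x = chain_generator" if "x \<in> set (letters u)" for x
      using that False by auto
    have v': "eval_monomial chain_algebra ?a v =
        chain_word (mdegree v - 1) (mark_coeff v (letter_index i (letters v)))"
      using Prod v by simp
    show ?thesis
    proof (cases "mdegree u = 1")
      case True
      then show ?thesis
        using v' e(1)[OF a, of u] uv False
        by (simp add: chain_word_products letter_index_append)
    next
      case False
      with uv have "2 \<le> mdegree u"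
        by simp
      then show ?thesis
        using v' e(2)[OF a, of u] False \<open>i \<notin> set (letters u)\<close>
        by (simp add: chain_word_products(5)[of _ _ _ "mdegree (Prod u v) - 1"] letter_index_append)
    qed
  qed
qed (simp add: letter_index_def)

text \<open>Ordinary algebras as superalgebras without odd part; this lets the envelope of
  \<open>chain_algebra\<close> test superidentities of even generators.\<close>

definition even_superalgebra ::
    "('f::field, 'a, 'm) module_scheme \<Rightarrow> ('f, 'a) superalgebra" where
  "even_superalgebra B = \<lparr>carrier = carrier B, monoid.mult = monoid.mult B, one = undefined,
    ring.zero = ring.zero B, add = ring.add B, module.smult = module.smult B,
    homog = (\<lambda>p. if p = 0 then carrier B else {\<zero>\<^bsub>B\<^esub>})\<rparr>"

lemma even_superalgebra_simps [simp]:
  "carrier (even_superalgebra B) = carrier B" "monoid.mult (even_superalgebra B) = monoid.mult B"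
  "ring.zero (even_superalgebra B) = ring.zero B" "ring.add (even_superalgebra B) = ring.add B"
  "module.smult (even_superalgebra B) = module.smult B"
  "homog (even_superalgebra B) p = (if p = 0 then carrier B else {\<zero>\<^bsub>B\<^esub>})"
  by (simp_all add: even_superalgebra_def)

lemma associator_even_superalgebra: "associator (even_superalgebra B) = associator B"
  by (simp add: associator_def a_minus_def a_inv_def m_inv_def fun_eq_iff)

lemma eval_monomial_even_superalgebra: "eval_monomial (even_superalgebra B) = eval_monomial B"
proof (intro ext)
  show "eval_monomial (even_superalgebra B) a w = eval_monomial B a w" for a w
    by (induction w) simp_all
qed

lemma even_superalgebra_super_laws:
  fixes B :: "('f::field_char_0, 'a, 'm) module_scheme"
  assumes "alt_metabelian_algebra B"
  shows "super_laws (even_superalgebra B)"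
proof -
  interpret B: alt_metabelian_algebra_char_0 B
    using assms by (simp add: alt_metabelian_algebra_char_0_def)
  have "nonassoc_algebra (even_superalgebra B)"
    by (rule nonassoc_algebraI) (auto simp: B.M.a_ac B.smult_add_scalar B.smult_add
        B.smult_mult B.mult_add_left B.mult_add_right B.smult_mult_left B.smult_mult_right)
  then have "superalgebra (even_superalgebra B)"
  proof (rule superalgebraI)
    fix x assume "x \<in> carrier (even_superalgebra B)"
    then show "\<exists>y\<in>homog (even_superalgebra B) 0. \<exists>z\<in>homog (even_superalgebra B) 1.
        x = y \<oplus>\<^bsub>even_superalgebra B\<^esub> z"
      by auto
  qed (auto split: if_splits)
  moreover have "associator B x y z \<oplus>\<^bsub>B\<^esub> associator B y x z = \<zero>\<^bsub>B\<^esub>"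
    "associator B x y z \<oplus>\<^bsub>B\<^esub> associator B x z y = \<zero>\<^bsub>B\<^esub>"
    if xyz: "x \<in> carrier B" "y \<in> carrier B" "z \<in> carrier B" for x y z
    using B.linearised_left_alternative[OF _ xyz] B.linearised_right_alternative[OF _ xyz] xyz
    by (auto intro!: B.eq_by_functionals simp: associator_def B.functional_simps algebra_simps)
  moreover have "associator B x y z = \<zero>\<^bsub>B\<^esub>"
    if "x \<in> carrier B" "y \<in> carrier B" "z \<in> carrier B" "x = \<zero>\<^bsub>B\<^esub> \<or> y = \<zero>\<^bsub>B\<^esub> \<or> z = \<zero>\<^bsub>B\<^esub>" for x y z
    using that by (auto simp: associator_def a_minus_def B.M.r_neg)
  ultimately show ?thesis
    by (auto simp: super_laws_def associator_even_superalgebra super_sign_def B.metabelian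
        split: if_splits)
qed

section \<open>Identities of the free algebras\<close>

lemma alt_metabelian_ideals_nonempty:
  "alt_metabelian_ideals r s \<noteq> ({} :: ((nat + nat) monomial \<Rightarrow> 'f::field_char_0) set set)"
proof -
  interpret superalgebra "chain_algebra :: ('f, _) superalgebra"
    by (rule chain_superalgebra)
  have "homogeneous_images (chain_algebra :: ('f, _) superalgebra) r s (\<lambda>_. \<zero>\<^bsub>chain_algebra\<^esub>)"
    unfolding homogeneous_images_def using homog_zero by blast
  then show ?thesis
    using evaluation_kernel[OF chain_super_laws] by blast
qed

text \<open>A value lies in the intersection iff it lies in every member of the family. So each
  quotient can be treated separately, and each of them is alternative metabelian by the definition
  of the family.\<close>

lemma identities_iff:
  fixes f :: "nat monomial \<Rightarrow> 'f::field_char_0"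
  shows "identities r s n f \<longleftrightarrow> multilinear_polynomial n f \<and>
    (\<forall>J\<in>alt_metabelian_ideals r s.
      satisfies_superidentity (quotient_superalgebra (free_superalgebra r s) J) n f)"
proof (cases "multilinear_polynomial n f")
  case True
  have "satisfies_superidentity (free_alt_metabelian_superalgebra r s) n f \<longleftrightarrow>
      (\<forall>p a. (\<forall>i<n. a i \<in> homog (free_superalgebra r s) (p i)) \<longrightarrow>
        superization_value (free_superalgebra r s) f p a \<in> alt_metabelian_ideal r s)"
    unfolding free_alt_metabelian_superalgebra_def
    by (rule quotient_superidentity_iff[OF free_is_superalgebra
          alt_metabelian_ideal_graded[OF alt_metabelian_ideals_nonempty] True])
  moreover have "satisfies_superidentity (quotient_superalgebra (free_superalgebra r s) J) n f \<longleftrightarrow>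
      (\<forall>p a. (\<forall>i<n. a i \<in> homog (free_superalgebra r s) (p i)) \<longrightarrow>
        superization_value (free_superalgebra r s) f p a \<in> J)"
    if "J \<in> alt_metabelian_ideals r s" for J
    using quotient_superidentity_iff[OF free_is_superalgebra _ True] that
    by (auto simp: alt_metabelian_ideals_def)
  ultimately show ?thesis
    using True unfolding identities_def alt_metabelian_ideal_def alt_metabelian_ideals_def[symmetric]
    by blast
qed (simp add: identities_def)

lemma identities_evaluate:
  fixes f :: "nat monomial \<Rightarrow> 'f::field_char_0" and M :: "('f, 'a, 'm) superalgebra_scheme"
  assumes f: "identities r s n f" and M: "super_laws M" and g: "homogeneous_images M r s g"
    and a: "\<And>i. i < n \<Longrightarrow> a i \<in> homog (free_superalgebra r s) (p i)"
  shows "superization_value M f p (\<lambda>i. evaluate M g (a i)) = \<zero>\<^bsub>M\<^esub>"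
proof -
  interpret M: superalgebra M using M by (simp add: super_laws_def)
  let ?J = "{h \<in> carrier (free_superalgebra r s). evaluate M g h = \<zero>\<^bsub>M\<^esub>}"
  have ml: "multilinear_polynomial n f"
    using f by (simp add: identities_def)
  have J: "?J \<in> alt_metabelian_ideals r s"
    by (rule evaluation_kernel[OF M g])
  then have "superization_value (free_superalgebra r s) f p a \<in> ?J"
    using f a quotient_superidentity_iff[OF free_is_superalgebra _ ml, of ?J]
    by (auto simp: identities_iff alt_metabelian_ideals_def)
  then show ?thesis
    using superization_value_hom[OF free_is_nonassoc_algebra M.nonassoc_algebra_axioms
        M.evaluate_hom[OF M.homogeneous_images_carrier[OF g]] ml, where a = a and p = p] a
    by (auto simp: free_homog)
qed

lemma identities_evaluate_monomials:
  fixes f :: "nat monomial \<Rightarrow> 'f::field_char_0" and M :: "('f, 'a, 'm) superalgebra_scheme"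
  assumes f: "identities r s n f" and M: "super_laws M" and g: "homogeneous_images M r s g"
    and v: "\<And>i. i < n \<Longrightarrow> in_generators r s (v i)"
  shows "superization_value M f (\<lambda>i. monomial_parity (v i)) (\<lambda>i. eval_monomial M g (v i)) = \<zero>\<^bsub>M\<^esub>"
proof -
  interpret M: superalgebra M using M by (simp add: super_laws_def)
  have "superization_value M f (\<lambda>i. monomial_parity (v i)) (\<lambda>i. evaluate M g (basis_element (v i))) = \<zero>\<^bsub>M\<^esub>"
    using v by (intro identities_evaluate[OF f M g] basis_element_homog)
  moreover have "superization_value M f p (\<lambda>i. evaluate M g (basis_element (v i))) =
      superization_value M f p (\<lambda>i. eval_monomial M g (v i))" for p
    using v M.evaluate_basis_element[OF M.homogeneous_images_carrier[OF g]]
      M.eval_generators[OF M.homogeneous_images_carrier[OF g]] f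
    by (intro superization_value_cong[OF M.nonassoc_algebra_axioms]) (auto simp: identities_def)
  ultimately show ?thesis
    by simp
qed

lemma identities_via_envelopes:
  fixes f :: "nat monomial \<Rightarrow> 'f::field_char_0"
  assumes "multilinear_polynomial n f"
    "\<And>J b. \<lbrakk>J \<in> alt_metabelian_ideals r s;
      \<And>i. b i \<in> carrier (grassmann_envelope (quotient_superalgebra (free_superalgebra r s) J))\<rbrakk> \<Longrightarrow>
      polynomial_value (grassmann_envelope (quotient_superalgebra (free_superalgebra r s) J)) f b =
      \<zero>\<^bsub>grassmann_envelope (quotient_superalgebra (free_superalgebra r s) J)\<^esub>"
  shows "identities r s n f"
  unfolding identities_iff
  using assms by (auto intro!: superidentity_via_envelope
      simp: alt_metabelian_ideals_def alt_metabelian_superalgebra_def)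

lemma free_functional:
  assumes "linear_functional (free_superalgebra r s) \<phi>" "h \<in> carrier (free_superalgebra r s)"
  shows "\<phi> h = (\<Sum>w\<in>{w. h w \<noteq> 0}. h w * \<phi> (basis_element w))"
proof -
  let ?A = "free_superalgebra r s"
  have "finite W \<Longrightarrow> h \<in> carrier ?A \<Longrightarrow> {w. h w \<noteq> 0} = W \<Longrightarrow> \<phi> h = (\<Sum>w\<in>W. h w * \<phi> (basis_element w))" for W h
  proof (induction W arbitrary: h rule: finite_induct)
    case empty
    then have "h = (\<lambda>w. 0)"
      by auto
    then show ?case
      using free.functional_zero[OF assms(1)] by simp
  next
    case (insert w W)
    let ?k = "\<lambda>v. if v = w then 0 else h v"
    have supp: "{v. ?k v \<noteq> 0} = W"
      using insert by auto
    then have k: "?k \<in> carrier ?A"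
      using insert by (auto simp: free_carrier split: if_splits)
    have "in_generators r s w"
      using insert.prems by (auto simp: free_carrier)
    then have b: "basis_element w \<in> carrier ?A"
      using basis_element_homog by (auto simp: free_homog)
    have "h = ?k \<oplus>\<^bsub>?A\<^esub> h w \<odot>\<^bsub>?A\<^esub> basis_element w"
      by (auto simp: basis_element_def)
    then have "\<phi> h = \<phi> ?k + h w * \<phi> (basis_element w)"
      using free.functional_add[OF assms(1) k free.smult_in[OF b, of "h w"]] free.functional_smult[OF assms(1) b]
      by metis
    moreover have "\<phi> ?k = (\<Sum>v\<in>W. h v * \<phi> (basis_element v))"
      using insert.IH[OF k supp] insert.hyps by (auto intro!: sum.cong)
    ultimately show ?case
      using insert.hyps by simp
  qed
  then show ?thesis
    using assms(2) by (simp add: free_carrier)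
qed

lemma eval_free_generators:
  assumes "in_generators r s w"
  shows "eval_monomial (free_superalgebra r s) (\<lambda>x. basis_element (Gen x)) w = basis_element w"
  using assms
proof (induction w)
  case (Prod u v)
  then show ?case
    by (auto simp: basis_element_def fun_eq_iff split: monomial.split)
qed simp

lemma eval_quotient_generators:
  fixes J :: "((nat + nat) monomial \<Rightarrow> 'f::field) set"
  assumes J: "graded_ideal J (free_superalgebra r s)" and w: "in_generators r s w"
  shows "eval_monomial (quotient_superalgebra (free_superalgebra r s) J)
      (\<lambda>x. J +>\<^bsub>free_superalgebra r s\<^esub> basis_element (Gen x)) w = J +>\<^bsub>free_superalgebra r s\<^esub> basis_element w"
proof -
  have "basis_element (Gen x) \<in> carrier (free_superalgebra r s :: ('f, _) superalgebra)" if "x \<in> set (letters w)" for x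
    using w that basis_element_homog[of "Gen x" r s] by (auto simp: free_homog)
  then have "eval_monomial (quotient_superalgebra (free_superalgebra r s) J)
      (\<lambda>x. J +>\<^bsub>free_superalgebra r s\<^esub> basis_element (Gen x)) w = J +>\<^bsub>free_superalgebra r s\<^esub>
      eval_monomial (free_superalgebra r s) (\<lambda>x. basis_element (Gen x)) w"
    by (intro eval_monomial_hom[OF free_is_nonassoc_algebra quotient_hom[OF free_is_superalgebra J]])
  then show ?thesis
    by (simp add: eval_free_generators[OF w])
qed

text \<open>A quotient of the smaller free superalgebra receives an evaluation from the larger one
  that sends the surplus generators to zero. On elements of the smaller free superalgebra, which are
  also elements of the larger one, this evaluation is the projection.\<close>

lemma identities_mono:
  fixes f :: "nat monomial \<Rightarrow> 'f::field_char_0"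
  assumes f: "identities r' s' n f" and le: "r \<le> r'" "s \<le> s'"
  shows "identities r s n f"
  unfolding identities_iff
proof (intro conjI ballI)
  show ml: "multilinear_polynomial n f"
    using f by (simp add: identities_def)
  fix J :: "((nat + nat) monomial \<Rightarrow> 'f) set" assume "J \<in> alt_metabelian_ideals r s"
  then have J: "graded_ideal J (free_superalgebra r s)"
    and Q: "super_laws (quotient_superalgebra (free_superalgebra r s) J)"
    by (auto simp: alt_metabelian_ideals_def intro: alt_metabelian_imp_super_laws)
  let ?A = "free_superalgebra r s" and ?q = "\<lambda>h. J +>\<^bsub>free_superalgebra r s\<^esub> h"
  let ?Q = "quotient_superalgebra ?A J"
  interpret Q: superalgebra ?Q using Q by (simp add: super_laws_def)
  note qh = quotient_hom[OF free_is_superalgebra J] and qs = quotient_simps[OF free_is_superalgebra J]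
  define g where "g x = (if x \<in> generators r s then ?q (basis_element (Gen x)) else \<zero>\<^bsub>?Q\<^esub>)" for x
  have gen: "?q (basis_element (Gen x)) \<in> homog ?Q (monomial_parity (Gen x))" if "x \<in> generators r s" for x
    using basis_element_homog[of "Gen x" r s] that by (auto simp: qs)
  have g: "homogeneous_images ?Q r' s' g"
    using gen[of "Inl _"] gen[of "Inr _"] Q.homog_zero
    by (auto simp: homogeneous_images_def g_def monomial_parity_simps)
  have sub: "generators r s \<subseteq> generators r' s'"
    using le by (auto simp: generators_def)
  have lift: "h \<in> homog (free_superalgebra r' s') p" if "h \<in> homog ?A p" for h :: "_ \<Rightarrow> 'f" and p
    using that sub by (force simp: free_homog free_carrier)
  have ev: "evaluate ?Q g h = ?q h" if h: "h \<in> carrier ?A" for h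
  proof (rule Q.eq_by_functionals)
    have gc: "g x \<in> carrier ?Q" if "x \<in> generators r s" for x
      using Q.homog_carrier[OF gen[OF that]] that by (simp add: g_def)
    show "evaluate ?Q g h \<in> carrier ?Q"
      by (rule Q.evaluate_closed[OF gc h])
    show "?q h \<in> carrier ?Q"
      using h by (simp add: qs)
    fix \<phi> assume \<phi>: "linear_functional ?Q \<phi>"
    have fin: "finite {w. h w \<noteq> 0}"
      using h by (simp add: free_carrier)
    have "eval_monomial ?Q g w = ?q (basis_element w)" if "h w \<noteq> 0" for w
    proof -
      have w: "in_generators r s w"
        using h that by (simp add: free_carrier)
      then have "eval_monomial ?Q g w = eval_monomial ?Q (\<lambda>x. ?q (basis_element (Gen x))) w"
        by (intro eval_monomial_cong) (auto simp: g_def)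
      then show ?thesis
        by (simp add: eval_quotient_generators[OF J w])
    qed
    then show "\<phi> (evaluate ?Q g h) = \<phi> (?q h)"
      using Q.functional_evaluate[OF gc h \<phi> fin]
        free_functional[OF linear_functional_hom[OF qh \<phi>] h] by simp
  qed
  have "superization_value ?A f p a \<in> J" if a: "\<forall>i<n. a i \<in> homog ?A (p i)" for p a
  proof -
    have c: "a i \<in> carrier ?A" if "i < n" for i
      using a that by (auto simp: free_homog)
    have "superization_value ?Q f p (\<lambda>i. ?q (a i)) = superization_value ?Q f p (\<lambda>i. evaluate ?Q g (a i))"
      using ev c by (intro superization_value_cong[OF Q.nonassoc_algebra_axioms ml]) (auto simp: qs)
    also have "\<dots> = \<zero>\<^bsub>?Q\<^esub>"
      using a lift by (intro identities_evaluate[OF f Q g]) auto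
    finally have "?q (superization_value ?A f p a) = \<zero>\<^bsub>?Q\<^esub>"
      using superization_value_hom[OF free_is_nonassoc_algebra Q.nonassoc_algebra_axioms qh ml c,
          where p = p] by simp
    moreover have "superization_value ?A f p a \<in> carrier ?A"
      by (rule superization_value_closed[OF free_is_nonassoc_algebra ml c])
    ultimately show ?thesis
      using quotient_zero_iff[OF free_is_superalgebra J] by blast
  qed
  then show "satisfies_superidentity ?Q n f"
    by (simp add: quotient_superidentity_iff[OF free_is_superalgebra J ml])
qed

text \<open>The letter \<open>i\<close> is evaluated at \<open>x^2\<close> and all others at the odd
  generator \<open>x\<close>. Each monomial then takes its marked coefficient at index
  \<open>n - 1\<close>, and its Koszul sign is \<open>marked_sign\<close>.\<close>

lemma identities_marks_vanish:
  fixes f :: "nat monomial \<Rightarrow> 'f::field_char_0"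
  assumes f: "identities 0 1 n f"
  shows "marks_vanish n f"
  unfolding marks_vanish_def
proof (intro allI impI)
  fix i assume i: "i < n"
  let ?C = "chain_algebra :: ('f, 'f chain_element) superalgebra"
  let ?x = "Gen (Inr 0) :: (nat + nat) monomial"
  let ?v = "\<lambda>j. if j = i then Prod ?x ?x else ?x"
  let ?p = "\<lambda>j. if j = i then 0 else 1 :: bit"
  let ?a = "\<lambda>j. if j = i then chain_word 0 (1, 0) else chain_generator :: 'f chain_element"
  interpret superalgebra ?C
    by (rule chain_superalgebra)
  have ml: "multilinear_polynomial n f"
    using f by (simp add: identities_def)
  have "homogeneous_images ?C 0 1 (\<lambda>_. chain_generator)"
    by (simp add: homogeneous_images_def chain_generator_def)
  then have "superization_value ?C f (\<lambda>j. monomial_parity (?v j))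
      (\<lambda>j. eval_monomial ?C (\<lambda>_. chain_generator) (?v j)) = \<zero>\<^bsub>?C\<^esub>"
    by (intro identities_evaluate_monomials[OF f chain_super_laws]) (auto simp: generators_def)
  moreover have "(\<lambda>j. monomial_parity (?v j)) = ?p"
    by (auto simp: monomial_parity_simps)
  moreover have "(\<lambda>j. eval_monomial ?C (\<lambda>_. chain_generator) (?v j)) = ?a"
    by (auto simp: chain_word_products)
  ultimately have zero: "superization_value ?C f ?p ?a = \<zero>\<^bsub>?C\<^esub>"
    by simp
  have "(\<Sum>w\<in>{w. f w \<noteq> 0}. marked_sign i w * f w * \<phi> (chain_word (n - 1) (marked_value i w))) = 0"
    if \<phi>: "linear_functional ?C \<phi>" for \<phi>
  proof -
    have "eval_monomial ?C ?a w = chain_word (n - 1) (marked_value i w)" if w: "f w \<noteq> 0" for w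
    proof -
      have "mdegree w = card {..<n}"
        using ml w distinct_card[of "letters w"] by (simp add: multilinear_polynomial_def)
      then show ?thesis
        using eval_chain_marked[of w i] multilinear_letters[OF ml w] i by (simp add: marked_value_def)
    qed
    then show ?thesis
      using functional_superization_value[OF chain_nonassoc_algebra ml _ \<phi>, of ?a ?p] zero
        functional_zero[OF \<phi>] by (simp add: marked_sign_koszul)
  qed
  moreover have "linear_functional ?C (\<lambda>x. fst (snd x) (n - 1))" "linear_functional ?C (\<lambda>x. snd (snd x) (n - 1))"
    by (auto simp: linear_functional_def)
  ultimately show "(\<Sum>w\<in>{w. f w \<noteq> 0}. marked_sign i w * f w * fst (marked_value i w)) = 0 \<and>
      (\<Sum>w\<in>{w. f w \<noteq> 0}. marked_sign i w * f w * snd (marked_value i w)) = 0"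
    by (fastforce simp: chain_word_def)
qed

text \<open>In degree 2 the two monomials have the independent marks 1 and \<tau> at the letter 0.
  In degree 1 there is one monomial, with mark 1, and in degree 0 none, as every monomial has a
  letter.\<close>

lemma marks_vanish_small:
  fixes f :: "nat monomial \<Rightarrow> 'f::field"
  assumes ml: "multilinear_polynomial n f" and n: "n < 3" and marks: "marks_vanish n f"
  shows "f w = 0"
proof (rule ccontr)
  assume w: "f w \<noteq> 0"
  let ?W = "{w. f w \<noteq> 0}"
  have deg: "mdegree w = n" if "f w \<noteq> 0" for w
    using ml that distinct_card[of "letters w"] by (simp add: multilinear_polynomial_def)
  have "n = 1 \<or> n = 2"
    using deg[OF w] mdegree_ge_1[of w] n by linarith
  then show False
  proof
    assume n: "n = 1"
    have "u = Gen 0" if u: "f u \<noteq> 0" for u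
    proof -
      obtain x where "u = Gen x"
        using deg[OF u] n mdegree_eq_1 by metis
      then show ?thesis
        using multilinear_letters(1)[OF ml u, of x] n by simp
    qed
    then have W: "?W = {Gen 0}"
      using w by blast
    then have "f (Gen 0) \<noteq> 0"
      by auto
    moreover have "(\<Sum>w\<in>?W. marked_sign 0 w * f w * fst (marked_value 0 w)) = 0"
      using marks n by (simp add: marks_vanish_def)
    ultimately show False
      unfolding W by (simp add: marked_value_def marked_sign_def)
  next
    assume n: "n = 2"
    let ?u = "Prod (Gen 0) (Gen (1 :: nat))" and ?v = "Prod (Gen 1) (Gen (0 :: nat))"
    have "u = ?u \<or> u = ?v" if fu: "f u \<noteq> 0" for u
    proof -
      obtain x y where u: "u = Prod (Gen x) (Gen y)"
        using deg[OF fu] n mdegree_eq_2 by metis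
      then have "x \<noteq> y" "x < 2" "y < 2"
        using multilinear_letters[OF ml fu] n by auto
      then show ?thesis
        using u by auto
    qed
    then have W: "?W \<subseteq> {?u, ?v}"
      by blast
    have sum: "(\<Sum>w\<in>?W. marked_sign 0 w * f w * h w) =
        (\<Sum>w\<in>{?u, ?v}. marked_sign 0 w * f w * h w)" for h
      using W by (intro sum.mono_neutral_left) auto
    have "0 < n"
      using n by simp
    note m = marks[unfolded marks_vanish_def, rule_format, OF this]
    have "f ?u = 0 \<and> f ?v = 0"
      using sum[symmetric, THEN trans, OF conjunct1[OF m]] sum[symmetric, THEN trans, OF conjunct2[OF m]]
      by (simp add: marked_value_def marked_sign_def letter_index_def twist_def permutation_sign_Cons)
    with W w show False
      by blast
  qed
qed

text \<open>In degree \<open>3\<close> the only obstruction is the linearisation of \<open>x\<^sup>3\<close>.\<close>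

lemma polynomial_value_of_identities:
  fixes f :: "nat monomial \<Rightarrow> 'f::field_char_0" and B :: "('f, 'a, 'm) module_scheme"
  assumes f: "identities 0 1 n f" and B: "alt_metabelian_algebra_char_0 B"
    and b: "\<And>i. b i \<in> carrier B"
  shows "polynomial_value B f b = (if n = 3 then ((\<Sum>w\<in>{w. f w \<noteq> 0}. f w) / 6) \<odot>\<^bsub>B\<^esub>
    alt_metabelian_algebra_char_0.symmetric_cube B (b 0) (b 1) (b 2) else \<zero>\<^bsub>B\<^esub>)"
proof -
  interpret B: alt_metabelian_algebra_char_0 B by (rule B)
  have ml: "multilinear_polynomial n f"
    using f by (simp add: identities_def)
  note marks = identities_marks_vanish[OF f]
  show ?thesis
  proof (cases "3 \<le> n")
    case True
    then show ?thesis
      by (rule B.polynomial_value_by_marks[OF ml _ marks b])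
  next
    case False
    then have "{w. f w \<noteq> 0} = {}"
      using marks_vanish_small[OF ml _ marks] by auto
    with False show ?thesis
      unfolding polynomial_value_def by simp
  qed
qed

lemma envelope_alt_metabelian:
  fixes J :: "((nat + nat) monomial \<Rightarrow> 'f::field_char_0) set"
  assumes "J \<in> alt_metabelian_ideals r s"
  shows "alt_metabelian_algebra_char_0
    (grassmann_envelope (quotient_superalgebra (free_superalgebra r s) J))"
  using assms
  by (simp add: alt_metabelian_ideals_def alt_metabelian_superalgebra_def alt_metabelian_algebra_char_0_def)

lemma identities_everywhere:
  fixes f :: "nat monomial \<Rightarrow> 'f::field_char_0"
  assumes f: "identities 0 1 n f" and sum: "n = 3 \<Longrightarrow> (\<Sum>w\<in>{w. f w \<noteq> 0}. f w) = 0"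
  shows "identities r s n f"
proof (rule identities_via_envelopes)
  fix J :: "((nat + nat) monomial \<Rightarrow> 'f) set" and b :: "nat \<Rightarrow> _"
  let ?G = "grassmann_envelope (quotient_superalgebra (free_superalgebra r s) J)"
  assume J: "J \<in> alt_metabelian_ideals r s" and b: "\<And>i. b i \<in> carrier ?G"
  interpret G: alt_metabelian_algebra_char_0 ?G
    by (rule envelope_alt_metabelian[OF J])
  show "polynomial_value ?G f b = \<zero>\<^bsub>?G\<^esub>"
    using polynomial_value_of_identities[OF f G.alt_metabelian_algebra_char_0_axioms b]
      sum G.smult_0[OF G.cubic_closed(3)[OF b b b]] by (simp split: if_splits)
qed (use f in \<open>simp add: identities_def\<close>)

lemma linear_functional_eval_monomial:
  assumes A: "nonassoc_algebra A" and \<phi>: "linear_functional A \<phi>"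
    and w: "distinct (letters w)" "i \<in> set (letters w)"
    and a: "\<And>x. x \<in> set (letters w) \<Longrightarrow> x \<noteq> i \<Longrightarrow> a x \<in> carrier A"
  shows "linear_functional A (\<lambda>y. \<phi> (eval_monomial A (a(i := y)) w))"
  using \<phi> w a
proof (induction w arbitrary: \<phi>)
  case (Prod u v)
  interpret nonassoc_algebra A by (rule A)
  show ?case
  proof (cases "i \<in> set (letters u)")
    case True
    with Prod.prems have v: "i \<notin> set (letters v)"
      by auto
    then have "eval_monomial A (a(i := y)) v = eval_monomial A a v" for y
      by (intro eval_monomial_cong) auto
    moreover have "eval_monomial A a v \<in> carrier A"
      using Prod.prems(4) v by (intro eval_monomial_closed) auto
    ultimately show ?thesis
      using Prod.IH(1)[OF linear_functional_mult_right[OF Prod.prems(1)]] Prod.prems True by (simp del: fun_upd_apply)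
  next
    case False
    then have "eval_monomial A (a(i := y)) u = eval_monomial A a u" for y
      by (intro eval_monomial_cong) auto
    moreover have "eval_monomial A a u \<in> carrier A"
      using Prod.prems(4) False by (intro eval_monomial_closed) auto
    ultimately show ?thesis
      using Prod.IH(2)[OF linear_functional_mult_left[OF Prod.prems(1)]] Prod.prems False by (simp del: fun_upd_apply)
  qed
qed simp

lemma linear_functional_sum:
  "(\<And>x. x \<in> I \<Longrightarrow> linear_functional A (\<phi> x)) \<Longrightarrow> linear_functional A (\<lambda>y. \<Sum>x\<in>I. c x * \<phi> x y)"
  by (simp add: linear_functional_def sum.distrib ring_distribs sum_distrib_left mult_ac)

lemma linear_functional_superization_value:
  assumes A: "nonassoc_algebra A" and f: "multilinear_polynomial n f" and \<phi>: "linear_functional A \<phi>"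
    and i: "i < n" and a: "\<And>j. j < n \<Longrightarrow> j \<noteq> i \<Longrightarrow> a j \<in> carrier A"
  obtains \<psi> where "linear_functional A \<psi>"
    "\<And>y. y \<in> carrier A \<Longrightarrow> \<psi> y = \<phi> (superization_value A f p (a(i := y)))"
proof
  let ?\<psi> = "\<lambda>y. \<Sum>w\<in>{w. f w \<noteq> 0}. koszul_sign p w * f w * \<phi> (eval_monomial A (a(i := y)) w)"
  show "linear_functional A ?\<psi>"
    using multilinear_letters[OF f] i a
    by (intro linear_functional_sum linear_functional_eval_monomial[OF A \<phi>]) auto
  show "?\<psi> y = \<phi> (superization_value A f p (a(i := y)))" if "y \<in> carrier A" for y
    using functional_superization_value[OF A f _ \<phi>, of "a(i := y)" p] a that by (auto split: if_splits)
qed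

text \<open>Reduces a superidentity to monomials in the generators, to which arguments by degree and
  by coinciding letters apply.\<close>

lemma superidentity_on_monomials:
  fixes f :: "nat monomial \<Rightarrow> 'f::field" and J :: "((nat + nat) monomial \<Rightarrow> 'f) set"
  assumes J: "graded_ideal J (free_superalgebra r s)" and ml: "multilinear_polynomial n f"
    and v: "\<And>v. (\<And>i. i < n \<Longrightarrow> in_generators r s (v i)) \<Longrightarrow>
      superization_value (quotient_superalgebra (free_superalgebra r s) J) f
        (\<lambda>i. monomial_parity (v i)) (\<lambda>i. J +>\<^bsub>free_superalgebra r s\<^esub> basis_element (v i)) =
      \<zero>\<^bsub>quotient_superalgebra (free_superalgebra r s) J\<^esub>"
  shows "satisfies_superidentity (quotient_superalgebra (free_superalgebra r s) J) n f"
proof -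
  let ?A = "free_superalgebra r s" and ?q = "\<lambda>h. J +>\<^bsub>free_superalgebra r s\<^esub> h"
  let ?Q = "quotient_superalgebra ?A J"
  interpret Q: superalgebra ?Q
    by (rule quotient_is_superalgebra[OF free_is_superalgebra J])
  note qh = quotient_hom[OF free_is_superalgebra J] and qs = quotient_simps[OF free_is_superalgebra J]
  let ?b = "\<lambda>p x. \<exists>w. in_generators r s w \<and> monomial_parity w = p \<and> x = ?q (basis_element w)"
  have bh: "x \<in> homog ?Q p" if b: "?b p x" for p x
    using b basis_element_homog by (auto simp: qs)
  \<comment> \<open>The first \<open>k\<close> arguments are arbitrary homogeneous elements, the
    others cosets of monomials; induction on \<open>k\<close> frees one argument at a time.\<close>
  have "superization_value ?Q f p a = \<zero>\<^bsub>?Q\<^esub>"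
    if "k \<le> n" "\<And>i. i < k \<Longrightarrow> a i \<in> homog ?Q (p i)" "\<And>i. k \<le> i \<Longrightarrow> i < n \<Longrightarrow> ?b (p i) (a i)" for k p a
    using that
  proof (induction k arbitrary: a)
    case 0
    then have "\<forall>i. \<exists>w. i < n \<longrightarrow> in_generators r s w \<and> monomial_parity w = p i \<and> a i = ?q (basis_element w)"
      by auto
    then obtain v where v': "\<And>i. i < n \<Longrightarrow> in_generators r s (v i) \<and> monomial_parity (v i) = p i \<and>
        a i = ?q (basis_element (v i))"
      by metis
    have "superization_value ?Q f p a = superization_value ?Q f (\<lambda>i. monomial_parity (v i)) a"
    proof -
      have "koszul_sign p w = (koszul_sign (\<lambda>i. monomial_parity (v i)) w :: 'f)" if "f w \<noteq> 0" for w
      proof -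
        have "letters w ! i < n" if "i < mdegree w" for i
          using multilinear_letters(1)[OF ml \<open>f w \<noteq> 0\<close>] nth_mem[OF that] by blast
        then have "p (letters w ! i) = monomial_parity (v (letters w ! i))" if "i < mdegree w" for i
          using v' that by simp
        then have "{(i, j). i < j \<and> j < mdegree w \<and> letters w ! j < letters w ! i \<and>
              p (letters w ! i) = 1 \<and> p (letters w ! j) = 1} =
            {(i, j). i < j \<and> j < mdegree w \<and> letters w ! j < letters w ! i \<and>
              monomial_parity (v (letters w ! i)) = 1 \<and> monomial_parity (v (letters w ! j)) = 1}"
          by (auto dest: less_trans)
        then show ?thesis
          unfolding koszul_sign_def by simp
      qed
      moreover have "eval_monomial ?Q a w \<in> carrier ?Q" if "f w \<noteq> 0" for w
        using multilinear_letters(1)[OF ml that] Q.homog_carrier[OF bh] 0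
        by (intro Q.eval_monomial_closed) blast
      ultimately show ?thesis
        unfolding superization_value_def by (intro Q.finsum_cong') auto
    qed
    also have "\<dots> = superization_value ?Q f (\<lambda>i. monomial_parity (v i)) (\<lambda>i. ?q (basis_element (v i)))"
    proof (rule superization_value_cong[OF Q.nonassoc_algebra_axioms ml])
      fix i assume "i < n"
      note v' = v'[OF this]
      show "a i = ?q (basis_element (v i))"
        using v' by simp
      show "?q (basis_element (v i)) \<in> carrier ?Q"
        using Q.homog_carrier[OF bh] v' by blast
    qed
    also have "\<dots> = \<zero>\<^bsub>?Q\<^esub>"
      using v v' by blast
    finally show ?case .
  next
    case (Suc k)
    have ac: "a i \<in> carrier ?Q" if "i < n" for i
    proof (cases "i < Suc k")
      case True
      then show ?thesis
        by (rule Q.homog_carrier[OF Suc.prems(2)])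
    next
      case False
      then show ?thesis
        using Suc.prems(3)[of i] that by (intro Q.homog_carrier[OF bh]) simp
    qed
    obtain h where h: "h \<in> homog ?A (p k)" "a k = ?q h"
      using Suc.prems(2)[of k] by (auto simp: qs)
    then have hc: "h \<in> carrier ?A"
      by (simp add: free_homog)
    show ?case
    proof (rule Q.eq_by_functionals)
      show "superization_value ?Q f p a \<in> carrier ?Q"
        by (rule superization_value_closed[OF Q.nonassoc_algebra_axioms ml ac])
      fix \<phi> assume \<phi>: "linear_functional ?Q \<phi>"
      obtain \<psi> where \<psi>: "linear_functional ?Q \<psi>"
        "\<And>y. y \<in> carrier ?Q \<Longrightarrow> \<psi> y = \<phi> (superization_value ?Q f p (a(k := y)))"
        using linear_functional_superization_value[OF Q.nonassoc_algebra_axioms ml \<phi>, of k a p] ac Suc.prems(1)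
        by auto
      have "\<psi> (?q (basis_element w)) = 0" if w: "h w \<noteq> 0" for w
      proof -
        have "in_generators r s w" "monomial_parity w = p k"
          using h w by (auto simp: free_homog free_carrier)
        then have b: "?b (p k) (?q (basis_element w))"
          by blast
        have "superization_value ?Q f p (a(k := ?q (basis_element w))) = \<zero>\<^bsub>?Q\<^esub>"
          using Suc.prems b by (intro Suc.IH) (auto simp: le_Suc_eq)
        then show ?thesis
          using \<psi>(2)[OF Q.homog_carrier[OF bh[OF b]]] Q.functional_zero[OF \<phi>] by simp
      qed
      then have "\<psi> (?q h) = 0"
        using free_functional[OF linear_functional_hom[OF qh \<psi>(1)] hc] by simp
      moreover have "a(k := ?q h) = a"
        using h(2) fun_upd_triv[of a k] by simp
      ultimately show "\<phi> (superization_value ?Q f p a) = \<phi> \<zero>\<^bsub>?Q\<^esub>"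
        using \<psi>(2)[of "?q h"] hc Q.functional_zero[OF \<phi>] by (simp add: qs)
    qed simp
  qed
  from this[of n] show ?thesis
    unfolding satisfies_superidentity_def by auto
qed

section \<open>The linearised cube in degree three\<close>

lemma mdegree_eq_3: "mdegree w = 3 \<longleftrightarrow> (\<exists>x y z. w = Prod (Prod (Gen x) (Gen y)) (Gen z) \<or>
    w = Prod (Gen x) (Prod (Gen y) (Gen z)))"
proof
  assume w: "mdegree w = 3"
  then obtain u v where uv: "w = Prod u v"
    by (cases w) auto
  then have "mdegree u = 1 \<and> mdegree v = 2 \<or> mdegree u = 2 \<and> mdegree v = 1"
    using w mdegree_ge_1[of u] mdegree_ge_1[of v] by (simp only: letters.simps length_append) linarith
  then show "\<exists>x y z. w = Prod (Prod (Gen x) (Gen y)) (Gen z) \<or> w = Prod (Gen x) (Prod (Gen y) (Gen z))"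
    unfolding mdegree_eq_1 mdegree_eq_2 using uv by blast
qed auto

lemma eval_triangular_cube:
  assumes "mdegree w = 3" "\<And>x. a x = (\<alpha> x, \<beta> x, \<gamma> x, 0, 0, 0)"
  shows "eval_monomial (triangular_algebra q) a w =
    (0, 0, 0, 0, 0, \<alpha> (letters w ! 0) * \<beta> (letters w ! 1) * \<gamma> (letters w ! 2))"
  using assms unfolding mdegree_eq_3 by auto

lemma linear_functional_triangular:
  "linear_functional (triangular_algebra q) (\<lambda>(a, b, c, d, e, g). g)"
  by (auto simp: linear_functional_def)

lemma multilinear_mdegree: "multilinear_polynomial n f \<Longrightarrow> f w \<noteq> 0 \<Longrightarrow> mdegree w = n"
  using distinct_card[of "letters w"] by (simp add: multilinear_polynomial_def)

text \<open>All letters are evaluated at the same even matrix \<open>m = E_12 + E_23 + E_34\<close>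
  with \<open>m^3 = E_14\<close>, so that every monomial contributes just its coefficient.\<close>

lemma identities_1_1_sum:
  fixes f :: "nat monomial \<Rightarrow> 'f::field_char_0"
  assumes f: "identities 1 1 3 f"
  shows "(\<Sum>w\<in>{w. f w \<noteq> 0}. f w) = 0"
proof -
  let ?T = "triangular_algebra False :: ('f, 'f triangular) superalgebra"
  let ?m = "(1, 1, 1, 0, 0, 0) :: 'f triangular"
  let ?g = "\<lambda>x :: nat + nat. case x of Inl _ \<Rightarrow> ?m | Inr _ \<Rightarrow> (0, 0, 0, 0, 0, 0)"
  let ?\<phi> = "\<lambda>(a, b, c, d, e, g). g :: 'f"
  have ml: "multilinear_polynomial 3 f"
    using f by (simp add: identities_def)
  have "homogeneous_images ?T 1 1 ?g"
    by (simp add: homogeneous_images_def triangular_homog)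
  then have "superization_value ?T f (\<lambda>_. monomial_parity (Gen (Inl 0)))
      (\<lambda>_. eval_monomial ?T ?g (Gen (Inl 0))) = \<zero>\<^bsub>?T\<^esub>"
    by (intro identities_evaluate_monomials[OF f triangular_super_laws]) (auto simp: generators_def)
  then have "superization_value ?T f (\<lambda>_. 0) (\<lambda>_. ?m) = \<zero>\<^bsub>?T\<^esub>"
    by (simp add: monomial_parity_simps)
  then have "(\<Sum>w\<in>{w. f w \<noteq> 0}. koszul_sign (\<lambda>_. 0) w * f w * ?\<phi> (eval_monomial ?T (\<lambda>_. ?m) w)) = 0"
    using functional_superization_value[OF triangular_nonassoc_algebra[of False] ml _ linear_functional_triangular,
        where a = "\<lambda>_. ?m" and p = "\<lambda>_. 0" ] by simp
  moreover have "koszul_sign (\<lambda>_. 0) w * f w * ?\<phi> (eval_monomial ?T (\<lambda>_. ?m) w) = f w" if "f w \<noteq> 0" for w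
    using eval_triangular_cube[OF multilinear_mdegree[OF ml that],
        where a = "\<lambda>_. ?m" and \<alpha> = "\<lambda>_. 1" and \<beta> = "\<lambda>_. 1" and \<gamma> = "\<lambda>_. 1"]
    by (simp add: koszul_sign_letters koszul_list_even)
  ultimately show ?thesis
    by simp
qed

lemma nth_letter_index: "x \<in> set l \<Longrightarrow> l ! letter_index x l = x"
  by (induction l) (auto simp: letter_index_def)

text \<open>Sending the letters \<open>i\<close>, \<open>j\<close>, \<open>k\<close> to three odd matrix units with nonzero product singles out
  the monomials with the word \<open>[i, j, k]\<close>.\<close>

lemma identities_0_3_sum:
  fixes f :: "nat monomial \<Rightarrow> 'f::field_char_0"
  assumes f: "identities 0 3 3 f"
  shows "(\<Sum>w\<in>{w. f w \<noteq> 0}. f w) = 0"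
proof -
  let ?T = "triangular_algebra True :: ('f, 'f triangular) superalgebra"
  let ?e = "\<lambda>m :: nat. (of_bool (m = 0), of_bool (m = 1), of_bool (m = 2), 0, 0, 0) :: 'f triangular"
  let ?g = "\<lambda>x :: nat + nat. case x of Inl m \<Rightarrow> ?e m | Inr m \<Rightarrow> ?e m"
  let ?\<phi> = "\<lambda>(a, b, c, d, e, g). g :: 'f"
  let ?W = "{w. f w \<noteq> 0}"
  have ml: "multilinear_polynomial 3 f"
    using f by (simp add: identities_def)
  have zero: "(\<Sum>w\<in>{w \<in> ?W. letters w = letters u}. f w) = 0" if u: "f u \<noteq> 0" for u
  proof -
    let ?i = "\<lambda>x. letter_index x (letters u)"
    have d: "distinct (letters u)" "mdegree u = 3" "set (letters u) = {..<3}"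
      using ml u multilinear_mdegree[OF ml u] by (auto simp: multilinear_polynomial_def)
    have "homogeneous_images ?T 0 3 ?g"
      by (simp add: homogeneous_images_def triangular_homog)
    moreover have "?i x < 3" if "x < 3" for x
      using letter_index_less[of x "letters u"] d that by simp
    ultimately have "superization_value ?T f (\<lambda>x. monomial_parity (Gen (Inr (?i x))))
        (\<lambda>x. eval_monomial ?T ?g (Gen (Inr (?i x)))) = \<zero>\<^bsub>?T\<^esub>"
      by (intro identities_evaluate_monomials[OF f triangular_super_laws])
        (auto simp: generators_def)
    then have "superization_value ?T f (\<lambda>_. 1) (\<lambda>x. ?e (?i x)) = \<zero>\<^bsub>?T\<^esub>"
      by (simp add: monomial_parity_simps)
    then have "(\<Sum>w\<in>?W. koszul_sign (\<lambda>_. 1) w * f w * ?\<phi> (eval_monomial ?T (\<lambda>x. ?e (?i x)) w)) = 0"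
      using functional_superization_value[OF triangular_nonassoc_algebra[of True] ml _ linear_functional_triangular,
          where a = "\<lambda>x. ?e (?i x)" and p = "\<lambda>_. 1" ] by simp
    also have "(\<Sum>w\<in>?W. koszul_sign (\<lambda>_. 1) w * f w * ?\<phi> (eval_monomial ?T (\<lambda>x. ?e (?i x)) w)) =
        (\<Sum>w\<in>?W. if letters w = letters u then koszul_sign (\<lambda>_. 1) u * f w else 0)"
    proof (rule sum.cong)
      fix w assume "w \<in> ?W"
      then have w: "distinct (letters w)" "mdegree w = 3" "set (letters w) = {..<3}"
        using ml multilinear_mdegree[OF ml] by (auto simp: multilinear_polynomial_def)
      have "?i (letters w ! 0) = 0 \<and> ?i (letters w ! 1) = 1 \<and> ?i (letters w ! 2) = 2 \<longleftrightarrow> letters w = letters u"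
      proof
        assume *: "?i (letters w ! 0) = 0 \<and> ?i (letters w ! 1) = 1 \<and> ?i (letters w ! 2) = 2"
        have nth: "letters u ! ?i x = x" if "x < 3" for x
          by (rule nth_letter_index) (simp add: d that)
        show "letters w = letters u"
        proof (rule nth_equalityI)
          fix m assume m: "m < mdegree w"
          then have "letters w ! m < 3"
            using w nth_mem[OF m] by auto
          moreover have "m = 0 \<or> m = 1 \<or> m = 2"
            using m w(2) by linarith
          then have "?i (letters w ! m) = m"
            using * by (elim disjE) simp_all
          ultimately show "letters w ! m = letters u ! m"
            using nth[of "letters w ! m"] by simp
        qed (use w d in simp)
      qed (use d letter_index_nth[of "letters u"] in simp)
      then show "koszul_sign (\<lambda>_. 1) w * f w * ?\<phi> (eval_monomial ?T (\<lambda>x. ?e (?i x)) w) =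
          (if letters w = letters u then koszul_sign (\<lambda>_. 1) u * f w else 0)"
        using eval_triangular_cube[OF w(2), where a = "\<lambda>x. ?e (?i x)" and \<alpha> = "\<lambda>x. of_bool (?i x = 0)"
            and \<beta> = "\<lambda>x. of_bool (?i x = 1)" and \<gamma> = "\<lambda>x. of_bool (?i x = 2)"]
        by (auto simp: koszul_sign_letters)
    qed simp
    also have "\<dots> = koszul_sign (\<lambda>_. 1) u * (\<Sum>w\<in>{w \<in> ?W. letters w = letters u}. f w)"
      using ml by (simp add: sum_distrib_left multilinear_polynomial_def sum.If_cases Collect_conj_eq)
    finally show ?thesis
      by (simp add: koszul_sign_def)
  qed
  \<comment> \<open>An associative algebra does not distinguish the two bracketings of a word; the
    coefficients are therefore summed word by word.\<close>
  have "(\<Sum>w\<in>?W. f w) = (\<Sum>l\<in>letters ` ?W. \<Sum>w\<in>{w \<in> ?W. letters w = l}. f w)"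
    using ml by (intro sum.image_gen) (simp add: multilinear_polynomial_def)
  also have "\<dots> = 0"
    using zero by (intro sum.neutral) auto
  finally show ?thesis .
qed

context alt_metabelian_algebra_char_0
begin

text \<open>With \<open>v = pq\<close>, the sums \<open>(vy)z + (vz)y\<close> and
  \<open>(yv)z + (zv)y\<close> are zero by skew symmetry, and \<open>(yz)v\<close>,
  \<open>(zy)v\<close> by the metabelian law.\<close>

lemma symmetric_cube_product:
  assumes [simp]: "p \<in> carrier A" "q \<in> carrier A" "y \<in> carrier A" "z \<in> carrier A"
  shows "symmetric_cube (p \<otimes> q) y z = \<zero>"
proof (rule eq_by_functionals)
  fix \<phi> assume \<phi>: "linear_functional A \<phi>"
  interpret degree_four A \<phi>
    by unfold_locales (rule \<phi>)
  have v: "p \<otimes> q \<in> square_annihilator"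
    by (intro square_annihilator_mult) simp_all
  show "\<phi> (symmetric_cube (p \<otimes> q) y z) = \<phi> \<zero>"
    using functional_symmetric_cube[OF _ _ _ \<phi>, of "p \<otimes> q" y z] right_right_skew[OF \<phi> v, of y z]
      annihilated_products(2)[OF \<phi> v, of y z] annihilated_products(2)[OF \<phi> v, of z y]
      b_skew[of p q y z] by (simp add: functional_zero[OF \<phi>] b_def)
qed simp_all

lemma symmetric_cube_products:
  assumes "x \<in> carrier A" "y \<in> carrier A" "z \<in> carrier A" "p \<in> carrier A" "q \<in> carrier A"
    "p \<otimes> q \<in> {x, y, z}"
  shows "symmetric_cube x y z = \<zero>"
proof -
  from assms(6) consider "x = p \<otimes> q" | "y = p \<otimes> q" | "z = p \<otimes> q"
    by auto
  then show ?thesis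
  proof cases
    case 1
    then show ?thesis
      using assms symmetric_cube_product by simp
  next
    case 2
    then show ?thesis
      using assms symmetric_cube_product symmetric_cube_commute(2)[of x y z] by simp
  next
    case 3
    then show ?thesis
      using assms symmetric_cube_product symmetric_cube_commute(1)[of x y z]
        symmetric_cube_commute(2)[of x z y] by simp
  qed
qed

end

locale superalgebra_char_0 = superalgebra A
  for A :: "('f::field_char_0, 'a, 'm) superalgebra_scheme" (structure)

lemma (in superalgebra_char_0) symmetric_cube_equal_odd:
  fixes S T U :: "nat set"
  assumes "alt_metabelian_algebra_char_0 G"
    and fin: "finite S" "finite T" "finite U" and disj: "S \<inter> T = {}" "S \<inter> U = {}" "T \<inter> U = {}"
    and par: "(of_nat (card S) :: bit) = 1" "(of_nat (card T) :: bit) = 1" "(of_nat (card U) :: bit) = 1"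
    and xz: "x \<in> homog A 1" "z \<in> homog A 1"
  shows "alt_metabelian_algebra_char_0.symmetric_cube G (single S x) (single T x) (single U z) = \<zero>\<^bsub>G\<^esub>"
proof -
  interpret G: alt_metabelian_algebra_char_0 G by fact
  have h: "x \<in> homog A (of_nat (card S))" "x \<in> homog A (of_nat (card T))" "z \<in> homog A (of_nat (card U))"
    using xz par by simp_all
  note c = single_closed[OF fin(1) h(1)] single_closed[OF fin(2) h(2)] single_closed[OF fin(3) h(3)]
  have d: "T \<inter> S = {}" "U \<inter> S = {}" "U \<inter> T = {}"
    using disj by auto
  have un: "S \<union> U \<union> T = S \<union> T \<union> U" "T \<union> S \<union> U = S \<union> T \<union> U" "T \<union> U \<union> S = S \<union> T \<union> U"
    "U \<union> S \<union> T = S \<union> T \<union> U" "U \<union> T \<union> S = S \<union> T \<union> U"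
    by auto
  have ts: "triple_sign T S U = - triple_sign S T U" "triple_sign S U T = - triple_sign S T U"
    "triple_sign T U S = triple_sign S T U" "triple_sign U T S = - triple_sign U S T"
    using triple_sign_swap[OF fin disj] triple_sign_swap(2)[OF fin(2,1,3) d(1) disj(3,2)]
      triple_sign_swap(2)[OF fin(3,1,2) d(2,3) disj(1)] by (simp_all add: super_sign_def par)
  have xz' [simp]: "x \<in> carrier A" "z \<in> carrier A"
    using xz by (auto intro: homog_carrier)
  have neg: "\<theta> ((- k) \<odot>\<^bsub>A\<^esub> v) = - \<theta> (k \<odot>\<^bsub>A\<^esub> v)" if "linear_functional A \<theta>" "v \<in> carrier A" for \<theta> k v
    using that by (simp add: functional_smult)
  show ?thesis
  proof (rule envelope_eqI)
    show "G.symmetric_cube (single S x) (single T x) (single U z) \<in> carrier G" "\<zero>\<^bsub>G\<^esub> \<in> carrier G"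
      using G.cubic_closed(3)[OF c] env.zero_closed by simp_all
    fix P :: "nat set" and \<theta> assume \<theta>: "linear_functional A \<theta>"
    show "\<theta> (G.symmetric_cube (single S x) (single T x) (single U z) P) = \<theta> (\<zero>\<^bsub>G\<^esub> P)"
      using G.functional_symmetric_cube[OF c linear_functional_component[OF \<theta>, of P]]
        single_triple(1)[OF fin h disj] single_triple(1)[OF fin(1,3,2) h(1,3,2) disj(2,1) d(3)]
        single_triple(1)[OF fin(2,1,3) h(2,1,3) d(1) disj(3,2)] single_triple(1)[OF fin(2,3,1) h(2,3,1) disj(3) d(1,2)]
        single_triple(1)[OF fin(3,1,2) h(3,1,2) d(2,3) disj(1)] single_triple(1)[OF fin(3,2,1) h(3,2,1) d(3,2,1)]
      by (simp add: un ts single_def neg[OF \<theta>] functional_zero[OF \<theta>])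
  qed
qed

text \<open>Parities of the two factors of a monomial, which add up to its own parity. A generator
  counts as a left factor without a right one.\<close>

fun left_parity :: "(nat + nat) monomial \<Rightarrow> bit" where
  "left_parity (Gen x) = monomial_parity (Gen x)"
| "left_parity (Prod u v) = monomial_parity u"

fun right_parity :: "(nat + nat) monomial \<Rightarrow> bit" where
  "right_parity (Gen x) = 0"
| "right_parity (Prod u v) = monomial_parity v"

text \<open>A product \<open>x y\<close> with the Grassmann factor \<open>e\<^sub>S e\<^sub>T\<close> is the product of \<open>e\<^sub>S \<otimes> x\<close> and
  \<open>e\<^sub>T \<otimes> y\<close>, so that the symmetric cube vanishes there; of three odd generators two coincide.\<close>

lemma identities_0_2:
  fixes f :: "nat monomial \<Rightarrow> 'f::field_char_0"
  assumes ml: "multilinear_polynomial 3 f"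
    and cube: "\<And>J b. \<lbrakk>J \<in> alt_metabelian_ideals 0 2;
      \<And>i. b i \<in> carrier (grassmann_envelope (quotient_superalgebra (free_superalgebra 0 2) J))\<rbrakk> \<Longrightarrow>
      polynomial_value (grassmann_envelope (quotient_superalgebra (free_superalgebra 0 2) J)) f b =
      c \<odot>\<^bsub>grassmann_envelope (quotient_superalgebra (free_superalgebra 0 2) J)\<^esub>
      alt_metabelian_algebra_char_0.symmetric_cube
        (grassmann_envelope (quotient_superalgebra (free_superalgebra 0 2) J)) (b 0) (b 1) (b 2)"
  shows "identities 0 2 3 f"
  unfolding identities_iff
proof (intro conjI ballI ml)
  fix J :: "((nat + nat) monomial \<Rightarrow> 'f) set" assume JF: "J \<in> alt_metabelian_ideals 0 2"
  then have J: "graded_ideal J (free_superalgebra 0 2)"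
    by (simp add: alt_metabelian_ideals_def)
  let ?A = "free_superalgebra 0 2 :: ('f, _) superalgebra" and ?q = "\<lambda>h. J +>\<^bsub>free_superalgebra 0 2\<^esub> h"
  let ?Q = "quotient_superalgebra ?A J"
  interpret Q: superalgebra_char_0 ?Q
    by (rule superalgebra_char_0.intro[OF quotient_is_superalgebra[OF free_is_superalgebra J]])
  interpret G: alt_metabelian_algebra_char_0 Q.G
    by (rule envelope_alt_metabelian[OF JF])
  note qs = quotient_simps[OF free_is_superalgebra J]
  show "satisfies_superidentity ?Q 3 f"
  proof (rule superidentity_on_monomials[OF J ml])
    fix v :: "nat \<Rightarrow> (nat + nat) monomial" assume v: "\<And>i. i < 3 \<Longrightarrow> in_generators 0 2 (v i)"
    let ?p = "\<lambda>i. monomial_parity (v i)" and ?a = "\<lambda>i. ?q (basis_element (v i))"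
    \<comment> \<open>Argument \<open>i\<close> owns the Grassmann generators \<open>2 * i\<close>
      for its left factor and \<open>2 * i + 1\<close> for its right factor; this keeps the blocks
      of different arguments ordered.\<close>
    define S where "S i = (if left_parity (v i) = 1 then {2 * i} else {})" for i
    define T where "T i = (if right_parity (v i) = 1 then {2 * i + 1} else {})" for i
    have par: "monomial_parity w = left_parity w + right_parity w" for w
      by (cases w) (simp_all add: monomial_parity_simps del: add_bit_eq_xor)
    interpret B: parity_blocks ?Q "\<lambda>i. S i \<union> T i" ?p
      by unfold_locales (auto simp: S_def T_def par split: if_splits)
    have hom: "?q (basis_element w) \<in> homog ?Q (monomial_parity w)" if "in_generators 0 2 w" for w
      using basis_element_homog[OF that] by (auto simp: qs)
    define b where "b i = (if i < 3 then Q.single (S i \<union> T i) (?a i) else \<zero>\<^bsub>Q.G\<^esub>)" for i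
    have bG: "b i \<in> carrier Q.G" for i
      using Q.env.zero_closed hom[OF v] B.block_finite B.block_card
      by (auto simp: b_def intro!: Q.single_closed)
    have "G.symmetric_cube (b 0) (b 1) (b 2) = \<zero>\<^bsub>Q.G\<^esub>"
    proof (cases "\<exists>i<3. \<exists>u w. v i = Prod u w")
      case True
      then obtain i u w where i: "i < 3" "v i = Prod u w"
        by auto
      then have uw: "in_generators 0 2 u" "in_generators 0 2 w"
        using v[of i] by auto
      have hu: "?q (basis_element u) \<in> homog ?Q (of_nat (card (S i)))"
        "?q (basis_element w) \<in> homog ?Q (of_nat (card (T i)))"
        using hom[OF uw(1)] hom[OF uw(2)] i by (auto simp: S_def T_def)
      have fin: "finite (S i)" "finite (T i)" "S i \<inter> T i = {}"
        by (auto simp: S_def T_def)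
      have "basis_element u \<in> carrier ?A" "basis_element w \<in> carrier ?A"
        using basis_element_homog uw by (auto simp: free_homog)
      moreover have "basis_element (Prod u w) = basis_element u \<otimes>\<^bsub>?A\<^esub> basis_element w"
        by (auto simp: basis_element_def fun_eq_iff split: monomial.split)
      ultimately have "?a i = ?q (basis_element u) \<otimes>\<^bsub>?Q\<^esub> ?q (basis_element w)"
        using i by (simp add: qs)
      \<comment> \<open>The generator of the left factor precedes that of the right factor, so
        argument \<open>i\<close> is the product of the two factors without a sign.\<close>
      moreover have "(grassmann_sign (S i) (T i) :: 'f) = 1"
        by (rule grassmann_sign_less) (auto simp: S_def T_def split: if_splits)
      ultimately have "b i = Q.single (S i) (?q (basis_element u)) \<otimes>\<^bsub>Q.G\<^esub> Q.single (T i) (?q (basis_element w))"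
        using Q.single_mult[OF fin(1) hu(1) fin(2) hu(2)] fin(3) i
          hu[THEN Q.homog_carrier] by (simp add: b_def)
      moreover have "i \<in> {0, 1, 2}"
        using i by auto
      ultimately show ?thesis
        by (intro G.symmetric_cube_products[OF bG bG bG Q.single_closed[OF fin(1) hu(1)]
              Q.single_closed[OF fin(2) hu(2)]]) auto
    next
      case False
      have "\<exists>t<2. v i = Gen (Inr t)" if i: "i < 3" for i
      proof -
        obtain x where "v i = Gen x"
          using False i by (cases "v i") auto
        then show ?thesis
          using v[OF i] by (auto simp: generators_def)
      qed
      then obtain t where t: "\<And>i. i < 3 \<Longrightarrow> t i < 2 \<and> v i = Gen (Inr (t i))"
        by metis
      have b: "b i = Q.single {2 * i} (?q (basis_element (Gen (Inr (t i)))))" if "i < 3" for i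
        using t[OF that] that by (simp add: b_def S_def T_def monomial_parity_simps)
      have h1: "?q (basis_element (Gen (Inr (t i)))) \<in> homog ?Q 1" if "i < 3" for i
        using hom[OF v[OF that]] t[OF that] by (simp add: monomial_parity_simps)
      have eq: "G.symmetric_cube (b i) (b j) (b k) = \<zero>\<^bsub>Q.G\<^esub>"
        if "i < 3" "j < 3" "k < 3" "i \<noteq> j" "i \<noteq> k" "j \<noteq> k" "t i = t j" for i j k
        using Q.symmetric_cube_equal_odd[OF G.alt_metabelian_algebra_char_0_axioms,
            of "{2 * i}" "{2 * j}" "{2 * k}" "?q (basis_element (Gen (Inr (t j))))"
              "?q (basis_element (Gen (Inr (t k))))"] that h1 b[of i] b[of j] b[of k]
        by simp
      \<comment> \<open>Pigeonhole: three letters and two odd generators.\<close>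
      have "t 0 = t 1 \<or> t 0 = t 2 \<or> t 1 = t 2"
        using t[of 0] t[of 1] t[of 2] by auto
      then show ?thesis
        using eq[of 0 1 2] eq[of 0 2 1] eq[of 1 2 0] G.symmetric_cube_commute[of "b 0" "b 1" "b 2"]
          G.symmetric_cube_commute[of "b 1" "b 0" "b 2"] G.symmetric_cube_commute[of "b 0" "b 2" "b 1"]
          G.symmetric_cube_commute[of "b 1" "b 2" "b 0"] bG
        by auto
    qed
    then have "polynomial_value Q.G f b = \<zero>\<^bsub>Q.G\<^esub>"
      using cube[OF JF bG] by simp
    then show "superization_value ?Q f ?p ?a = \<zero>\<^bsub>?Q\<^esub>"
      using B.polynomial_value_envelope[OF ml, of ?a b] hom[OF v] by (simp add: b_def)
  qed
qed

definition cube_words :: "nat monomial set" where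
  "cube_words = {Prod (Prod (Gen 0) (Gen 1)) (Gen 2), Prod (Prod (Gen 0) (Gen 2)) (Gen 1),
    Prod (Prod (Gen 1) (Gen 0)) (Gen 2), Prod (Prod (Gen 1) (Gen 2)) (Gen 0),
    Prod (Prod (Gen 2) (Gen 0)) (Gen 1), Prod (Prod (Gen 2) (Gen 1)) (Gen 0)}"

definition linearised_cube :: "nat monomial \<Rightarrow> 'f::field" where
  "linearised_cube w = of_bool (w \<in> cube_words)"

lemma linearised_cube_support: "{w. linearised_cube w \<noteq> (0 :: 'f::field)} = cube_words"
  by (auto simp: linearised_cube_def)

lemma linearised_cube_multilinear: "multilinear_polynomial 3 linearised_cube"
  unfolding multilinear_polynomial_def linearised_cube_support
  by (auto simp: linearised_cube_def cube_words_def)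

lemma linearised_cube_sum:
  "(\<Sum>w\<in>{w. linearised_cube w \<noteq> (0 :: 'f::field_char_0)}. linearised_cube w) = (6 :: 'f)"
  unfolding linearised_cube_support by (simp add: linearised_cube_def) (simp add: cube_words_def)

text \<open>The value of this polynomial in an envelope is \<open>symmetric_cube\<close> itself, so
  the vanishing result applies with the factor 1.\<close>

lemma linearised_cube_identity: "identities 0 2 3 (linearised_cube :: _ \<Rightarrow> 'f::field_char_0)"
proof (rule identities_0_2[OF linearised_cube_multilinear])
  fix J :: "((nat + nat) monomial \<Rightarrow> 'f) set" and b :: "nat \<Rightarrow> _"
  let ?G = "grassmann_envelope (quotient_superalgebra (free_superalgebra 0 2) J)"
  assume J: "J \<in> alt_metabelian_ideals 0 2" and b: "\<And>i. b i \<in> carrier ?G"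
  interpret G: alt_metabelian_algebra_char_0 ?G
    by (rule envelope_alt_metabelian[OF J])
  have c: "eval_monomial ?G b w \<in> carrier ?G" for w
    by (intro G.eval_monomial_closed b)
  show "polynomial_value ?G linearised_cube b = 1 \<odot>\<^bsub>?G\<^esub> G.symmetric_cube (b 0) (b 1) (b 2)"
  proof (rule G.eq_by_functionals)
    fix \<phi> assume \<phi>: "linear_functional ?G \<phi>"
    have "\<phi> (polynomial_value ?G linearised_cube b) = (\<Sum>w\<in>cube_words. \<phi> (eval_monomial ?G b w))"
      unfolding polynomial_value_def linearised_cube_support
      by (subst G.functional_finsum[OF \<phi>]) (auto simp: c linearised_cube_def G.functional_smult[OF \<phi> c])
    then show "\<phi> (polynomial_value ?G linearised_cube b) = \<phi> (1 \<odot>\<^bsub>?G\<^esub> G.symmetric_cube (b 0) (b 1) (b 2))"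
      using G.functional_symmetric_cube[OF b b b \<phi>, of 0 1 2] G.smult_1[OF G.cubic_closed(3)[OF b b b]]
      by (simp add: cube_words_def add_ac)
  next
    show "polynomial_value ?G linearised_cube b \<in> carrier ?G"
      unfolding polynomial_value_def by (intro G.finsum_closed) (use c in blast)
    show "1 \<odot>\<^bsub>?G\<^esub> G.symmetric_cube (b 0) (b 1) (b 2) \<in> carrier ?G"
      by (intro G.smult_in G.cubic_closed b)
  qed
qed

section \<open>Polynomials separating the even free superalgebras\<close>

lemma letters_map_monomial: "letters (map_monomial h w) = map h (letters w)"
  by (induction w) simp_all

lemma eval_map_monomial: "eval_monomial A b (map_monomial h w) = eval_monomial A (\<lambda>x. b (h x)) w"
  by (induction w) simp_all

text \<open>With the empty set as Grassmann factor, the even part embeds into the envelope, where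
  the results on ordinary algebras apply.\<close>

lemma (in superalgebra) eval_monomial_even:
  assumes "\<And>x. x \<in> set (letters w) \<Longrightarrow> g x \<in> homog A 0"
  shows "eval_monomial G (\<lambda>x. single {} (g x)) w = single {} (eval_monomial A g w)"
  using assms
proof (induction w)
  case (Prod u v)
  have "eval_monomial A g w \<in> homog A 0" if "w = u \<or> w = v" for w
  proof -
    have "eval_monomial A g w \<in> homog A (\<Sum>x\<leftarrow>letters w. 0)"
      using that Prod.prems by (intro eval_monomial_homog) auto
    moreover have "(\<Sum>x\<leftarrow>l. 0 :: bit) = 0" for l :: "'c list"
      by (induction l) simp_all
    ultimately show ?thesis
      by simp
  qed
  then have h: "eval_monomial A g u \<in> homog A 0" "eval_monomial A g v \<in> homog A 0"
    by simp_all
  then show ?case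
    using Prod single_mult[of "{}" "eval_monomial A g u" "{}" "eval_monomial A g v"] h[THEN homog_carrier]
    by simp
qed simp

text \<open>With \<open>r\<close> even generators a monomial of degree at least \<open>r + 2\<close>
  has two surplus letters, and \<open>monomial_vanishes\<close> applies in the envelope. For
  \<open>r = 1\<close> the bound 4 is the stronger one: the cube of an even generator need not
  vanish.\<close>

lemma high_degree_vanishes:
  fixes J :: "((nat + nat) monomial \<Rightarrow> 'f::field_char_0) set"
  assumes JF: "J \<in> alt_metabelian_ideals r 0" and w: "in_generators r 0 w"
    and deg: "4 \<le> mdegree w" "r + 2 \<le> mdegree w"
  shows "J +>\<^bsub>free_superalgebra r 0\<^esub> basis_element w = \<zero>\<^bsub>quotient_superalgebra (free_superalgebra r 0) J\<^esub>"
proof -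
  have J: "graded_ideal J (free_superalgebra r 0)"
    using JF by (simp add: alt_metabelian_ideals_def)
  let ?A = "free_superalgebra r 0 :: ('f, _) superalgebra" and ?q = "\<lambda>h. J +>\<^bsub>free_superalgebra r 0\<^esub> h"
  let ?Q = "quotient_superalgebra ?A J"
  interpret Q: superalgebra ?Q
    by (rule quotient_is_superalgebra[OF free_is_superalgebra J])
  interpret G: alt_metabelian_algebra_char_0 Q.G
    by (rule envelope_alt_metabelian[OF JF])
  note qs = quotient_simps[OF free_is_superalgebra J]
  define g where "g x = ?q (basis_element (Gen x))" for x
  define h where "h x = (case x of Inl i \<Rightarrow> i | Inr i \<Rightarrow> i)" for x :: "nat + nat"
  define b where "b i = (if i < r then Q.single {} (g (Inl i)) else \<zero>\<^bsub>Q.G\<^esub>)" for i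
  have g: "g x \<in> homog ?Q 0" if "x \<in> generators r 0" for x
    using basis_element_homog[of "Gen x" r 0] that
    by (auto simp: g_def qs generators_def monomial_parity_simps)
  have "b i \<in> carrier Q.G" for i
    using g[of "Inl i"] Q.env.zero_closed by (auto simp: b_def generators_def intro!: Q.single_closed)
  moreover have "card (set (letters (map_monomial h w))) \<le> r"
  proof -
    have "set (letters (map_monomial h w)) \<subseteq> {..<r}"
      using w by (auto simp: letters_map_monomial generators_def h_def)
    then show ?thesis
      using card_mono[of "{..<r}"] by simp
  qed
  ultimately have "eval_monomial Q.G b (map_monomial h w) = \<zero>\<^bsub>Q.G\<^esub>"
    using deg by (intro G.monomial_vanishes) (simp_all add: letters_map_monomial)
  moreover have "eval_monomial Q.G b (map_monomial h w) = eval_monomial Q.G (\<lambda>x. Q.single {} (g x)) w"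
    unfolding eval_map_monomial using w
    by (intro eval_monomial_cong) (auto simp: b_def h_def generators_def)
  moreover have "eval_monomial Q.G (\<lambda>x. Q.single {} (g x)) w = Q.single {} (eval_monomial ?Q g w)"
    using g w by (intro Q.eval_monomial_even) auto
  ultimately have "Q.single {} (eval_monomial ?Q g w) = \<zero>\<^bsub>Q.G\<^esub>"
    by metis
  then have "eval_monomial ?Q g w = \<zero>\<^bsub>?Q\<^esub>"
    by (metis (no_types) Q.envelope_simps(1) Q.single_def)
  then show ?thesis
    using eval_quotient_generators[OF J w] by (simp add: g_def[abs_def])
qed

primrec substitute :: "('x \<Rightarrow> 'y monomial) \<Rightarrow> 'x monomial \<Rightarrow> 'y monomial" where
  "substitute v (Gen x) = v x"
| "substitute v (Prod u w) = Prod (substitute v u) (substitute v w)"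

lemma eval_substitute:
  "eval_monomial A (\<lambda>x. eval_monomial A g (v x)) w = eval_monomial A g (substitute v w)"
  by (induction w) simp_all

lemma letters_substitute: "letters (substitute v w) = concat (map (\<lambda>x. letters (v x)) (letters w))"
  by (induction w) simp_all

lemma mdegree_substitute: "mdegree w \<le> mdegree (substitute v w)"
proof (induction w)
  case (Gen x)
  show ?case
    using mdegree_ge_1[of "v x"] by simp
qed simp

lemma eval_basis_elements:
  fixes J :: "((nat + nat) monomial \<Rightarrow> 'f::field) set"
  assumes J: "graded_ideal J (free_superalgebra r s)"
    and v: "\<And>x. x \<in> set (letters w) \<Longrightarrow> in_generators r s (v x)"
  shows "eval_monomial (quotient_superalgebra (free_superalgebra r s) J)
    (\<lambda>x. J +>\<^bsub>free_superalgebra r s\<^esub> basis_element (v x)) w =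
    J +>\<^bsub>free_superalgebra r s\<^esub> basis_element (substitute v w)"
proof -
  let ?Q = "quotient_superalgebra (free_superalgebra r s) J"
  let ?g = "\<lambda>x. J +>\<^bsub>free_superalgebra r s\<^esub> basis_element (Gen x)"
  have "eval_monomial ?Q (\<lambda>x. J +>\<^bsub>free_superalgebra r s\<^esub> basis_element (v x)) w =
      eval_monomial ?Q (\<lambda>x. eval_monomial ?Q ?g (v x)) w"
    by (intro eval_monomial_cong) (simp add: eval_quotient_generators[OF J v])
  also have "\<dots> = eval_monomial ?Q ?g (substitute v w)"
    by (rule eval_substitute)
  also have "\<dots> = J +>\<^bsub>free_superalgebra r s\<^esub> basis_element (substitute v w)"
    using v by (intro eval_quotient_generators[OF J]) (auto simp: letters_substitute)
  finally show ?thesis .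
qed

primrec left_word :: "nat \<Rightarrow> nat monomial" where
  "left_word 0 = Gen 0"
| "left_word (Suc n) = Prod (left_word n) (Gen (Suc n))"

lemma letters_left_word: "letters (left_word n) = [0..<Suc n]"
  by (induction n) simp_all

lemma basis_element_multilinear:
  "distinct (letters w) \<Longrightarrow> set (letters w) = {..<n} \<Longrightarrow> multilinear_polynomial n (basis_element w)"
  unfolding multilinear_polynomial_def basis_element_support by (auto simp: basis_element_def)

lemma left_word_multilinear: "multilinear_polynomial (Suc n) (basis_element (left_word n))"
  by (rule basis_element_multilinear) (auto simp: letters_left_word)

lemma superization_value_basis_element:
  assumes "nonassoc_algebra A" "eval_monomial A a w \<in> carrier A"
  shows "superization_value A (basis_element w) p a = koszul_sign p w \<odot>\<^bsub>A\<^esub> eval_monomial A a w"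
proof -
  interpret nonassoc_algebra A by fact
  show ?thesis
    using assms(2) unfolding superization_value_def basis_element_support
    by (simp add: basis_element_def)
qed

lemma superization_value_basis_element_zero_iff:
  assumes "nonassoc_algebra A" "eval_monomial A a w \<in> carrier A"
  shows "superization_value A (basis_element w) p a = \<zero>\<^bsub>A\<^esub> \<longleftrightarrow> eval_monomial A a w = \<zero>\<^bsub>A\<^esub>"
proof -
  interpret nonassoc_algebra A by fact
  have "koszul_sign p w \<odot>\<^bsub>A\<^esub> (koszul_sign p w \<odot>\<^bsub>A\<^esub> eval_monomial A a w) = eval_monomial A a w"
    using assms(2) by (simp add: koszul_sign_letters koszul_list_square flip: smult_mult)
  then show ?thesis
    unfolding superization_value_basis_element[OF assms] by (metis smult_zero)
qed

text \<open>Substituting monomials does not lower the degree, which stays at least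
  \<open>r + 2\<close>; for \<open>2 \<le> r\<close> this includes the bound 4.\<close>

lemma left_word_identity:
  assumes "2 \<le> r"
  shows "identities r 0 (r + 2) (basis_element (left_word (r + 1)) :: _ \<Rightarrow> 'f::field_char_0)"
  unfolding identities_iff
proof (intro conjI ballI)
  show ml: "multilinear_polynomial (r + 2) (basis_element (left_word (r + 1)) :: _ \<Rightarrow> 'f)"
    using left_word_multilinear[of "r + 1"] by simp
  fix J :: "((nat + nat) monomial \<Rightarrow> 'f) set" assume JF: "J \<in> alt_metabelian_ideals r 0"
  then have J: "graded_ideal J (free_superalgebra r 0)"
    by (simp add: alt_metabelian_ideals_def)
  let ?Q = "quotient_superalgebra (free_superalgebra r 0) J"
  interpret Q: superalgebra ?Q
    by (rule quotient_is_superalgebra[OF free_is_superalgebra J])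
  show "satisfies_superidentity ?Q (r + 2) (basis_element (left_word (r + 1)))"
  proof (rule superidentity_on_monomials[OF J ml])
    fix v assume v: "\<And>i. i < r + 2 \<Longrightarrow> in_generators r 0 (v i)"
    have "eval_monomial ?Q (\<lambda>i. J +>\<^bsub>free_superalgebra r 0\<^esub> basis_element (v i)) (left_word (r + 1)) = \<zero>\<^bsub>?Q\<^esub>"
    proof -
      have "in_generators r 0 (substitute v (left_word (r + 1)))"
      proof
        fix x assume "x \<in> set (letters (substitute v (left_word (r + 1))))"
        then obtain i where "i \<in> set [0..<Suc (r + 1)]" "x \<in> set (letters (v i))"
          unfolding letters_substitute letters_left_word by (auto simp del: upt_Suc)
        then have "i < r + 2" "x \<in> set (letters (v i))"
          by auto
        then show "x \<in> generators r 0"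
          using v by blast
      qed
      moreover have "r + 2 \<le> mdegree (substitute v (left_word (r + 1)))"
        using mdegree_substitute[of "left_word (r + 1)" v] by (simp add: letters_left_word)
      ultimately have "J +>\<^bsub>free_superalgebra r 0\<^esub> basis_element (substitute v (left_word (r + 1))) = \<zero>\<^bsub>?Q\<^esub>"
        using assms by (intro high_degree_vanishes[OF JF]) auto
      moreover have "in_generators r 0 (v i)" if "i \<in> set (letters (left_word (r + 1)))" for i
        using v[of i] that unfolding letters_left_word by auto
      ultimately show ?thesis
        by (subst eval_basis_elements[OF J]) simp_all
    qed
    then show "superization_value ?Q (basis_element (left_word (r + 1))) (\<lambda>i. monomial_parity (v i))
        (\<lambda>i. J +>\<^bsub>free_superalgebra r 0\<^esub> basis_element (v i)) = \<zero>\<^bsub>?Q\<^esub>"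
      by (simp add: superization_value_basis_element[OF Q.nonassoc_algebra_axioms] del: left_word.simps)
  qed
qed

text \<open>All letters are evaluated at the odd generator of \<open>chain_algebra\<close>, whose
  left-normed powers are the nonzero elements \<open>e_n\<close>.\<close>

lemma left_word_not_identity_odd:
  "\<not> identities 0 1 (Suc (Suc n)) (basis_element (left_word (Suc n)) :: _ \<Rightarrow> 'f::field_char_0)"
proof
  let ?C = "chain_algebra :: ('f, 'f chain_element) superalgebra"
  assume f: "identities 0 1 (Suc (Suc n)) (basis_element (left_word (Suc n)) :: _ \<Rightarrow> 'f)"
  have "homogeneous_images ?C 0 1 (\<lambda>_. chain_generator)"
    by (simp add: homogeneous_images_def chain_generator_def)
  then have "superization_value ?C (basis_element (left_word (Suc n))) (\<lambda>j. monomial_parity (Gen (Inr 0)))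
      (\<lambda>j. eval_monomial ?C (\<lambda>_. chain_generator) (Gen (Inr (0 :: nat)) :: (nat + nat) monomial)) = \<zero>\<^bsub>?C\<^esub>"
    by (intro identities_evaluate_monomials[OF f chain_super_laws]) (auto simp: generators_def)
  then have "eval_monomial ?C (\<lambda>_. chain_generator) (left_word (Suc n)) = \<zero>\<^bsub>?C\<^esub>"
    using superization_value_basis_element_zero_iff[OF chain_nonassoc_algebra,
        of "\<lambda>_. chain_generator :: 'f chain_element" "left_word (Suc n)"] by simp
  moreover have "eval_monomial ?C (\<lambda>_. chain_generator) (left_word (Suc n)) = chain_word n (1, 0)"
    by (induction n) (simp_all add: chain_word_products)
  ultimately show False
    by (auto simp: chain_word_def dest: fun_cong[of _ _ n])
qed

text \<open>In the envelope of \<open>chain_algebra\<close> take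
  \<open>X_i = e_i \<otimes> x\<close>. One generator has to occur twice, but
  \<open>X_0 X_0 = 0\<close>; therefore \<open>U = 1 \<otimes> x^2\<close> is added to
  \<open>X_0\<close>. Then \<open>(U + X_0)^2 = U X_0 + X_0 U\<close> has the coefficient
  \<open>1 + \<tau>\<close>, and the other \<open>X_i\<close> only lengthen the chain.\<close>

lemma left_word_not_identity_even:
  "\<not> identities (r + 1) 0 (r + 2) (basis_element (left_word (r + 1)) :: _ \<Rightarrow> 'f::field_char_0)"
proof
  let ?C = "chain_algebra :: ('f, 'f chain_element) superalgebra"
  assume f: "identities (r + 1) 0 (r + 2) (basis_element (left_word (r + 1)) :: _ \<Rightarrow> 'f)"
  interpret C: superalgebra ?C
    by (rule chain_superalgebra)
  interpret G: alt_metabelian_algebra_char_0 C.G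
    using super_laws_imp_alt_metabelian[of ?C, OF chain_super_laws]
    by (simp add: alt_metabelian_superalgebra_def alt_metabelian_algebra_char_0_def)
  let ?M = "even_superalgebra C.G"
  have M: "super_laws ?M"
    by (rule even_superalgebra_super_laws) unfold_locales
  let ?U = "C.single {} (chain_word 0 (1, 0))" and ?X = "\<lambda>i. C.single {i} chain_generator"
  let ?g = "\<lambda>i. if i = 0 then ?U \<oplus>\<^bsub>C.G\<^esub> ?X 0 else ?X i"
  have hom: "chain_word m k \<in> homog ?C (of_nat m)" "chain_generator \<in> homog ?C 1" for m k
    by (auto simp: chain_word_def chain_generator_def of_nat_bit)
  have U: "?U \<in> carrier C.G"
    using hom(1)[of 0] by (intro C.single_closed) simp_all
  have V: "?X i \<in> carrier C.G" for i
    using hom(2) by (intro C.single_closed) simp_all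
  let ?h = "\<lambda>x :: nat + nat. case x of Inl i \<Rightarrow> ?g i | Inr i \<Rightarrow> \<zero>\<^bsub>C.G\<^esub>"
  have g: "?g i \<in> carrier C.G" for i
    using U V C.env.a_closed[OF U V] by simp
  then have "homogeneous_images ?M (r + 1) 0 ?h"
    by (simp add: homogeneous_images_def)
  \<comment> \<open>Truncated subtraction sends the letters 0 and 1 to the same generator, so that
    \<open>r + 2\<close> letters use \<open>r + 1\<close> generators.\<close>
  then have "superization_value ?M (basis_element (left_word (r + 1))) (\<lambda>j. monomial_parity (Gen (Inl (j - 1))))
      (\<lambda>j. eval_monomial ?M ?h (Gen (Inl (j - 1)))) = \<zero>\<^bsub>?M\<^esub>"
    by (intro identities_evaluate_monomials[OF f M]) (auto simp: generators_def)
  moreover have "nonassoc_algebra ?M"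
    using M by (simp add: super_laws_def superalgebra_def)
  moreover have "eval_monomial ?M (\<lambda>j. ?g (j - 1)) (left_word (r + 1)) \<in> carrier ?M"
    using g unfolding eval_monomial_even_superalgebra even_superalgebra_simps by (intro C.env.eval_monomial_closed)
  ultimately have zero: "eval_monomial C.G (\<lambda>j. ?g (j - 1)) (left_word (r + 1)) = \<zero>\<^bsub>C.G\<^esub>"
    using superization_value_basis_element_zero_iff[of ?M "\<lambda>j. ?g (j - 1)" "left_word (r + 1)"]
    by (simp add: eval_monomial_even_superalgebra del: left_word.simps C.envelope_simps cong: if_cong)
  have "eval_monomial C.G (\<lambda>j. ?g (j - 1)) (left_word (Suc k)) = C.single {0..k} (chain_word (Suc k) (1, 1))" for k
  proof (induction k)
    case 0
    have "chain_word 0 (1, 0) \<otimes>\<^bsub>?C\<^esub> chain_word 0 (1, 0) = chain_word 0 (0, 0)"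
      by (rule chain_word_products(4)) (simp add: chain_word_def)
    also have "\<dots> = \<zero>\<^bsub>?C\<^esub>"
      by (auto simp: chain_word_def)
    finally have "?U \<otimes>\<^bsub>C.G\<^esub> ?U = C.single {} \<zero>\<^bsub>?C\<^esub>"
      using C.single_mult[of "{}" "chain_word 0 (1, 0)" "{}" "chain_word 0 (1, 0)"] hom(1)[of 0]
        C.smult_zero by (simp del: chain_simps)
    then have "?U \<otimes>\<^bsub>C.G\<^esub> ?U = \<zero>\<^bsub>C.G\<^esub>"
      by (simp add: C.single_def fun_eq_iff)
    moreover have "?U \<otimes>\<^bsub>C.G\<^esub> ?X 0 = C.single {0} (chain_word 1 (1, 0))"
      "?X 0 \<otimes>\<^bsub>C.G\<^esub> ?U = C.single {0} (chain_word 1 (0, 1))"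
      using C.single_mult[of "{}" "chain_word 0 (1, 0)" "{0}" chain_generator] hom(1)[of 0] hom(2)
        C.single_mult[of "{0}" chain_generator "{}" "chain_word 0 (1, 0)"] C.smult_1
      by (simp_all add: chain_word_products twist_def)
    moreover have "?X 0 \<otimes>\<^bsub>C.G\<^esub> ?X 0 = \<zero>\<^bsub>C.G\<^esub>"
      using C.single_mult[of "{0}" chain_generator "{0}" chain_generator] hom(2) by simp
    moreover have "(?U \<oplus>\<^bsub>C.G\<^esub> ?X 0) \<otimes>\<^bsub>C.G\<^esub> (?U \<oplus>\<^bsub>C.G\<^esub> ?X 0) =
        (?U \<otimes>\<^bsub>C.G\<^esub> ?U \<oplus>\<^bsub>C.G\<^esub> ?X 0 \<otimes>\<^bsub>C.G\<^esub> ?U) \<oplus>\<^bsub>C.G\<^esub> (?U \<otimes>\<^bsub>C.G\<^esub> ?X 0 \<oplus>\<^bsub>C.G\<^esub> ?X 0 \<otimes>\<^bsub>C.G\<^esub> ?X 0)"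
      using U V[of 0] C.env.a_closed[OF U V]
      by (simp only: C.env.mult_add_left C.env.mult_add_right)
    ultimately have "(?U \<oplus>\<^bsub>C.G\<^esub> ?X 0) \<otimes>\<^bsub>C.G\<^esub> (?U \<oplus>\<^bsub>C.G\<^esub> ?X 0) =
        (\<zero>\<^bsub>C.G\<^esub> \<oplus>\<^bsub>C.G\<^esub> C.single {0} (chain_word 1 (0, 1))) \<oplus>\<^bsub>C.G\<^esub> (C.single {0} (chain_word 1 (1, 0)) \<oplus>\<^bsub>C.G\<^esub> \<zero>\<^bsub>C.G\<^esub>)"
      by simp
    also have "\<dots> = C.single {0} (chain_word 1 (1, 1))"
      by (auto simp: C.single_def chain_word_def fun_eq_iff)
    finally show ?case
      by simp
  next
    case (Suc k)
    have "(of_nat (card {0..k}) :: bit) = of_nat (Suc k)"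
      by simp
    then have "chain_word (Suc k) (1, 1) \<in> homog ?C (of_nat (card {0..k}))"
      using hom(1)[of "Suc k"] by metis
    then have "C.single {0..k} (chain_word (Suc k) (1, 1)) \<otimes>\<^bsub>C.G\<^esub> ?X (Suc k) =
        C.single ({0..k} \<union> {Suc k}) (grassmann_sign {0..k} {Suc k} \<odot>\<^bsub>?C\<^esub> chain_word (Suc (Suc k)) (1, 1))"
      using C.single_mult[of "{0..k}" "chain_word (Suc k) (1, 1)" "{Suc k}" chain_generator] hom(2)
      by (simp add: chain_word_products)
    moreover have "grassmann_sign {0..k} {Suc k} = (1 :: 'f)"
      by (rule grassmann_sign_less) auto
    moreover have "{0..k} \<union> {Suc k} = {0..Suc k}"
      by auto
    ultimately show ?case
      using Suc C.smult_1 by simp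
  qed
  from this[of r] zero have "C.single {0..r} (chain_word (Suc r) (1, 1)) {0..r} = \<zero>\<^bsub>?C\<^esub>"
    by (simp del: left_word.simps)
  then show False
    by (auto simp: C.single_def chain_word_def dest: fun_cong[of _ _ "Suc r"])
qed

text \<open>A separate polynomial for \<open>r = 1\<close>, where the left-normed word of degree
  \<open>r + 2 = 3\<close> does not vanish on the even generator.\<close>

definition inner_commutator :: "nat monomial \<Rightarrow> 'f::field" where
  "inner_commutator w = of_bool (w = Prod (Gen 0) (Prod (Gen 1) (Gen 2))) -
    of_bool (w = Prod (Gen 0) (Prod (Gen 2) (Gen 1)))"

lemma inner_commutator_support: "{w. inner_commutator w \<noteq> (0 :: 'f::field)} =
    {Prod (Gen 0) (Prod (Gen 1) (Gen 2)), Prod (Gen 0) (Prod (Gen 2) (Gen 1))}"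
  by (auto simp: inner_commutator_def)

lemma inner_commutator_multilinear: "multilinear_polynomial 3 inner_commutator"
  unfolding multilinear_polynomial_def inner_commutator_support
  by (auto simp: inner_commutator_def of_bool_def split: if_splits)

lemma functional_inner_commutator:
  fixes A :: "('f::field, 'a, 'm) module_scheme" (structure)
  assumes "nonassoc_algebra A" "\<And>i. i < 3 \<Longrightarrow> a i \<in> carrier A" "linear_functional A \<phi>"
  shows "\<phi> (superization_value A inner_commutator p a) = \<phi> (a 0 \<otimes> (a 1 \<otimes> a 2)) -
    koszul_sign p (Prod (Gen 0) (Prod (Gen 2) (Gen 1))) * \<phi> (a 0 \<otimes> (a 2 \<otimes> a 1))"
  using functional_superization_value[OF assms(1) inner_commutator_multilinear assms(2,3)]
  by (simp add: inner_commutator_support)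
    (simp add: inner_commutator_def koszul_sign_letters koszul_list_Cons)

lemma monomial_parity_even: "in_generators r 0 w \<Longrightarrow> monomial_parity w = 0"
proof (induction w)
  case (Gen x)
  then show ?case
    by (auto simp: generators_def monomial_parity_simps)
qed (simp add: monomial_parity_simps)

text \<open>Either all three monomials are the one generator and both terms agree, or the total
  degree is at least 4 and both terms vanish.\<close>

lemma inner_commutator_identity: "identities 1 0 3 (inner_commutator :: _ \<Rightarrow> 'f::field_char_0)"
  unfolding identities_iff
proof (intro conjI ballI inner_commutator_multilinear)
  fix J :: "((nat + nat) monomial \<Rightarrow> 'f) set" assume JF: "J \<in> alt_metabelian_ideals 1 0"
  then have J: "graded_ideal J (free_superalgebra 1 0)"
    by (simp add: alt_metabelian_ideals_def)
  let ?Q = "quotient_superalgebra (free_superalgebra 1 0) J" and ?q = "\<lambda>h. J +>\<^bsub>free_superalgebra 1 0\<^esub> h"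
  interpret Q: superalgebra ?Q
    by (rule quotient_is_superalgebra[OF free_is_superalgebra J])
  show "satisfies_superidentity ?Q 3 inner_commutator"
  proof (rule superidentity_on_monomials[OF J inner_commutator_multilinear])
    fix v :: "nat \<Rightarrow> _" assume v: "\<And>i. i < 3 \<Longrightarrow> in_generators 1 0 (v i)"
    let ?a = "\<lambda>i. ?q (basis_element (v i))" and ?p = "\<lambda>i. monomial_parity (v i)"
    have c: "?a i \<in> carrier ?Q" if "i < 3" for i
    proof -
      have "(basis_element (v i) :: _ \<Rightarrow> 'f) \<in> homog (free_superalgebra 1 0) (monomial_parity (v i))"
        by (rule basis_element_homog[OF v[OF that]])
      then show ?thesis
        unfolding quotient_simps(1)[OF free_is_superalgebra J] by (intro imageI) (simp add: free_homog)
    qed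
    have sub: "?a i \<otimes>\<^bsub>?Q\<^esub> (?a j \<otimes>\<^bsub>?Q\<^esub> ?a k) = ?q (basis_element (Prod (v i) (Prod (v j) (v k))))"
      if "i < 3" "j < 3" "k < 3" for i j k
      using eval_basis_elements[OF J, of "Prod (Gen i) (Prod (Gen j) (Gen k))" v] v that by auto
    have "koszul_sign ?p w = (1 :: 'f)" if "set (letters w) \<subseteq> {..<3}" for w
      unfolding koszul_sign_letters
    proof (rule koszul_list_even)
      fix i assume "i \<in> set (letters w)"
      then show "?p i = 0"
        using v that by (intro monomial_parity_even) blast
    qed
    then have sign: "koszul_sign ?p (Prod (Gen 0) (Prod (Gen 2) (Gen 1))) = (1 :: 'f)"
      by simp
    have eq: "?q (basis_element (Prod (v 0) (Prod (v 1) (v 2)))) = ?q (basis_element (Prod (v 0) (Prod (v 2) (v 1))))"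
    proof (cases "mdegree (v 0) = 1 \<and> mdegree (v 1) = 1 \<and> mdegree (v 2) = 1")
      case True
      then have "v i = Gen (Inl 0)" if "i < 3" for i
      proof -
        have "i = 0 \<or> i = 1 \<or> i = 2"
          using that by auto
        then obtain x where "v i = Gen x"
          using True unfolding mdegree_eq_1 by blast
        then show ?thesis
          using v[OF that] by (auto simp: generators_def)
      qed
      then show ?thesis
        by simp
    next
      case False
      then have deg: "4 \<le> mdegree (v 0) + mdegree (v 1) + mdegree (v 2)"
        using mdegree_ge_1[of "v 0"] mdegree_ge_1[of "v 1"] mdegree_ge_1[of "v 2"] by linarith
      then have "?q (basis_element (Prod (v 0) (Prod (v 1) (v 2)))) = \<zero>\<^bsub>?Q\<^esub>"
        "?q (basis_element (Prod (v 0) (Prod (v 2) (v 1)))) = \<zero>\<^bsub>?Q\<^esub>"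
        using v by (intro high_degree_vanishes[OF JF]; simp)+
      then show ?thesis
        by simp
    qed
    show "superization_value ?Q inner_commutator ?p ?a = \<zero>\<^bsub>?Q\<^esub>"
    proof (rule Q.eq_by_functionals)
      fix \<phi> assume \<phi>: "linear_functional ?Q \<phi>"
      show "\<phi> (superization_value ?Q inner_commutator ?p ?a) = \<phi> \<zero>\<^bsub>?Q\<^esub>"
        using functional_inner_commutator[OF Q.nonassoc_algebra_axioms c \<phi>, where p = ?p]
          sub[of 0 1 2] sub[of 0 2 1] eq sign Q.functional_zero[OF \<phi>] by simp
    next
      show "superization_value ?Q inner_commutator ?p ?a \<in> carrier ?Q"
        by (rule superization_value_closed[OF Q.nonassoc_algebra_axioms inner_commutator_multilinear c])
      show "\<zero>\<^bsub>?Q\<^esub> \<in> carrier ?Q"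
        by (rule Q.zero_closed)
    qed
  qed
qed

text \<open>For odd arguments the Koszul sign turns the difference into a sum: at the generator
  \<open>x\<close> the value is \<open>2 x(xx)\<close>, whose component at \<tau> and index 1 is
  2.\<close>

lemma inner_commutator_not_identity_odd:
  "\<not> identities 0 1 3 (inner_commutator :: _ \<Rightarrow> 'f::field_char_0)"
proof
  let ?C = "chain_algebra :: ('f, 'f chain_element) superalgebra"
  let ?\<phi> = "\<lambda>x :: 'f chain_element. snd (snd x) 1"
  assume f: "identities 0 1 3 (inner_commutator :: _ \<Rightarrow> 'f)"
  have "homogeneous_images ?C 0 1 (\<lambda>_. chain_generator)"
    by (simp add: homogeneous_images_def chain_generator_def)
  then have "superization_value ?C inner_commutator (\<lambda>j. monomial_parity (Gen (Inr 0)))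
      (\<lambda>j. eval_monomial ?C (\<lambda>_. chain_generator) (Gen (Inr (0 :: nat)) :: (nat + nat) monomial)) = \<zero>\<^bsub>?C\<^esub>"
    by (intro identities_evaluate_monomials[OF f chain_super_laws]) (auto simp: generators_def)
  moreover have "linear_functional ?C ?\<phi>"
    by (auto simp: linear_functional_def)
  ultimately show False
    using functional_inner_commutator[OF chain_nonassoc_algebra, where a = "\<lambda>_. chain_generator :: 'f chain_element" and \<phi> = ?\<phi> and p = "\<lambda>_. 1"]
    by (simp add: monomial_parity_simps koszul_sign_letters koszul_list_Cons chain_word_products)
      (simp add: chain_word_def twist_def)
qed

lemma inner_commutator_not_identity_even:
  "\<not> identities 2 0 3 (inner_commutator :: _ \<Rightarrow> 'f::field_char_0)"
proof
  let ?T = "triangular_algebra False :: ('f, 'f triangular) superalgebra"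
  \<comment> \<open>The letters 0 and 2 become \<open>x = E_12 + E_34\<close> and the letter 1
    becomes \<open>y = E_23\<close>; then \<open>x(yx) = E_14\<close>, whereas
    \<open>x(xy) = 0\<close>.\<close>
  let ?g = "\<lambda>x :: nat + nat. case x of Inl i \<Rightarrow> (if i = 0 then (1, 0, 1, 0, 0, 0) else (0, 1, 0, 0, 0, 0) :: 'f triangular)
    | Inr _ \<Rightarrow> (0, 0, 0, 0, 0, 0)"
  let ?v = "\<lambda>j :: nat. Gen (Inl (if j = 1 then 1 else 0)) :: (nat + nat) monomial"
  assume f: "identities 2 0 3 (inner_commutator :: _ \<Rightarrow> 'f)"
  have "homogeneous_images ?T 2 0 ?g"
    by (simp add: homogeneous_images_def triangular_homog)
  then have "superization_value ?T inner_commutator (\<lambda>j. monomial_parity (?v j))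
      (\<lambda>j. eval_monomial ?T ?g (?v j)) = \<zero>\<^bsub>?T\<^esub>"
    by (intro identities_evaluate_monomials[OF f triangular_super_laws]) (auto simp: generators_def)
  then show False
    using functional_inner_commutator[OF triangular_nonassoc_algebra[of False] _ linear_functional_triangular,
        where a = "\<lambda>j. eval_monomial ?T ?g (?v j)" and p = "\<lambda>j. monomial_parity (?v j)"]
    by simp
qed

section \<open>Superalgebras on a given type\<close>

text \<open>Members of a supervariety have their carrier in \<open>'u\<close>, whereas the free
  superalgebra consists of cosets of polynomials; its structure is copied along an injection of the
  carrier.\<close>

lemma transport_superalgebra:
  fixes A :: "('f::field, 'a) superalgebra" and e :: "'a \<Rightarrow> 'u"
  assumes A: "superalgebra A" and e: "inj_on e (carrier A)"
  obtains A' :: "('f, 'u) superalgebra" where "superalgebra A'"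
    "\<And>n f. multilinear_polynomial n f \<Longrightarrow> satisfies_superidentity A' n f \<longleftrightarrow> satisfies_superidentity A n f"
proof
  interpret A: superalgebra A by (rule A)
  let ?d = "inv_into (carrier A) e"
  let ?B = "\<lparr>carrier = e ` carrier A, monoid.mult = (\<lambda>x y. e (?d x \<otimes>\<^bsub>A\<^esub> ?d y)), one = undefined,
    ring.zero = e \<zero>\<^bsub>A\<^esub>, add = (\<lambda>x y. e (?d x \<oplus>\<^bsub>A\<^esub> ?d y)), module.smult = (\<lambda>c x. e (c \<odot>\<^bsub>A\<^esub> ?d x)),
    homog = (\<lambda>i. e ` homog A i)\<rparr> :: ('f, 'u) superalgebra"
  have d [simp]: "?d (e x) = x" if "x \<in> carrier A" for x
    using e that by (rule inv_into_f_f)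
  show B: "superalgebra ?B"
  proof (rule superalgebra_image[OF A, where h = e])
    fix x y assume xy: "x \<in> homog A 0" "y \<in> homog A 1" "e x = e y"
    then have "x = y"
      using e A.homog_carrier by (metis inj_onD)
    then have "x \<in> homog A 0 \<inter> homog A 1"
      using xy by simp
    then show "e x = e \<zero>\<^bsub>A\<^esub>"
      using A.homog_disjoint by simp
  qed simp_all
  then interpret B: superalgebra ?B .
  have hom: "algebra_hom A ?B e"
    by (simp add: algebra_hom_def)
  fix n and f :: "nat monomial \<Rightarrow> 'f" assume f: "multilinear_polynomial n f"
  have val: "superization_value ?B f p (\<lambda>i. e (a i)) = \<zero>\<^bsub>?B\<^esub> \<longleftrightarrow> superization_value A f p a = \<zero>\<^bsub>A\<^esub>"
    if a: "\<And>i. i < n \<Longrightarrow> a i \<in> homog A (p i)" for p a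
  proof -
    have c: "a i \<in> carrier A" if "i < n" for i
      using a[OF that] A.homog_carrier by blast
    have "superization_value ?B f p (\<lambda>i. e (a i)) = e (superization_value A f p a)"
      by (rule superization_value_hom[OF A.nonassoc_algebra_axioms B.nonassoc_algebra_axioms hom f c])
    moreover have "superization_value A f p a \<in> carrier A"
      by (rule superization_value_closed[OF A.nonassoc_algebra_axioms f c])
    ultimately show ?thesis
      using inj_onD[OF e, of "superization_value A f p a" "\<zero>\<^bsub>A\<^esub>"] by auto
  qed
  show "satisfies_superidentity ?B n f \<longleftrightarrow> satisfies_superidentity A n f"
    unfolding satisfies_superidentity_def
  proof (intro iffI allI impI)
    fix p a assume *: "\<forall>p a. (\<forall>i<n. a i \<in> homog ?B (p i)) \<longrightarrow> superization_value ?B f p a = \<zero>\<^bsub>?B\<^esub>"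
      and a: "\<forall>i<n. a i \<in> homog A (p i)"
    then have "superization_value ?B f p (\<lambda>i. e (a i)) = \<zero>\<^bsub>?B\<^esub>"
      by simp
    then show "superization_value A f p a = \<zero>\<^bsub>A\<^esub>"
      using val[of a p] a by blast
  next
    fix p a assume *: "\<forall>p a. (\<forall>i<n. a i \<in> homog A (p i)) \<longrightarrow> superization_value A f p a = \<zero>\<^bsub>A\<^esub>"
      and a: "\<forall>i<n. a i \<in> homog ?B (p i)"
    have da: "?d (a i) \<in> homog A (p i) \<and> e (?d (a i)) = a i" if "i < n" for i
      using a that A.homog_carrier by (auto dest!: spec[of _ i])
    then have h: "?d (a i) \<in> homog A (p i)" if "i < n" for i
      using that by blast
    have "superization_value A f p (\<lambda>i. ?d (a i)) = \<zero>\<^bsub>A\<^esub>"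
      by (rule *[rule_format]) (rule h)
    moreover have "superization_value ?B f p (\<lambda>i. e (?d (a i))) = \<zero>\<^bsub>?B\<^esub> \<longleftrightarrow>
        superization_value A f p (\<lambda>i. ?d (a i)) = \<zero>\<^bsub>A\<^esub>"
      by (rule val) (rule h)
    ultimately have "superization_value ?B f p (\<lambda>i. e (?d (a i))) = \<zero>\<^bsub>?B\<^esub>"
      by (rule iffD2[rotated])
    moreover have "superization_value ?B f p a = superization_value ?B f p (\<lambda>i. e (?d (a i)))"
    proof (rule superization_value_cong[OF B.nonassoc_algebra_axioms f])
      fix i assume i: "i < n"
      show "a i = e (?d (a i))"
        using da[OF i] by simp
      have "?d (a i) \<in> carrier A"
        using h[OF i] A.homog_carrier by blast
      then show "e (?d (a i)) \<in> carrier ?B"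
        unfolding partial_object.simps by (rule imageI)
    qed
    ultimately show "superization_value ?B f p a = \<zero>\<^bsub>?B\<^esub>"
      by simp
  qed
qed

text \<open>The pairing function \<open>q\<close> folds a list into one scalar. The code does not
  reveal the length, which is therefore stored beside it.\<close>

primrec encode_list :: "('f \<times> 'f \<Rightarrow> 'f) \<Rightarrow> 'f \<Rightarrow> 'f list \<Rightarrow> 'f" where
  "encode_list q z [] = z"
| "encode_list q z (x # xs) = q (x, encode_list q z xs)"

text \<open>The distinct tags 0 and 1 tell products from generators and odd generators from even
  ones. The indices are coded by \<open>of_nat\<close>, which is injective in characteristic
  0.\<close>

primrec encode_monomial :: "('f::field_char_0 \<times> 'f \<Rightarrow> 'f) \<Rightarrow> (nat + nat) monomial \<Rightarrow> 'f" where
  "encode_monomial q (Gen x) = q (0, case x of Inl i \<Rightarrow> q (0, of_nat i) | Inr i \<Rightarrow> q (1, of_nat i))"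
| "encode_monomial q (Prod u v) = q (1, q (encode_monomial q u, encode_monomial q v))"

lemma encode_list_inject:
  assumes q: "inj q" and xs: "length xs = length ys" "encode_list q z xs = encode_list q z ys"
  shows "xs = ys"
  using xs by (induction xs ys rule: list_induct2) (auto dest: injD[OF q])

lemma encode_monomial_inject:
  assumes q: "inj q"
  shows "encode_monomial q u = encode_monomial q v \<Longrightarrow> u = v"
proof (induction u arbitrary: v)
  case (Gen x)
  then show ?case
    by (cases v) (auto dest!: injD[OF q] split: sum.splits)
next
  case (Prod u1 u2)
  then show ?case
    by (cases v) (auto dest!: injD[OF q])
qed

text \<open>A field of characteristic 0 is infinite and hence in bijection with its square. A
  finitely supported function is determined by a finite list of pairs of a monomial and a scalar,
  and the bijection packs such a list into one scalar.\<close>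

lemma finite_support_embedding:
  obtains E :: "((nat + nat) monomial \<Rightarrow> 'f::field_char_0) \<Rightarrow> 'f" where "inj_on E {h. finite {w. h w \<noteq> 0}}"
proof -
  have "infinite (UNIV :: 'f set)"
    by (rule infinite_UNIV_char_0)
  then have "\<exists>q :: 'f \<times> 'f \<Rightarrow> 'f. bij_betw q (UNIV \<times> UNIV) UNIV"
    unfolding card_of_ordIso by (rule card_of_Times_same_infinite)
  then obtain q :: "'f \<times> 'f \<Rightarrow> 'f" where q: "inj q"
    by (auto dest: bij_betw_imp_inj_on)
  let ?graph = "\<lambda>h :: (nat + nat) monomial \<Rightarrow> 'f. (\<lambda>w. (w, h w)) ` {w. h w \<noteq> 0}"
  define l where "l h = (SOME l. set l = ?graph h)" for h
  have l: "set (l h) = ?graph h" if "finite {w. h w \<noteq> 0}" for h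
    unfolding l_def using finite_list[OF finite_imageI[OF that, of "\<lambda>w. (w, h w)"]] by (rule someI_ex)
  define c where "c = (\<lambda>(w, x). q (encode_monomial q w, x))"
  have c: "inj c"
    by (rule injI) (auto simp: c_def dest!: injD[OF q] encode_monomial_inject[OF q])
  define E where "E h = q (of_nat (length (l h)), encode_list q 0 (map c (l h)))" for h
  have "inj_on E {h. finite {w. h w \<noteq> 0}}"
  proof (rule inj_onI)
    fix h k assume hk: "h \<in> {h. finite {w. h w \<noteq> 0}}" "k \<in> {h. finite {w. h w \<noteq> 0}}" "E h = E k"
    then have "length (l h) = length (l k)" "encode_list q 0 (map c (l h)) = encode_list q 0 (map c (l k))"
      by (auto simp: E_def dest!: injD[OF q])
    then have "map c (l h) = map c (l k)"
      by (intro encode_list_inject[OF q]) simp_all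
    then have graph: "?graph h = ?graph k"
      using c l[of h] l[of k] hk by (simp add: inj_map_eq_map)
    show "h = k"
    proof
      fix w
      show "h w = k w"
      proof (cases "h w = 0 \<and> k w = 0")
        case False
        then have "(w, h w) \<in> ?graph k \<or> (w, k w) \<in> ?graph h"
          using graph by blast
        then show ?thesis
          by auto
      qed simp
    qed
  qed
  then show ?thesis
    by (rule that)
qed

lemma coset_embedding:
  fixes J :: "((nat + nat) monomial \<Rightarrow> 'f::field_char_0) set"
  assumes J: "graded_ideal J (free_superalgebra r s)"
  obtains E :: "((nat + nat) monomial \<Rightarrow> 'f) set \<Rightarrow> 'f"
    where "inj_on E (carrier (quotient_superalgebra (free_superalgebra r s) J))"
proof -
  let ?A = "free_superalgebra r s :: ('f, _) superalgebra"
  note sub = graded_ideal_submodule[OF free_is_superalgebra J]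
  obtain E :: "((nat + nat) monomial \<Rightarrow> 'f) \<Rightarrow> 'f" where E: "inj_on E {h. finite {w. h w \<noteq> 0}}"
    by (rule finite_support_embedding)
  define rep where "rep C = (SOME h. h \<in> C)" for C :: "((nat + nat) monomial \<Rightarrow> 'f) set"
  have rep: "rep C \<in> carrier ?A \<and> C = J +>\<^bsub>?A\<^esub> rep C" if C: "C \<in> carrier (quotient_superalgebra ?A J)" for C
  proof -
    obtain a where a: "a \<in> carrier ?A" "C = J +>\<^bsub>?A\<^esub> a"
      using C by (auto simp: quotient_simps[OF free_is_superalgebra J])
    then have "rep C \<in> C"
      unfolding rep_def using free.coset_self[OF sub a(1)] by (metis someI)
    then obtain j where "j \<in> J" "rep C = j \<oplus>\<^bsub>?A\<^esub> a"
      unfolding a(2) free.coset_elem[OF sub] by blast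
    then show ?thesis
      using a free.coset_absorb[OF sub _ a(1)] free.submodule_carrier[OF sub] free.a_closed by metis
  qed
  have "inj_on (\<lambda>C. E (rep C)) (carrier (quotient_superalgebra ?A J))"
  proof (rule inj_onI)
    fix C D assume CD: "C \<in> carrier (quotient_superalgebra ?A J)" "D \<in> carrier (quotient_superalgebra ?A J)"
      "E (rep C) = E (rep D)"
    then have "rep C = rep D"
      using rep[OF CD(1)] rep[OF CD(2)] by (intro inj_onD[OF E]) (auto simp: free_carrier)
    then show "C = D"
      using rep[OF CD(1)] rep[OF CD(2)] by simp
  qed
  then show ?thesis
    by (rule that)
qed

lemma supervariety_iff:
  fixes A :: "('f::field_char_0, 'u) superalgebra"
  shows "A \<in> alt_metabelian_supervariety r s \<longleftrightarrow> superalgebra A \<and>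
    (\<forall>n f. identities r s n f \<longrightarrow> satisfies_superidentity A n f)"
  by (simp add: alt_metabelian_supervariety_def generated_supervariety_def identities_def)

lemma supervariety_subset:
  assumes "\<And>n (f :: nat monomial \<Rightarrow> 'f::field_char_0). identities r' s' n f \<Longrightarrow> identities r s n f"
  shows "(alt_metabelian_supervariety r s :: ('f, 'u) superalgebra set) \<subseteq> alt_metabelian_supervariety r' s'"
  using assms by (auto simp: supervariety_iff)

text \<open>The copy on \<open>'u\<close> of the free superalgebra with \<open>r'\<close> and
  \<open>s'\<close> generators lies in the supervariety that it generates and violates
  \<open>f\<close>, which holds throughout the smaller one.\<close>

lemma supervariety_strict:
  fixes emb :: "'f::field_char_0 \<Rightarrow> 'u" and f :: "nat monomial \<Rightarrow> 'f"
  assumes emb: "inj emb" and f: "identities r s n f" "\<not> identities r' s' n f"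
    and sub: "\<And>n (f :: nat monomial \<Rightarrow> 'f). identities r' s' n f \<Longrightarrow> identities r s n f"
  shows "(alt_metabelian_supervariety r s :: ('f, 'u) superalgebra set) \<subset> alt_metabelian_supervariety r' s'"
proof -
  let ?F = "free_alt_metabelian_superalgebra r' s' :: ('f, _) superalgebra"
  note J = alt_metabelian_ideal_graded[OF alt_metabelian_ideals_nonempty, of r' s']
  obtain E :: "_ \<Rightarrow> 'f" where E: "inj_on E (carrier ?F)"
    unfolding free_alt_metabelian_superalgebra_def by (rule coset_embedding[OF J])
  have "superalgebra ?F"
    unfolding free_alt_metabelian_superalgebra_def by (rule quotient_is_superalgebra[OF free_is_superalgebra J])
  moreover have "inj_on (emb \<circ> E) (carrier ?F)"
    using E emb by (intro comp_inj_on) (auto intro: inj_on_subset)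
  ultimately obtain A :: "('f, 'u) superalgebra" where A: "superalgebra A"
    "\<And>n f. multilinear_polynomial n f \<Longrightarrow> satisfies_superidentity A n f \<longleftrightarrow> satisfies_superidentity ?F n f"
    by (rule transport_superalgebra) (rule that)
  then have "A \<in> alt_metabelian_supervariety r' s'"
    by (simp add: supervariety_iff identities_def)
  moreover have "A \<notin> alt_metabelian_supervariety r s"
    using A f by (auto simp: supervariety_iff identities_def)
  ultimately show ?thesis
    using supervariety_subset[of r' s' r s, OF sub, where 'u = 'u] by blast
qed

section \<open>Comparison of the supervarieties\<close>

lemma identities_1_1:
  fixes f :: "nat monomial \<Rightarrow> 'f::field_char_0"
  assumes "1 \<le> r" "1 \<le> s" "identities r s n f"
  shows "identities r' s' n f"
proof (rule identities_everywhere)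
  have f: "identities 1 1 n f"
    by (rule identities_mono[OF assms(3,1,2)])
  show "identities 0 1 n f"
    by (rule identities_mono[OF f]) simp_all
  show "n = 3 \<Longrightarrow> (\<Sum>w\<in>{w. f w \<noteq> 0}. f w) = 0"
    using f identities_1_1_sum by blast
qed

lemma identities_0_3:
  fixes f :: "nat monomial \<Rightarrow> 'f::field_char_0"
  assumes "3 \<le> s" "identities r s n f"
  shows "identities r' s' n f"
proof (rule identities_everywhere)
  have f: "identities 0 3 n f"
    by (rule identities_mono[OF assms(2)]) (use assms(1) in simp_all)
  show "identities 0 1 n f"
    by (rule identities_mono[OF f]) simp_all
  show "n = 3 \<Longrightarrow> (\<Sum>w\<in>{w. f w \<noteq> 0}. f w) = 0"
    using f identities_0_3_sum by blast
qed

lemma identities_0_1_0_2: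
  fixes f :: "nat monomial \<Rightarrow> 'f::field_char_0"
  assumes f: "identities 0 1 n f"
  shows "identities 0 2 n f"
proof (cases "n = 3")
  case True
  have ml: "multilinear_polynomial 3 f"
    using f True by (simp add: identities_def)
  show ?thesis
    unfolding True
  proof (rule identities_0_2[OF ml])
    fix J :: "((nat + nat) monomial \<Rightarrow> 'f) set" and b :: "nat \<Rightarrow> _"
    let ?G = "grassmann_envelope (quotient_superalgebra (free_superalgebra 0 2) J)"
    assume J: "J \<in> alt_metabelian_ideals 0 2" and b: "\<And>i. b i \<in> carrier ?G"
    show "polynomial_value ?G f b = ((\<Sum>w\<in>{w. f w \<noteq> 0}. f w) / 6) \<odot>\<^bsub>?G\<^esub>
        alt_metabelian_algebra_char_0.symmetric_cube ?G (b 0) (b 1) (b 2)"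
      using polynomial_value_of_identities[OF f envelope_alt_metabelian[OF J] b] True by simp
  qed
qed (use identities_everywhere[OF f] in simp)

lemma linearised_cube_not_identity:
  "\<not> identities 1 1 3 (linearised_cube :: _ \<Rightarrow> 'f::field_char_0)"
  "\<not> identities 0 3 3 (linearised_cube :: _ \<Rightarrow> 'f::field_char_0)"
proof -
  have "(\<Sum>w\<in>{w. linearised_cube w \<noteq> (0 :: 'f)}. linearised_cube w) \<noteq> (0 :: 'f)"
    unfolding linearised_cube_sum by simp
  then show "\<not> identities 1 1 3 (linearised_cube :: _ \<Rightarrow> 'f)" "\<not> identities 0 3 3 (linearised_cube :: _ \<Rightarrow> 'f)"
    using identities_1_1_sum identities_0_3_sum by blast+
qed

text \<open>One polynomial serves both strict inclusions: it fails with a further even generator,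
  and it fails already for a single odd generator alone.\<close>

lemma separating_identity:
  assumes "1 \<le> r"
  obtains n and f :: "nat monomial \<Rightarrow> 'f::field_char_0"
  where "identities r 0 n f" "\<not> identities (r + 1) 0 n f" "\<not> identities r 1 n f"
proof (cases "r = 1")
  case True
  have "\<not> identities 1 1 3 (inner_commutator :: _ \<Rightarrow> 'f)"
    using inner_commutator_not_identity_odd identities_mono[of 1 1 3 "inner_commutator :: _ \<Rightarrow> 'f" 0 1] by auto
  then show ?thesis
    using that[of 3 inner_commutator] inner_commutator_identity inner_commutator_not_identity_even True
    by (simp add: numeral_2_eq_2)
next
  case False
  let ?f = "basis_element (left_word (r + 1)) :: _ \<Rightarrow> 'f"
  have "\<not> identities r 1 (r + 2) ?f"
  proof
    assume "identities r 1 (r + 2) ?f"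
    then have "identities 0 1 (Suc (Suc r)) (basis_element (left_word (Suc r)) :: _ \<Rightarrow> 'f)"
      using identities_mono[of r 1 "r + 2" ?f 0 1] by simp
    then show False
      using left_word_not_identity_odd by blast
  qed
  moreover have "identities r 0 (r + 2) ?f"
    by (rule left_word_identity) (use assms False in simp)
  ultimately show ?thesis
    using that left_word_not_identity_even by blast
qed

theorem theorem2:
  fixes emb :: "'f::field_char_0 \<Rightarrow> 'u"
  assumes "inj emb"
  shows "let V = (alt_metabelian_supervariety :: nat \<Rightarrow> nat \<Rightarrow> ('f, 'u) superalgebra set) in
    (\<forall>r\<ge>1. V r 0 \<subset> V (r + 1) 0 \<and> V r 0 \<subset> V r 1) \<and>
    (V 0 1 \<subset> V 1 1 \<and> V 0 2 \<subset> V 1 2 \<and> V 0 1 = V 0 2 \<and> V 0 2 \<subset> V 0 3) \<and>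
    (\<forall>r\<ge>1. \<forall>s\<ge>1. V r s = V (r + 1) s \<and> V r s = V r (s + 1)) \<and>
    (\<forall>s\<ge>3. V 0 s = V 1 s \<and> V 0 s = V 0 (s + 1))"
proof -
  let ?V = "alt_metabelian_supervariety :: nat \<Rightarrow> nat \<Rightarrow> ('f, 'u) superalgebra set"
  let ?c = "linearised_cube :: nat monomial \<Rightarrow> 'f"
  have strict: "?V r 0 \<subset> ?V (r + 1) 0 \<and> ?V r 0 \<subset> ?V r 1" if r: "1 \<le> r" for r
  proof -
    obtain n and f :: "nat monomial \<Rightarrow> 'f" where
      f: "identities r 0 n f" "\<not> identities (r + 1) 0 n f" "\<not> identities r 1 n f"
      by (rule separating_identity[OF r])
    show ?thesis
      by (intro conjI supervariety_strict[OF assms f(1,2)] supervariety_strict[OF assms f(1,3)])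
        (erule identities_mono; simp)+
  qed
  have c: "identities 0 1 3 ?c"
    by (rule identities_mono[OF linearised_cube_identity]) simp_all
  have c12: "\<not> identities 1 2 3 ?c"
    using linearised_cube_not_identity(1) identities_mono[of 1 2 3 ?c 1 1] by auto
  have V01: "?V 0 1 \<subset> ?V 1 1"
    by (intro supervariety_strict[OF assms c linearised_cube_not_identity(1)]) (erule identities_mono; simp)
  have V02: "?V 0 2 \<subset> ?V 1 2"
    by (intro supervariety_strict[OF assms linearised_cube_identity c12]) (erule identities_mono; simp)
  have V03: "?V 0 2 \<subset> ?V 0 3"
    by (intro supervariety_strict[OF assms linearised_cube_identity linearised_cube_not_identity(2)])
      (erule identities_mono; simp)
  have eq: "?V 0 1 = ?V 0 2"
  proof (rule subset_antisym)
    show "?V 0 1 \<subseteq> ?V 0 2"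
      by (intro supervariety_subset) (erule identities_mono; simp)
    show "?V 0 2 \<subseteq> ?V 0 1"
      by (intro supervariety_subset identities_0_1_0_2)
  qed
  have V11: "?V r s = ?V r' s'" if "1 \<le> r" "1 \<le> s" "1 \<le> r'" "1 \<le> s'" for r s r' s'
    by (intro subset_antisym supervariety_subset; erule identities_1_1[rotated 2]; fact that)
  have V3: "?V 0 s = ?V r' s'" if "3 \<le> s" "3 \<le> s'" for s r' s'
    by (intro subset_antisym supervariety_subset; erule identities_0_3[rotated]; fact that)
  have V31: "?V 0 s = ?V 1 s" "?V 0 s = ?V 0 (s + 1)" if "3 \<le> s" for s
    using V3[of s s 1] V3[of s "s + 1" 0] that by simp_all
  have V1: "?V r s = ?V (r + 1) s" "?V r s = ?V r (s + 1)" if "1 \<le> r" "1 \<le> s" for r s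
    by (rule V11; use that in simp)+
  show ?thesis
    unfolding Let_def
    by (intro conjI allI impI strict[THEN conjunct1] strict[THEN conjunct2] V01 V02 V03 eq V1 V31)
qed

end
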